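(* Let $X_1,\dots,X_n$ be i.i.d. $N(0,\Sigma)$ random variables in a separable Banach space $E$. (i) If $f:L(E^{\ast},E)\to\mathbb{R}$ satisfies the Hölder condition with exponent $\rho\in(0,1]$, then $$\bigl\|f(\hat\Sigma_n)-f(\Sigma)\bigr\|_{L_{\psi_{1/\rho}}(\mathbb{P}_\Sigma)}\lesssim\|f\|_{\mathrm{Lip}_\rho}\|\Sigma\|^\rho\Bigl(\sqrt{\tfrac{\mathbf{r}(\Sigma)}{n}}\vee\tfrac{\mathbf{r}(\Sigma)}{n}\Bigr)^{\rho}.$$ (ii) If $f:L(E^{\ast},E)\to\mathbb{R}$ is Lipschitz and Fréchet continuously differentiable with derivative $f'$ satisfying the Hölder condition with exponent $\rho\in(0,1]$, then $$\bigl\|f(\hat\Sigma_n)-f(\Sigma)\bigr\|_{L_{\psi_1}(\mathbb{P}_\Sigma)}\lesssim\|f\|_{\mathrm{Lip}}\Bigl(\sqrt{\tfrac{\mathbf{r}(\Sigma)}{n}}\vee1\Bigr)\frac{\|\Sigma\|}{\sqrt n}+\|f'\|_{\mathrm{Lip}_\rho}\|\Sigma\|^{1+\rho}\Bigl(\sqrt{\tfrac{\mathbf{r}(\Sigma)}{n}}\vee\tfrac{\mathbf{r}(\Sigma)}{n}\Bigr)^{1+\rho}.$$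
   Context: $E$ is a separable Banach space with dual $E^\ast$; $\langle x,u\rangle$ is the value of $u\in E^\ast$ at $x\in E$. $L(E^\ast,E)$ is the space of bounded linear operators $A:E^\ast\to E$ with the operator norm. $X\sim N(0,\Sigma)$ is a centered Gaussian random variable in $E$ with covariance operator $\Sigma u=\mathbb{E}\langle X,u\rangle X$. The sample covariance operator of i.i.d. copies $X_1,\dots,X_n$ is $\hat\Sigma_n u=n^{-1}\sum_{j=1}^n\langle X_j,u\rangle X_j$. The effective rank is $\mathbf{r}(\Sigma)=\mathbb{E}\|X\|^2/\|\Sigma\|$ (for $\Sigma\ne0$). For $\alpha>0$, the $\psi_\alpha$-norm of a real random variable is $\|\eta\|_{L_{\psi_\alpha}(\mathbb{P}_\Sigma)}:=\sup_{p\ge1}p^{-1/\alpha}(\mathbb{E}_\Sigma|\eta|^p)^{1/p}$ (for $\alpha\ge1$ equivalent to the Orlicz norm with $\psi_\alpha(u)=e^{u^\alpha}-1$). For a map $g$ between Banach spaces, $\|g\|_{\mathrm{Lip}_\rho}=\sup_{x\ne y}\|g(x)-g(y)\|/\|x-y\|^\rho$ and $\|g\|_{\mathrm{Lip}}=\|g\|_{\mathrm{Lip}_1}$. $A\lesssim B$ means $A\le CB$ with a numerical constant $C>0$. $a\vee b=\max(a,b)$. *)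

theory Defs
  imports "HOL-Probability.Probability"
begin

text \<open>
  A real separable Banach space \<open>E\<close> is a type \<open>'e :: {banach, second_countable_topology}\<close>; its dual is
  \<open>'e \<Rightarrow>\<^sub>L real\<close>, the duality pairing is application, and the space of bounded operators
  from the dual to \<open>E\<close> is \<open>('e \<Rightarrow>\<^sub>L real) \<Rightarrow>\<^sub>L 'e\<close> with the operator norm.
\<close>

type_synonym 'e dual_op = "('e \<Rightarrow>\<^sub>L real) \<Rightarrow>\<^sub>L 'e"

text \<open>
  The law \<open>N(0, \<Sigma>)\<close>. A one-dimensional marginal may be degenerate (\<open>\<sigma> = 0\<close>), which the density
  \<open>normal_density\<close> does not cover. The last conjunct says
  \<open>\<Sigma> u = E \<langle>X, u\<rangle> X\<close>, the integral being a Bochner integral that exists.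
\<close>

definition centered_normal :: "real \<Rightarrow> real measure" where
  "centered_normal \<sigma> =
     (if \<sigma> = 0 then return borel 0 else density lborel (\<lambda>x. ennreal (normal_density 0 \<sigma> x)))"

definition gaussian_law ::
  "('e :: {banach, second_countable_topology}) dual_op \<Rightarrow> 'e measure \<Rightarrow> bool" where
  "gaussian_law \<Sigma> \<mu> \<longleftrightarrow>
     prob_space \<mu> \<and> sets \<mu> = sets borel \<and>
     (\<forall>u :: 'e \<Rightarrow>\<^sub>L real. \<exists>\<sigma>\<ge>0. distr \<mu> borel (\<lambda>x. blinfun_apply u x) = centered_normal \<sigma>) \<and>
     (\<forall>u :: 'e \<Rightarrow>\<^sub>L real.
        has_bochner_integral \<mu> (\<lambda>x. blinfun_apply u x *\<^sub>R x) (blinfun_apply \<Sigma> u))"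

definition iid_sample ::
  "'a measure \<Rightarrow> nat \<Rightarrow> (nat \<Rightarrow> 'a \<Rightarrow> 'e :: {banach, second_countable_topology}) \<Rightarrow> 'e measure \<Rightarrow> bool"
  where
  "iid_sample M n X \<mu> \<longleftrightarrow>
     prob_space.indep_vars M (\<lambda>_. borel) X {1..n} \<and> (\<forall>j\<in>{1..n}. distr M borel (X j) = \<mu>)"

definition sample_cov ::
  "nat \<Rightarrow> (nat \<Rightarrow> 'a \<Rightarrow> 'e :: {banach, second_countable_topology}) \<Rightarrow> 'a \<Rightarrow> 'e dual_op" where
  "sample_cov n X \<omega> =
     Blinfun (\<lambda>u. (1 / real n) *\<^sub>R (\<Sum>j=1..n. blinfun_apply u (X j \<omega>) *\<^sub>R X j \<omega>))"

lemma sample_cov_apply: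
  "blinfun_apply (sample_cov n X \<omega>) u =
     (1 / real n) *\<^sub>R (\<Sum>j=1..n. blinfun_apply u (X j \<omega>) *\<^sub>R X j \<omega>)"
proof -
  have "bounded_linear (\<lambda>u. (1 / real n) *\<^sub>R (\<Sum>j=1..n. blinfun_apply u (X j \<omega>) *\<^sub>R X j \<omega>))"
    by (intro bounded_linear_intros)
  then show ?thesis
    unfolding sample_cov_def by (simp add: bounded_linear_Blinfun_apply)
qed

text \<open>The value at \<open>\<Sigma> = 0\<close>, where the effective rank is undefined, is \<open>0\<close>; it is only ever
  multiplied by a positive power of \<open>norm \<Sigma>\<close>.\<close>

definition effective_rank ::
  "('e :: {banach, second_countable_topology}) dual_op \<Rightarrow> 'e measure \<Rightarrow> real" where
  "effective_rank \<Sigma> \<mu> = (\<integral>x. (norm x)\<^sup>2 \<partial>\<mu>) / norm \<Sigma>"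

definition Lp_norm :: "'a measure \<Rightarrow> real \<Rightarrow> ('a \<Rightarrow> real) \<Rightarrow> ennreal" where
  "Lp_norm M p \<eta> =
     (let I = (\<integral>\<^sup>+\<omega>. ennreal (\<bar>\<eta> \<omega>\<bar> powr p) \<partial>M)
      in if I = \<top> then \<top> else ennreal (enn2real I powr (1 / p)))"

definition psi_norm :: "real \<Rightarrow> 'a measure \<Rightarrow> ('a \<Rightarrow> real) \<Rightarrow> ennreal" where
  "psi_norm \<alpha> M \<eta> = (SUP p\<in>{1..}. ennreal (p powr (- 1 / \<alpha>)) * Lp_norm M p \<eta>)"

definition holder_norm ::
  "real \<Rightarrow> ('b :: real_normed_vector \<Rightarrow> 'c :: real_normed_vector) \<Rightarrow> ennreal" where
  "holder_norm \<rho> g =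
     (SUP (x, y)\<in>{(x, y). x \<noteq> y}. ennreal (norm (g x - g y) / norm (x - y) powr \<rho>))"

text \<open>
  A numerical constant may depend neither on the space \<open>E\<close> nor on the probability space. Both are
  types, and a formula cannot quantify over types, so a bare \<open>\<exists>C > 0\<close> would yield one constant per
  instance. The bound below, whose value is immaterial, makes the constants uniform over all types.
\<close>

definition numerical_constant :: "real \<Rightarrow> bool" where
  "numerical_constant C \<longleftrightarrow> 0 < C \<and> C \<le> 10 ^ 100"

end

theory Submission
  imports Defs
begin

text \<open>
  Everything reduces to the moments of \<open>norm (sample_cov n X \<omega> - \<Sigma>)\<close> (the Koltchinskii--Lounici
  bound) and, in the smooth case, to a concentration inequality.

  The product of the laws of the observations is invariant under rotations of two independent copies.
  Decoupling by such a rotation replaces the quadratic deviation by a bilinear form in \<open>x\<close> and \<open>y\<close>, which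
  is Gaussian given \<open>x\<close>. Its norm is compared with a sum of two Gaussian linear forms as in Chevet's
  inequality; since the comparison is applied to exponential moments, no concentration argument is
  needed: the exponential moment of the deviation is at most a fraction of itself plus a constant, and
  it is known to be finite.
  The comparison itself interpolates along the rotation and uses Gaussian integration by parts, which
  is the derivative of the rotation invariance.

  If \<open>f\<close> is smooth, the linear term of its Taylor expansion at \<open>\<Sigma>\<close> has mean zero, so the bias has the order
  \<open>1 + \<rho>\<close> of the remainder. The fluctuation around the mean is controlled by the Maurey--Pisier inequality:
  the derivative of \<open>f\<close> along the rotation is a conditionally Gaussian variable whose variance is at most
  of order \<open>norm \<Sigma> / n\<close> times \<open>norm (sample_cov n X \<omega>)\<close>.
\<close>

section \<open>Norming functionals\<close>

text \<open>For fixed x, Chevet's bound contains the largest sum of squares of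
  \<open>u (x k)\<close> over the dual unit ball, which is at most \<open>n\<close> times the norm
  of the sample covariance. The unknown thus reappears under a square root. Young's inequality
  returns it at half the original rate in the exponent, and this shape can be absorbed; hence one
  exponential moment, at the rate \<open>1 / (12000 * rate n)\<close>, is the central estimate. It
  yields all moments of order q with the growth q^q that the psi-norms require. Neither the dual of
  E nor the operator space need be separable. Suprema therefore run over a countable norming
  sequence in the dual ball, and operator-valued means are tested against pairs of functionals; the
  Hahn-Banach argument below serves both purposes. All auxiliary Gaussian families are coordinates
  of one infinite product of the law, where identities between laws reduce to characteristic
  functionals. The factor 500 inside 12000 comes from Fernique's theorem: \<open>exp\<close> of the
  squared norm divided by 500 times its mean has integral at most 2.\<close>

definition sublinear :: "('a::real_vector \<Rightarrow> real) \<Rightarrow> bool" where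
  "sublinear q \<longleftrightarrow> (\<forall>x y. q (x + y) \<le> q x + q y) \<and> (\<forall>t x. 0 \<le> t \<longrightarrow> q (t *\<^sub>R x) = t * q x)"

lemma sublinearD:
  assumes "sublinear q"
  shows "q (x + y) \<le> q x + q y" and "0 \<le> t \<Longrightarrow> q (t *\<^sub>R x) = t * q x"
    and "q 0 = 0" and "- q (- x) \<le> q x"
proof -
  show "q (x + y) \<le> q x + q y" and scale: "0 \<le> t \<Longrightarrow> q (t *\<^sub>R x) = t * q x" for x y t
    using assms by (auto simp: sublinear_def)
  show zero: "q 0 = 0"
    using scale[of 0 0] by simp
  have "q (x + - x) \<le> q x + q (- x)"
    using assms unfolding sublinear_def by blast
  then show "- q (- x) \<le> q x"
    using zero by simp
qed

text \<open>This construction lowers a sublinear functional until it is additive in the direction \<open>y\<close>;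
  minimal sublinear functionals are therefore linear.\<close>

definition lower_along :: "('a::real_vector \<Rightarrow> real) \<Rightarrow> 'a \<Rightarrow> 'a \<Rightarrow> real" where
  "lower_along q y z = (INF t\<in>{0..}. q (z + t *\<^sub>R y) - t * q y)"

lemma lower_along_le:
  assumes "sublinear q" and "0 \<le> t"
  shows "lower_along q y z \<le> q (z + t *\<^sub>R y) - t * q y"
proof -
  \<comment> \<open>Subadditivity on \<open>t y = (z + t y) + (- z)\<close> bounds the set from
    below, so the real infimum is meaningful.\<close>
  have "- q (- z) \<le> q (z + t *\<^sub>R y) - t * q y" if "0 \<le> t" for t
    using sublinearD(1)[OF assms(1), of "z + t *\<^sub>R y" "- z"] sublinearD(2)[OF assms(1) that, of y]
    by simp
  then have "bdd_below ((\<lambda>t. q (z + t *\<^sub>R y) - t * q y) ` {0..})"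
    by (auto intro!: bdd_belowI2)
  then show ?thesis
    unfolding lower_along_def using assms(2) by (auto intro!: cINF_lower)
qed

lemma lower_along_sublinear:
  assumes "sublinear q"
  shows "sublinear (lower_along q y)"
  unfolding sublinear_def
proof (intro conjI allI impI)
  note q = sublinearD[OF assms]
  have greatest: "c \<le> lower_along q y z" if "\<And>t. 0 \<le> t \<Longrightarrow> c \<le> q (z + t *\<^sub>R y) - t * q y" for c z
    unfolding lower_along_def using that by (auto intro!: cINF_greatest)
  show "lower_along q y (a + b) \<le> lower_along q y a + lower_along q y b" for a b
  proof -
    have "lower_along q y (a + b) \<le> (q (a + t *\<^sub>R y) - t * q y) + (q (b + s *\<^sub>R y) - s * q y)"
      if "0 \<le> t" "0 \<le> s" for t s
      using lower_along_le[OF assms, of "t + s" y "a + b"] that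
        q(1)[of "a + t *\<^sub>R y" "b + s *\<^sub>R y"] by (simp add: algebra_simps)
    then have "lower_along q y (a + b) - (q (a + t *\<^sub>R y) - t * q y) \<le> lower_along q y b"
      if "0 \<le> t" for t
      using that by (intro greatest) (smt (verit))
    then have "lower_along q y (a + b) - lower_along q y b \<le> lower_along q y a"
      by (intro greatest) (smt (verit))
    then show ?thesis by simp
  qed
  show "lower_along q y (t *\<^sub>R x) = t * lower_along q y x" if "0 \<le> t" for t x
  proof (cases "t = 0")
    case True
    have "lower_along q y 0 \<le> 0" using lower_along_le[OF assms, of 0 y 0] q(3) by simp
    moreover have "0 \<le> lower_along q y 0" using q(2) by (intro greatest) simp
    ultimately show ?thesis using True by simp
  next
    case False
    then have t: "0 < t" using that by simp
    \<comment> \<open>One inequality for every positive factor suffices: the reverse one is its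
      instance at \<open>1 / t\<close>.\<close>
    have le: "s * lower_along q y z \<le> lower_along q y (s *\<^sub>R z)" if s: "0 < s" for s z
    proof (rule greatest)
      fix r :: real assume r: "0 \<le> r"
      have "s * lower_along q y z \<le> s * (q (z + (r / s) *\<^sub>R y) - (r / s) * q y)"
        using lower_along_le[OF assms, of "r / s" y z] r s by (intro mult_left_mono) auto
      also have "\<dots> = q (s *\<^sub>R (z + (r / s) *\<^sub>R y)) - r * q y"
        using s by (simp add: q(2) algebra_simps del: scaleR_add_right)
      finally show "s * lower_along q y z \<le> q (s *\<^sub>R z + r *\<^sub>R y) - r * q y"
        using s by (simp add: scaleR_add_right)
    qed
    have "(1 / t) * lower_along q y (t *\<^sub>R x) \<le> lower_along q y ((1 / t) *\<^sub>R (t *\<^sub>R x))"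
      using le[of "1 / t" "t *\<^sub>R x"] t by simp
    then have "lower_along q y (t *\<^sub>R x) \<le> t * lower_along q y x"
      using t by (simp add: field_simps)
    then show ?thesis using le[OF t, of x] by simp
  qed
qed

text \<open>Zorn's lemma for the reversed pointwise order. A chain has its pointwise infimum as
  bound: \<open>- p (- x)\<close> keeps it finite, and it is subadditive because any two members of
  a chain are comparable, so the smaller one can serve at both arguments.\<close>

lemma minimal_sublinear_exists:
  fixes p :: "'a::real_vector \<Rightarrow> real"
  assumes "sublinear p"
  obtains q where "sublinear q" "q \<le> p" "\<And>q'. sublinear q' \<Longrightarrow> q' \<le> q \<Longrightarrow> q' = q"
proof -
  define A where "A = {q. sublinear q \<and> q \<le> p}"
  have "\<exists>m\<in>A. \<forall>a\<in>A. a \<le> m \<longrightarrow> a = m"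
  proof (rule predicate_Zorn[where P = "\<lambda>x y. y \<le> x"])
    show "partial_order_on A (relation_of (\<lambda>x y. y \<le> x) A)"
      by (rule partial_order_on_relation_ofI) auto
  next
    fix C assume "C \<in> Chains (relation_of (\<lambda>x y. y \<le> x) A)"
    then have C: "C \<subseteq> A" and tot: "\<And>a b. a \<in> C \<Longrightarrow> b \<in> C \<Longrightarrow> a \<le> b \<or> b \<le> a"
      by (auto simp: Chains_def relation_of_def)
    show "\<exists>u\<in>A. \<forall>a\<in>C. u \<le> a"
    proof (cases "C = {}")
      case True
      then show ?thesis using assms by (auto simp: A_def)
    next
      case False
      define u where "u x = (INF q\<in>C. q x)" for x
      have sub: "sublinear q" and lep: "q x \<le> p x" if "q \<in> C" for q x
        using that C by (auto simp: A_def le_fun_def)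
      have lb: "- p (- x) \<le> q x" if "q \<in> C" for q x
        using sublinearD(4)[OF sub[OF that], of x] lep[OF that, of "- x"] by simp
      have le: "u x \<le> q x" if "q \<in> C" for q x
        unfolding u_def using that lb by (auto intro!: cINF_lower bdd_belowI2)
      have greatest: "c \<le> u x" if "\<And>q. q \<in> C \<Longrightarrow> c \<le> q x" for c x
        unfolding u_def using that False by (auto intro!: cINF_greatest)
      have "u (a + b) \<le> q a + q' b" if "q \<in> C" "q' \<in> C" for q q' a b
      proof -
        have "q \<le> q' \<or> q' \<le> q" using tot that by blast
        then show ?thesis
        proof
          assume "q \<le> q'"
          then have "q b \<le> q' b" by (simp add: le_fun_def)
          then show ?thesis using le[OF that(1), of "a + b"] sublinearD(1)[OF sub[OF that(1)], of a b] by simp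
        next
          assume "q' \<le> q"
          then have "q' a \<le> q a" by (simp add: le_fun_def)
          then show ?thesis using le[OF that(2), of "a + b"] sublinearD(1)[OF sub[OF that(2)], of a b] by simp
        qed
      qed
      then have "u (a + b) - q a \<le> u b" if "q \<in> C" for q a b
        using that by (intro greatest) (smt (verit))
      then have "u (a + b) - u b \<le> u a" for a b
        by (intro greatest) (smt (verit))
      then have add: "u (a + b) \<le> u a + u b" for a b by (smt (verit))
      have pos: "t * u x \<le> u (t *\<^sub>R x)" if "0 \<le> t" for t x
      proof (rule greatest)
        fix q assume q: "q \<in> C"
        show "t * u x \<le> q (t *\<^sub>R x)"
          using sublinearD(2)[OF sub[OF q] that, of x] le[OF q, of x] that by (simp add: mult_left_mono)
      qed
      have scale: "u (t *\<^sub>R x) = t * u x" if "0 \<le> t" for t x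
      proof (cases "t = 0")
        case True
        have "(\<lambda>q. q 0) ` C = (\<lambda>q. 0) ` C"
          by (intro image_cong refl sublinearD(3)[OF sub])
        then have "u 0 = 0" using \<open>C \<noteq> {}\<close> by (simp add: u_def image_constant_conv)
        then show ?thesis using True by simp
      next
        case False
        then have t: "0 < t" using that by simp
        have "(1 / t) * u (t *\<^sub>R x) \<le> u ((1 / t) *\<^sub>R (t *\<^sub>R x))" by (rule pos) (use t in simp)
        then have "u (t *\<^sub>R x) \<le> t * u x" using t by (simp add: field_simps)
        then show ?thesis using pos[OF that, of x] by simp
      qed
      obtain q0 where q0: "q0 \<in> C" using False by blast
      have "u \<in> A"
        unfolding A_def sublinear_def le_fun_def
        by (intro CollectI conjI allI impI add scale) (simp, rule order_trans[OF le[OF q0] lep[OF q0]])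
      then show ?thesis using le by (auto simp: le_fun_def)
    qed
  qed
  then obtain m where m: "m \<in> A" "\<And>a. a \<in> A \<Longrightarrow> a \<le> m \<Longrightarrow> a = m" by blast
  show ?thesis
  proof (rule that[of m])
    show "sublinear m" "m \<le> p" using m(1) by (auto simp: A_def)
    show "q' = m" if "sublinear q'" "q' \<le> m" for q'
    proof -
      have "q' \<le> p" using m(1) order.trans[OF that(2)] by (simp add: A_def)
      then show ?thesis using m(2)[of q'] that by (simp add: A_def)
    qed
  qed
qed

text \<open>A minimal sublinear functional q satisfies \<open>lower_along q y = q\<close> for every
  y, which makes it additive. Minimizing below \<open>lower_along norm x\<close> instead of
  \<open>norm\<close> forces \<open>q (- x) \<le> - norm x\<close>, hence the value
  \<open>norm x\<close> at x.\<close>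

theorem norming_functional_exists:
  fixes x :: "'a::real_normed_vector"
  obtains u :: "'a \<Rightarrow>\<^sub>L real" where "norm u \<le> 1" "blinfun_apply u x = norm x"
proof -
  have sn: "sublinear (norm :: 'a \<Rightarrow> real)"
    by (auto simp: sublinear_def norm_triangle_ineq)
  obtain q where q: "sublinear q" "q \<le> lower_along norm x"
    and min: "\<And>q'. sublinear q' \<Longrightarrow> q' \<le> q \<Longrightarrow> q' = q"
    using minimal_sublinear_exists[OF lower_along_sublinear[OF sn]] by metis
  have qn: "q z \<le> norm z" for z
    using q(2) lower_along_le[OF sn, of 0 x z] by (auto simp: le_fun_def intro: order_trans)
  have super: "q z + q y \<le> q (z + y)" for y z
  proof -
    have "lower_along q y \<le> q"
      using lower_along_le[OF q(1), of 0 y] by (auto simp: le_fun_def)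
    then have "lower_along q y = q"
      using min lower_along_sublinear[OF q(1)] by blast
    then show ?thesis using lower_along_le[OF q(1), of 1 y z] by simp
  qed
  have add: "q (z + y) = q z + q y" for y z
    using super sublinearD(1)[OF q(1)] by (simp add: order_antisym)
  have neg: "q (- z) = - q z" for z
    using add[of z "- z"] sublinearD(3)[OF q(1)] by simp
  have scale: "q (t *\<^sub>R z) = t * q z" for t z
  proof (cases "0 \<le> t")
    case False
    then have "q (t *\<^sub>R z) = q (- ((- t) *\<^sub>R z))" by simp
    also have "\<dots> = t * q z" using neg sublinearD(2)[OF q(1), of "- t" z] False by simp
    finally show ?thesis .
  qed (rule sublinearD(2)[OF q(1)])
  have absq: "\<bar>q z\<bar> \<le> norm z" for z
    using qn[of z] qn[of "- z"] neg[of z] by (auto simp: abs_le_iff)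
  have bl: "bounded_linear q"
    by (rule bounded_linear_intro[where K = 1]) (use add scale absq in auto)
  have "q (- x) \<le> norm (- x + 1 *\<^sub>R x) - 1 * norm x"
    using q(2) lower_along_le[OF sn, of 1 x "- x"] by (auto simp: le_fun_def intro: order_trans)
  then have "q x = norm x"
    using neg[of x] qn[of x] by simp
  moreover have "norm (Blinfun q) \<le> 1"
    using absq by (intro norm_blinfun_bound) (auto simp: bounded_linear_Blinfun_apply[OF bl])
  ultimately show ?thesis
    using that[of "Blinfun q"] by (simp add: bounded_linear_Blinfun_apply[OF bl])
qed

text \<open>Functionals norming the points of a countable dense set norm every point by
  approximation. The one-sided form of the conclusion, without absolute values, is what closed balls
  and suprema need later.\<close>

theorem norming_sequence_exists:
  obtains u :: "nat \<Rightarrow> 'a::{real_normed_vector, second_countable_topology} \<Rightarrow>\<^sub>L real"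
  where "\<And>i. norm (u i) \<le> 1"
    "\<And>x c. (\<And>i. blinfun_apply (u i) x \<le> c) \<Longrightarrow> norm x \<le> c"
proof -
  obtain D :: "'a set" where D: "countable D" "\<And>S. open S \<Longrightarrow> S \<noteq> {} \<Longrightarrow> \<exists>d\<in>D. d \<in> S"
    using countable_dense_exists by blast
  have ne: "D \<noteq> {}" using D(2)[of UNIV] by auto
  define d where "d = from_nat_into D"
  have "\<forall>x::'a. \<exists>u :: 'a \<Rightarrow>\<^sub>L real. norm u \<le> 1 \<and> blinfun_apply u x = norm x"
    using norming_functional_exists by metis
  then obtain v :: "'a \<Rightarrow> 'a \<Rightarrow>\<^sub>L real" where v: "\<And>x. norm (v x) \<le> 1" "\<And>x. blinfun_apply (v x) x = norm x"
    by metis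
  have "norm x \<le> c" if le: "\<And>i. blinfun_apply (v (d i)) x \<le> c" for x c
  proof (rule field_le_epsilon)
    fix e :: real assume e: "0 < e"
    obtain y where y: "y \<in> D" "dist x y < e / 2"
      using D(2)[of "ball x (e / 2)"] e by auto
    obtain i where i: "d i = y"
      using from_nat_into_surj[OF D(1) y(1)] by (auto simp: d_def)
    have "\<bar>blinfun_apply (v y) (y - x)\<bar> \<le> norm (v y) * norm (y - x)"
      using norm_blinfun[of "v y" "y - x"] by simp
    also have "\<dots> \<le> 1 * norm (y - x)" using v(1) by (intro mult_right_mono) auto
    finally have "blinfun_apply (v y) y \<le> blinfun_apply (v y) x + e / 2"
      using y(2) by (simp add: blinfun.diff_right dist_norm norm_minus_commute)
    moreover have "norm x \<le> norm y + e / 2"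
      using y(2) norm_triangle_ineq[of y "x - y"] by (simp add: dist_norm)
    ultimately show "norm x \<le> c + e"
      using le[of i] v(2)[of y] i by simp
  qed
  then show ?thesis using that v(1) by blast
qed

lemma functional_le_norm:
  fixes u :: "'a::real_normed_vector \<Rightarrow>\<^sub>L real"
  assumes "norm u \<le> 1"
  shows "\<bar>blinfun_apply u x\<bar> \<le> norm x"
proof -
  have "\<bar>blinfun_apply u x\<bar> \<le> norm u * norm x"
    using norm_blinfun[of u x] by simp
  also have "\<dots> \<le> 1 * norm x" using assms by (intro mult_right_mono) auto
  finally show ?thesis by simp
qed

text \<open>Pettis: a closed ball is a countable intersection of half-spaces given by the norming
  sequence, an open ball is a countable union of closed ones, and by Lindelof every open set is a
  countable union of open balls.\<close>

theorem borel_measurable_weakly: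
  fixes f :: "'b \<Rightarrow> 'a::{real_normed_vector, second_countable_topology}"
  assumes "\<And>u :: 'a \<Rightarrow>\<^sub>L real. (\<lambda>x. blinfun_apply u (f x)) \<in> borel_measurable N"
  shows "f \<in> borel_measurable N"
proof -
  obtain u :: "nat \<Rightarrow> 'a \<Rightarrow>\<^sub>L real" where u: "\<And>i. norm (u i) \<le> 1"
    "\<And>x c. (\<And>i. blinfun_apply (u i) x \<le> c) \<Longrightarrow> norm x \<le> c"
    using norming_sequence_exists by blast
  have cb: "f -` cball a r \<inter> space N \<in> sets N" for a r
  proof -
    have "f -` cball a r \<inter> space N = {x \<in> space N. \<forall>i. blinfun_apply (u i) (f x) - blinfun_apply (u i) a \<le> r}"
    proof -
      have "norm (y - a) \<le> r \<longleftrightarrow> (\<forall>i. blinfun_apply (u i) y - blinfun_apply (u i) a \<le> r)" for y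
      proof
        assume "norm (y - a) \<le> r"
        then show "\<forall>i. blinfun_apply (u i) y - blinfun_apply (u i) a \<le> r"
          using functional_le_norm[OF u(1), of _ "y - a"]
          by (simp add: blinfun.diff_right) (smt (verit))
      next
        assume "\<forall>i. blinfun_apply (u i) y - blinfun_apply (u i) a \<le> r"
        then show "norm (y - a) \<le> r"
          using u(2)[of "y - a" r] by (simp add: blinfun.diff_right)
      qed
      then show ?thesis by (auto simp: dist_norm norm_minus_commute[of a])
    qed
    also have "\<dots> \<in> sets N" using assms[measurable] by measurable
    finally show ?thesis .
  qed
  have ball: "f -` ball a r \<inter> space N \<in> sets N" for a r
  proof -
    have "ball a r = (\<Union>n. cball a (r - 1 / real (Suc n)))"
    proof (intro set_eqI iffI)
      fix y assume "y \<in> ball a r"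
      then obtain n where "1 / real (Suc n) < r - dist a y"
        using nat_approx_posE[of "r - dist a y"] by auto
      then show "y \<in> (\<Union>n. cball a (r - 1 / real (Suc n)))" by (auto intro!: exI[of _ n])
    next
      fix y assume "y \<in> (\<Union>n. cball a (r - 1 / real (Suc n)))"
      then obtain n where "dist a y \<le> r - 1 / real (Suc n)" by auto
      then show "y \<in> ball a r" by (smt (verit) mem_ball of_nat_0_less_iff zero_less_Suc zero_less_divide_1_iff)
    qed
    then have eq: "f -` ball a r \<inter> space N = (\<Union>n. f -` cball a (r - 1 / real (Suc n)) \<inter> space N)" by auto
    show ?thesis unfolding eq using cb by (intro sets.countable_UN) blast
  qed
  have union_balls: "\<exists>\<D>. countable \<D> \<and> (\<forall>B\<in>\<D>. \<exists>a r. B = ball a r) \<and> \<Union>\<D> = S" if "open S" for S :: "'a set"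
  proof -
    define F where "F = {B. \<exists>a r. B = ball a r \<and> B \<subseteq> S}"
    have "open B" if "B \<in> F" for B using that by (auto simp: F_def)
    then obtain F' where F': "F' \<subseteq> F" "countable F'" "\<Union>F' = \<Union>F"
      using Lindelof[of F] by metis
    have "S \<subseteq> \<Union>F"
    proof
      fix x assume "x \<in> S"
      then obtain e where "0 < e" "ball x e \<subseteq> S" using \<open>open S\<close> open_contains_ball by blast
      then have "ball x e \<in> F" "x \<in> ball x e" by (auto simp: F_def)
      then show "x \<in> \<Union>F" by blast
    qed
    moreover have "\<Union>F \<subseteq> S" unfolding F_def by blast
    ultimately have "\<Union>F' = S" using F'(3) by simp
    moreover have "\<forall>B\<in>F'. \<exists>a r. B = ball a r" using F'(1) by (auto simp: F_def)
    ultimately show ?thesis using F'(2) by blast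
  qed
  show ?thesis
  proof (rule borel_measurableI)
    fix S :: "'a set" assume "open S"
    then obtain \<D> where \<D>: "countable \<D>" "\<forall>B\<in>\<D>. \<exists>a r. B = ball a r" "\<Union>\<D> = S"
      using union_balls by blast
    then have eq: "f -` S \<inter> space N = (\<Union>B\<in>\<D>. f -` B \<inter> space N)" by auto
    have "f -` B \<inter> space N \<in> sets N" if "B \<in> \<D>" for B
      using ball \<D>(2) that by metis
    then show "f -` S \<inter> space N \<in> sets N"
      unfolding eq using \<D>(1) by (intro sets.countable_UN') auto
  qed
qed

section \<open>Characteristic functionals\<close>

text \<open>Levy's uniqueness theorem for the law of u after normalizing the weight to a probability
  density; weights of total mass 0 are treated apart. In the induction below the weight encodes the
  events fixed so far.\<close>

lemma weighted_law_eqI_char: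
  fixes w u :: "'w \<Rightarrow> real"
  assumes "prob_space M1" "prob_space M2"
    and sets: "sets M2 = sets M1"
    and [measurable]: "w \<in> borel_measurable M1" "u \<in> borel_measurable M1"
    and w: "\<And>x. 0 \<le> w x" "\<And>x. w x \<le> C"
    and eq: "\<And>s. (CLINT x|M1. w x * iexp (s * u x)) = (CLINT x|M2. w x * iexp (s * u x))"
    and B[measurable]: "B \<in> sets borel"
  shows "(\<integral>x. w x * indicator B (u x) \<partial>M1) = (\<integral>x. w x * indicator B (u x) \<partial>M2)"
proof -
  interpret M1: prob_space M1 by fact
  interpret M2: prob_space M2 by fact
  have meas2[measurable]: "w \<in> borel_measurable M2" "u \<in> borel_measurable M2"
    using sets by (simp_all cong: measurable_cong_sets)
  have int1: "integrable M1 w" and int2: "integrable M2 w"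
    using w by (auto intro!: M1.integrable_const_bound[where B = C] M2.integrable_const_bound[where B = C])
  define c where "c = (\<integral>x. w x \<partial>M1)"
  have c2: "c = (\<integral>x. w x \<partial>M2)"
  proof -
    have "(CLINT x|M1. complex_of_real (w x)) = (CLINT x|M2. complex_of_real (w x))"
      using eq[of 0] by simp
    then show ?thesis by (simp add: c_def)
  qed
  have c0: "0 \<le> c" using w by (simp add: c_def)
  show ?thesis
  proof (cases "c = 0")
    case True
    have "AE x in M1. w x = 0" "AE x in M2. w x = 0"
      using integral_nonneg_eq_0_iff_AE[OF int1] integral_nonneg_eq_0_iff_AE[OF int2] w True c2 c_def
      by auto
    then have "(\<integral>x. w x * indicator B (u x) \<partial>M1) = 0" "(\<integral>x. w x * indicator B (u x) \<partial>M2) = 0"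
      by (auto intro!: integral_eq_zero_AE elim!: eventually_mono)
    then show ?thesis by simp
  next
    case False
    then have c: "0 < c" using c0 by simp
    define N where "N M = distr (density M (\<lambda>x. ennreal (w x / c))) borel u" for M
    have real_distr: "real_distribution (N M)" and char: "char (N M) s = (CLINT x|M. w x * iexp (s * u x)) / c"
      and meas: "measure (N M) B = (\<integral>x. w x * indicator B (u x) \<partial>M) / c"
      if M: "prob_space M" "sets M = sets M1" "integrable M w" "c = (\<integral>x. w x \<partial>M)" for M s
    proof -
      have [measurable]: "w \<in> borel_measurable M" "u \<in> borel_measurable M"
        using M(2) by (simp_all cong: measurable_cong_sets)
      have "prob_space (density M (\<lambda>x. ennreal (w x / c)))"
      proof
        have "emeasure (density M (\<lambda>x. ennreal (w x / c))) (space M) = (\<integral>\<^sup>+x. ennreal (w x / c) \<partial>M)"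
          by (subst emeasure_density) (auto intro!: nn_integral_cong)
        also have "\<dots> = ennreal (\<integral>x. w x / c \<partial>M)"
          using M(3) w c by (intro nn_integral_eq_integral) auto
        also have "\<dots> = 1" using M(4) c by simp
        finally show "emeasure (density M (\<lambda>x. ennreal (w x / c))) (space (density M (\<lambda>x. ennreal (w x / c)))) = 1"
          by simp
      qed
      then have ps: "prob_space (N M)"
        unfolding N_def by (rule prob_space.prob_space_distr) measurable
      then show "real_distribution (N M)"
        by (auto simp: real_distribution_def real_distribution_axioms_def N_def)
      have "char (N M) s = (CLINT x|M. (w x / c) *\<^sub>R iexp (s * u x))"
        unfolding char_def N_def using w c
        by (subst integral_distr) (auto simp: integral_density)
      also have "\<dots> = (CLINT x|M. w x * iexp (s * u x) / c)"
        by (simp add: scaleR_conv_of_real)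
      finally show "char (N M) s = (CLINT x|M. w x * iexp (s * u x)) / c" by simp
      have "measure (N M) B = (\<integral>x. indicator B x \<partial>N M)"
        using ps by (simp add: N_def)
      also have "\<dots> = (\<integral>x. (w x / c) *\<^sub>R indicator B (u x) \<partial>M)"
        unfolding N_def using w c by (subst integral_distr) (auto simp: integral_density)
      finally show "measure (N M) B = (\<integral>x. w x * indicator B (u x) \<partial>M) / c" by simp
    qed
    have "N M1 = N M2"
      using real_distr[of M1] real_distr[of M2] char[of M1] char[of M2] assms(1,2) sets int1 int2 c2 c_def eq
      by (intro Levy_uniqueness) auto
    then show ?thesis
      using meas[of M1] meas[of M2] assms(1,2) sets int1 int2 c2 c_def c by auto
  qed
qed

text \<open>Uniqueness of characteristic functionals, obtained from the one-dimensional theorem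
  alone: constraints \<open>u x \<in> B\<close> are added one at a time to a weight, while the
  transforms of all functionals in U are carried along. The hypothesis \<open>gen\<close> expresses
  that U generates the sigma-algebra.\<close>

theorem prob_measure_eqI_char:
  fixes U :: "('w \<Rightarrow> real) set"
  assumes M1: "prob_space M1" and M2: "prob_space M2"
    and sets: "sets M2 = sets M1"
    and zero: "(\<lambda>_. 0) \<in> U"
    and lin: "\<And>u v s. u \<in> U \<Longrightarrow> v \<in> U \<Longrightarrow> (\<lambda>x. s * u x + v x) \<in> U"
    and meas: "\<And>u. u \<in> U \<Longrightarrow> u \<in> borel_measurable M1"
    and gen: "\<And>N. space N = space M1 \<Longrightarrow> (\<And>u. u \<in> U \<Longrightarrow> u \<in> borel_measurable N) \<Longrightarrow> (\<lambda>x. x) \<in> measurable N M1"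
    and char: "\<And>u. u \<in> U \<Longrightarrow> (CLINT x|M1. iexp (u x)) = (CLINT x|M2. iexp (u x))"
  shows "M1 = M2"
proof -
  interpret M1: prob_space M1 by fact
  interpret M2: prob_space M2 by fact
  have space: "space M2 = space M1" using sets by (rule sets_eq_imp_space_eq)
  have meas2: "u \<in> borel_measurable M2" if "u \<in> U" for u
    using meas[OF that] sets by (simp cong: measurable_cong_sets)
  define w where "w L x = (\<Prod>(u, B)\<leftarrow>L. indicator B (u x) :: real)"
    for L :: "(('w \<Rightarrow> real) \<times> real set) list" and x
  define ok where "ok L \<longleftrightarrow> (\<forall>(u, B)\<in>set L. u \<in> U \<and> B \<in> sets borel)" for L :: "(('w \<Rightarrow> real) \<times> real set) list"
  have w01: "0 \<le> w L x" "w L x \<le> 1" for L x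
    by (induction L) (auto simp: w_def indicator_def)
  have wmeas: "w L \<in> borel_measurable M1" if "ok L" for L
    using that
  proof (induction L)
    case Nil
    then show ?case by (simp add: w_def)
  next
    case (Cons a L)
    obtain u B where a: "a = (u, B)" by (cases a)
    have [measurable]: "u \<in> borel_measurable M1" "B \<in> sets borel" "w L \<in> borel_measurable M1"
      using Cons meas by (auto simp: ok_def a)
    have "w (a # L) = (\<lambda>x. indicator B (u x) * w L x)" by (auto simp: w_def a)
    then show ?case by simp
  qed
  have wmeas2: "w L \<in> borel_measurable M2" if "ok L" for L
    using wmeas[OF that] sets by (simp cong: measurable_cong_sets)
  \<comment> \<open>The functional v must vary in the induction, since each new constraint on u
    calls for the transforms at \<open>s * u\<close>, \<open>s * u + v\<close> and
    \<open>s * u - v\<close>.\<close>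
  have wchar: "(CLINT x|M1. w L x * iexp (v x)) = (CLINT x|M2. w L x * iexp (v x))" if "ok L" "v \<in> U" for L v
    using that
  proof (induction L arbitrary: v)
    case Nil
    then show ?case using char by (simp add: w_def)
  next
    case (Cons a L)
    obtain u B where a: "a = (u, B)" by (cases a)
    have okL: "ok L" and u: "u \<in> U" and B[measurable]: "B \<in> sets borel"
      using Cons(2) by (auto simp: ok_def a)
    note v = Cons(3)
    have [measurable]: "u \<in> borel_measurable M1" "v \<in> borel_measurable M1" "w L \<in> borel_measurable M1"
      "u \<in> borel_measurable M2" "v \<in> borel_measurable M2" "w L \<in> borel_measurable M2"
      using meas meas2 wmeas wmeas2 u v okL by auto
    have bnd: "cmod (complex_of_real (w L x) * iexp t) \<le> 1" for x t
      using w01[of L x] by (simp add: norm_mult)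
    have int: "integrable M1 (\<lambda>x. w L x * iexp (f x))" "integrable M2 (\<lambda>x. w L x * iexp (g x))"
      if [measurable]: "f \<in> borel_measurable M1" "g \<in> borel_measurable M2" for f g
      by (auto intro!: M1.integrable_const_bound[where B = 1] M2.integrable_const_bound[where B = 1] simp: bnd simp del: norm_mult)
    have comb: "(CLINT x|M. a x + k * (b x + c x)) = (CLINT x|M. a x) + k * ((CLINT x|M. b x) + (CLINT x|M. c x))"
      "(CLINT x|M. a x + k * (b x - c x)) = (CLINT x|M. a x) + k * ((CLINT x|M. b x) - (CLINT x|M. c x))"
      if "complex_integrable M a" "complex_integrable M b" "complex_integrable M c"
      for M :: "'w measure" and a b c k
      using that by simp_all
    define J where "J M f = (CLINT x|M. w L x * iexp (f x))" for M f
    have J: "J M1 f = J M2 f" if "f \<in> U" for f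
      unfolding J_def using Cons(1)[OF okL that] .
    have minus: "(\<lambda>x. s * u x - v x) \<in> U" for s
      using lin[OF v lin[OF u zero, of s], of "-1"] by (simp add: algebra_simps)
    have plus: "(\<lambda>x. s * u x + v x) \<in> U" "(\<lambda>x. s * u x) \<in> U" for s
      using lin[OF u v, of s] lin[OF u zero, of s] by auto
    have e1: "(\<integral>x. w L x * indicator B (u x) \<partial>M1) = (\<integral>x. w L x * indicator B (u x) \<partial>M2)"
      using w01 J[OF plus(2)] unfolding J_def
      by (intro weighted_law_eqI_char[OF M1 M2 sets, where C = 1]) auto
    \<comment> \<open>Weights have to be nonnegative, so the cosine and sine of v enter shifted by
      1. The products with \<open>iexp (s * u x)\<close> expand into transforms that the induction
      hypothesis covers.\<close>
    have cosE: "of_real (w L x * (1 + cos (v x))) * iexp (s * u x)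
        = w L x * iexp (s * u x) + (1/2) * (w L x * iexp (s * u x + v x) + w L x * iexp (s * u x - v x))"
      and sinE: "of_real (w L x * (1 + sin (v x))) * iexp (s * u x)
        = w L x * iexp (s * u x) + (1/(2*\<i>)) * (w L x * iexp (s * u x + v x) - w L x * iexp (s * u x - v x))" for x s
    proof -
      have e: "iexp (s * u x + v x) = iexp (s * u x) * iexp (v x)"
        "iexp (s * u x - v x) = iexp (s * u x) * inverse (iexp (v x))"
        by (simp_all add: exp_add exp_minus ring_distribs exp_diff divide_inverse flip: exp_minus)
      have i: "inverse (iexp (v x)) = of_real (cos (v x)) - \<i> * of_real (sin (v x))"
        by (simp add: cis_conv_exp[symmetric] complex_eq_iff flip: exp_minus mult_minus_right of_real_minus)
      have c: "iexp (v x) = of_real (cos (v x)) + \<i> * of_real (sin (v x))"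
        by (simp add: cis_conv_exp[symmetric] complex_eq_iff)
      show "of_real (w L x * (1 + cos (v x))) * iexp (s * u x)
        = w L x * iexp (s * u x) + (1/2) * (w L x * iexp (s * u x + v x) + w L x * iexp (s * u x - v x))"
        unfolding e unfolding i unfolding c by (simp add: algebra_simps)
      show "of_real (w L x * (1 + sin (v x))) * iexp (s * u x)
        = w L x * iexp (s * u x) + (1/(2*\<i>)) * (w L x * iexp (s * u x + v x) - w L x * iexp (s * u x - v x))"
        unfolding e unfolding i unfolding c by (simp add: algebra_simps)
    qed
    have e2: "(\<integral>x. (w L x * (1 + cos (v x))) * indicator B (u x) \<partial>M1) = (\<integral>x. (w L x * (1 + cos (v x))) * indicator B (u x) \<partial>M2)"
    proof (rule weighted_law_eqI_char[OF M1 M2 sets, where C = 2])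
      show "(CLINT x|M1. of_real (w L x * (1 + cos (v x))) * iexp (s * u x)) = (CLINT x|M2. of_real (w L x * (1 + cos (v x))) * iexp (s * u x))" for s
        unfolding cosE using J[OF plus(1), of s] J[OF plus(2), of s] J[OF minus, of s]
        by (subst (1 2) comb(1)) (auto intro!: int simp only: J_def, measurable)
      show "0 \<le> w L x * (1 + cos (v x))" for x
        using w01(1)[of L x] cos_ge_minus_one[of "v x"] by (intro mult_nonneg_nonneg) linarith+
      show "w L x * (1 + cos (v x)) \<le> 2" for x
        using mult_mono[OF w01(2)[of L x], of "1 + cos (v x)" 2] w01(1)[of L x] cos_ge_minus_one[of "v x"]
        by simp
    qed auto
    have e3: "(\<integral>x. (w L x * (1 + sin (v x))) * indicator B (u x) \<partial>M1) = (\<integral>x. (w L x * (1 + sin (v x))) * indicator B (u x) \<partial>M2)"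
    proof (rule weighted_law_eqI_char[OF M1 M2 sets, where C = 2])
      show "(CLINT x|M1. of_real (w L x * (1 + sin (v x))) * iexp (s * u x)) = (CLINT x|M2. of_real (w L x * (1 + sin (v x))) * iexp (s * u x))" for s
        unfolding sinE using J[OF plus(1), of s] J[OF plus(2), of s] J[OF minus, of s]
        by (subst (1 2) comb(2)) (auto intro!: int simp only: J_def, measurable)
      show "0 \<le> w L x * (1 + sin (v x))" for x
        using w01(1)[of L x] sin_ge_minus_one[of "v x"] by (intro mult_nonneg_nonneg) linarith+
      show "w L x * (1 + sin (v x)) \<le> 2" for x
        using mult_mono[OF w01(2)[of L x], of "1 + sin (v x)" 2] w01(1)[of L x] sin_ge_minus_one[of "v x"]
        by simp
    qed auto
    \<comment> \<open>Subtracting the unshifted weight removes the 1, and the two real integrals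
      recombine into the transform of v under the enlarged weight.\<close>
    have split: "(CLINT x|M. w (a # L) x * iexp (v x)) =
        of_real ((\<integral>x. (w L x * (1 + cos (v x))) * indicator B (u x) \<partial>M) - (\<integral>x. w L x * indicator B (u x) \<partial>M))
        + \<i> * of_real ((\<integral>x. (w L x * (1 + sin (v x))) * indicator B (u x) \<partial>M) - (\<integral>x. w L x * indicator B (u x) \<partial>M))"
      if M: "prob_space M" and [measurable]: "u \<in> borel_measurable M" "v \<in> borel_measurable M" "w L \<in> borel_measurable M" for M
    proof -
      interpret prob_space M by fact
      have b: "\<bar>w L x * t\<bar> \<le> 2" if "\<bar>t\<bar> \<le> 2" for t x
        using mult_mono[OF w01(2)[of L x] that] w01(1)[of L x] by (simp add: abs_mult)
      have i1: "integrable M (\<lambda>x. w L x * indicator B (u x))"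
        by (rule integrable_const_bound[where B = 2]) (use b in \<open>auto simp: indicator_def\<close>)
      have i2: "integrable M (\<lambda>x. w L x * cos (v x) * indicator B (u x))"
        "integrable M (\<lambda>x. w L x * sin (v x) * indicator B (u x))"
        using b[OF order_trans[OF abs_cos_le_one]] b[OF order_trans[OF abs_sin_le_one]]
        by (auto intro!: integrable_const_bound[where B = 2] simp: indicator_def)
      have "(CLINT x|M. w (a # L) x * iexp (v x)) =
         (CLINT x|M. of_real (w L x * cos (v x) * indicator B (u x)) + \<i> * of_real (w L x * sin (v x) * indicator B (u x)))"
        by (intro Bochner_Integration.integral_cong)
          (auto simp: w_def a cis_conv_exp[symmetric] complex_eq_iff indicator_def)
      also have "\<dots> = of_real (\<integral>x. w L x * cos (v x) * indicator B (u x) \<partial>M) + \<i> * of_real (\<integral>x. w L x * sin (v x) * indicator B (u x) \<partial>M)"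
        using i2 by (simp del: of_real_mult)
      finally show ?thesis using i1 i2 by (simp add: algebra_simps)
    qed
    show ?case
      using e1 e2 e3 by (subst split[OF M1]; simp; subst split[OF M2]; simp)
  qed
  define cyl where "cyl L = {x\<in>space M1. \<forall>(u, B)\<in>set L. u x \<in> B}" for L :: "(('w \<Rightarrow> real) \<times> real set) list"
  define E where "E = {cyl L | L. ok L}"
  have cylw: "indicator (cyl L) x = w L x" if "x \<in> space M1" for L x
  proof (induction L)
    case Nil
    then show ?case using that by (simp add: w_def cyl_def)
  next
    case (Cons a L)
    obtain u B where a: "a = (u, B)" by (cases a)
    have "indicator (cyl (a # L)) x = indicator B (u x) * (indicator (cyl L) x :: real)"
      using that by (auto simp: cyl_def a indicator_def)
    then show ?case using Cons by (simp add: w_def a)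
  qed
  have cyl_meas: "cyl L \<in> sets M1" if "ok L" for L
    using that
  proof (induction L)
    case Nil
    then show ?case by (simp add: cyl_def)
  next
    case (Cons a L)
    obtain u B where a: "a = (u, B)" by (cases a)
    have [measurable]: "u \<in> borel_measurable M1" "B \<in> sets borel" and L: "cyl L \<in> sets M1"
      using Cons meas by (auto simp: ok_def a)
    have "cyl (a # L) = {x\<in>space M1. u x \<in> B} \<inter> cyl L" by (auto simp: cyl_def a)
    then show ?case using L by simp
  qed
  have ok_append: "ok L \<Longrightarrow> ok L' \<Longrightarrow> ok (L @ L')" for L L' by (auto simp: ok_def)
  \<comment> \<open>\<open>gen\<close> is applied to the sigma-algebra generated by the cylinders,
    on which all members of U are measurable by construction.\<close>
  have gensets: "sets M1 = sigma_sets (space M1) E"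
  proof
    have "E \<subseteq> sets M1" using cyl_meas by (auto simp: E_def)
    then show "sigma_sets (space M1) E \<subseteq> sets M1" by (rule sets.sigma_sets_subset)
    define N where "N = sigma (space M1) E"
    have E: "E \<subseteq> Pow (space M1)" by (auto simp: E_def cyl_def)
    have "u \<in> borel_measurable N" if "u \<in> U" for u
    proof (rule measurableI)
      fix B :: "real set" assume "B \<in> sets borel"
      then have "cyl [(u, B)] \<in> E" using that by (auto simp: E_def ok_def)
      moreover have "u -` B \<inter> space N = cyl [(u, B)]" by (auto simp: cyl_def N_def E)
      ultimately show "u -` B \<inter> space N \<in> sets N" by (simp add: N_def E)
    qed auto
    then have "(\<lambda>x. x) \<in> measurable N M1" using gen[of N] by (simp add: N_def E)
    then show "sets M1 \<subseteq> sigma_sets (space M1) E"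
      using measurable_sets[of "\<lambda>x. x" N M1] sets.sets_into_space[of _ M1]
      by (auto simp: N_def E vimage_def Int_absorb2 dest!: subsetD)
  qed
  show ?thesis
  proof (rule measure_eqI_generator_eq[where \<Omega> = "space M1" and E = E and A = "\<lambda>_. space M1"])
    show "Int_stable E"
    proof (rule Int_stableI)
      fix a b assume "a \<in> E" "b \<in> E"
      then obtain L L' where "a = cyl L" "ok L" "b = cyl L'" "ok L'" by (auto simp: E_def)
      moreover have "cyl L \<inter> cyl L' = cyl (L @ L')" by (auto simp: cyl_def)
      ultimately show "a \<inter> b \<in> E" using ok_append by (auto simp: E_def)
    qed
    show "E \<subseteq> Pow (space M1)" by (auto simp: E_def cyl_def)
    show "range (\<lambda>_::nat. space M1) \<subseteq> E"
      by (auto simp: E_def ok_def cyl_def intro!: exI[of _ "[]"])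
    fix X assume "X \<in> E"
    then obtain L where X: "X = cyl L" "ok L" by (auto simp: E_def)
    \<comment> \<open>At \<open>v = 0\<close> the transform of the weight is the probability of the
      cylinder.\<close>
    have "measure M (cyl L) = Re (CLINT x|M. w L x * iexp 0)" if "sets M = sets M1" "prob_space M" for M
    proof -
      interpret prob_space M by fact
      have "measure M (cyl L) = (\<integral>x. indicator (cyl L) x \<partial>M)"
        using that cyl_meas[OF X(2)] by simp
      also have "\<dots> = (\<integral>x. w L x \<partial>M)"
        using cylw sets_eq_imp_space_eq[OF that(1)] by (intro Bochner_Integration.integral_cong) auto
      finally show ?thesis by simp
    qed
    then have "measure M1 (cyl L) = measure M2 (cyl L)"
      using wchar[OF X(2) zero] M1 M2 sets by simp
    then show "emeasure M1 X = emeasure M2 X"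
      by (simp add: X M1.emeasure_eq_measure M2.emeasure_eq_measure)
  qed (use gensets sets in auto)
qed

section \<open>Gaussian measures and rotation invariance\<close>

lemma centered_normal_eq_distr:
  assumes "0 \<le> \<sigma>"
  shows "centered_normal \<sigma> = distr std_normal_distribution borel (\<lambda>x. \<sigma> * x)"
proof -
  interpret prob_space std_normal_distribution
    using prob_space_normal_density[of 1 0] by simp
  show ?thesis
  proof (cases "\<sigma> = 0")
    case True
    then show ?thesis by (simp add: centered_normal_def distr_const)
  next
    case False
    have "distributed std_normal_distribution lborel (\<lambda>x. x) (normal_density 0 1)"
      by (simp add: distributed_def distr_id2)
    from normal_density_affine[OF this, of \<sigma> 0]
    have "distributed std_normal_distribution lborel (\<lambda>x. \<sigma> * x) (normal_density 0 \<sigma>)"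
      using False assms by simp
    then have "distr std_normal_distribution lborel (\<lambda>x. \<sigma> * x) = density lborel (normal_density 0 \<sigma>)"
      by (rule distributed_distr_eq_density)
    then show ?thesis
      using False by (simp add: centered_normal_def cong: distr_cong)
  qed
qed

lemma char_centered_normal:
  assumes "0 \<le> \<sigma>"
  shows "char (centered_normal \<sigma>) t = exp (- (\<sigma> * t)\<^sup>2 / 2)"
proof -
  have "char (centered_normal \<sigma>) t = char std_normal_distribution (t * \<sigma>)"
    unfolding char_def centered_normal_eq_distr[OF assms]
    by (subst integral_distr) (auto simp: mult_ac)
  then show ?thesis by (simp add: char_std_normal_distribution mult_ac)
qed

lemma centered_normal_second_moment:
  assumes "0 \<le> \<sigma>"
  shows "integrable (centered_normal \<sigma>) (\<lambda>x. x\<^sup>2)" "(\<integral>x. x\<^sup>2 \<partial>centered_normal \<sigma>) = \<sigma>\<^sup>2"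
  using std_normal_distribution_even_moments[of 1] unfolding centered_normal_eq_distr[OF assms]
  by (auto simp: integrable_distr_eq integral_distr power_mult_distrib)

lemma real_distribution_centered_normal:
  assumes "0 \<le> \<sigma>"
  shows "real_distribution (centered_normal \<sigma>)"
  unfolding centered_normal_eq_distr[OF assms]
  using real_dist_normal_dist
  by (intro real_distribution.intro prob_space.prob_space_distr)
    (auto simp: real_distribution_def real_distribution_axioms_def)

lemma std_normal_exp_square:
  "(\<integral>\<^sup>+x. ennreal (exp (x\<^sup>2 / 4)) \<partial>std_normal_distribution) = ennreal (sqrt 2)"
proof -
  have eq: "std_normal_density x * exp (x\<^sup>2 / 4) = sqrt 2 * normal_density 0 (sqrt 2) x" for x
    by (simp add: normal_density_def real_sqrt_mult mult_exp_exp field_simps flip: exp_add)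
  have "(\<integral>\<^sup>+x. ennreal (exp (x\<^sup>2 / 4)) \<partial>std_normal_distribution)
     = (\<integral>\<^sup>+x. ennreal (std_normal_density x) * ennreal (exp (x\<^sup>2 / 4)) \<partial>lborel)"
    by (subst nn_integral_density) auto
  also have "\<dots> = (\<integral>\<^sup>+x. ennreal (sqrt 2) * ennreal (normal_density 0 (sqrt 2) x) \<partial>lborel)"
    by (intro nn_integral_cong) (simp add: eq flip: ennreal_mult)
  also have "\<dots> = ennreal (sqrt 2)"
    by (subst nn_integral_cmult) (auto simp: nn_integral_eq_integral)
  finally show ?thesis .
qed

text \<open>After standardization the rate \<open>1 / (4 * v)\<close> leaves an exponent of at most
  \<open>x^2 / 4\<close>, whose integral is \<open>sqrt 2\<close>; the rounded value 2 is used from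
  here on. Only an upper bound v on the variance enters, so degenerate laws are included.\<close>

lemma normal_exp_square_le:
  assumes distr: "distr M borel u = centered_normal \<sigma>" and [measurable]: "u \<in> borel_measurable M"
    and \<sigma>: "0 \<le> \<sigma>" "\<sigma>\<^sup>2 \<le> v" and v: "0 < v" and a: "a \<le> 1 / (4 * v)"
  shows "(\<integral>\<^sup>+x. ennreal (exp (a * (u x)\<^sup>2)) \<partial>M) \<le> 2"
proof -
  have "(\<integral>\<^sup>+x. ennreal (exp (a * (u x)\<^sup>2)) \<partial>M) = (\<integral>\<^sup>+x. ennreal (exp (a * x\<^sup>2)) \<partial>distr M borel u)"
    by (subst nn_integral_distr) auto
  also have "\<dots> = (\<integral>\<^sup>+x. ennreal (exp (a * (\<sigma> * x)\<^sup>2)) \<partial>std_normal_distribution)"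
    unfolding distr centered_normal_eq_distr[OF \<sigma>(1)] by (subst nn_integral_distr) auto
  also have "\<dots> \<le> (\<integral>\<^sup>+x. ennreal (exp (x\<^sup>2 / 4)) \<partial>std_normal_distribution)"
  proof (intro nn_integral_mono ennreal_leI iffD2[OF exp_le_cancel_iff])
    fix x :: real
    have "a * \<sigma>\<^sup>2 \<le> (1 / (4 * v)) * \<sigma>\<^sup>2" using a by (intro mult_right_mono) auto
    also have "\<dots> \<le> 1 / 4" using \<sigma>(2) v by (simp add: field_simps)
    finally have "a * \<sigma>\<^sup>2 * x\<^sup>2 \<le> (1 / 4) * x\<^sup>2" by (intro mult_right_mono) auto
    then show "a * (\<sigma> * x)\<^sup>2 \<le> x\<^sup>2 / 4" by (simp add: power_mult_distrib mult_ac)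
  qed
  also have "\<dots> \<le> ennreal 2"
    unfolding std_normal_exp_square by (intro ennreal_leI real_le_lsqrt) auto
  finally show ?thesis by simp
qed

section \<open>Linear forms in finitely many coordinates of a sequence\<close>

definition lin_form :: "nat \<Rightarrow> (nat \<Rightarrow> 'e::real_normed_vector \<Rightarrow>\<^sub>L real) \<Rightarrow> (nat \<Rightarrow> 'e) \<Rightarrow> real" where
  "lin_form N w x = (\<Sum>k<N. blinfun_apply (w k) (x k))"

lemma lin_form_extend:
  assumes "N \<le> N'"
  shows "lin_form N w x = lin_form N' (\<lambda>k. if k < N then w k else 0) x"
proof -
  have "lin_form N' (\<lambda>k. if k < N then w k else 0) x = (\<Sum>k<N'. if k < N then blinfun_apply (w k) (x k) else 0)"
    unfolding lin_form_def by (intro sum.cong) auto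
  also have "\<dots> = lin_form N w x"
    unfolding lin_form_def using assms by (intro sum.mono_neutral_cong_right) auto
  finally show ?thesis by simp
qed

lemma lin_form_lincomb:
  "a * lin_form N w x + b * lin_form N v x = lin_form N (\<lambda>k. a *\<^sub>R w k + b *\<^sub>R v k) x"
  by (simp add: lin_form_def blinfun.add_left blinfun.scaleR_left sum.distrib sum_distrib_left)

lemma lin_form_lincomb_right:
  "lin_form N w (\<lambda>k. a *\<^sub>R x k + b *\<^sub>R y k) = a * lin_form N w x + b * lin_form N w y"
  by (simp add: lin_form_def blinfun.add_right blinfun.scaleR_right sum.distrib sum_distrib_left)

text \<open>Forms of different lengths are padded with zeros to a common length. This supplies the
  closure under linear combinations demanded by \<open>prob_measure_eqI_char\<close>.\<close>

lemma lin_form_lincomb_exists: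
  fixes w v w' v' :: "nat \<Rightarrow> 'e::real_normed_vector \<Rightarrow>\<^sub>L real"
  shows
  "\<exists>N'' w'' v''. \<forall>x y. s * (lin_form N w x + lin_form N v y) + (lin_form N' w' x + lin_form N' v' y)
     = lin_form N'' w'' x + lin_form N'' v'' y"
proof -
  define K where "K = max N N'"
  define e where "e N w = (\<lambda>k. if k < N then w k else 0)" for N and w :: "nat \<Rightarrow> 'e \<Rightarrow>\<^sub>L real"
  have "lin_form N w x = lin_form K (e N w) x" "lin_form N' w x = lin_form K (e N' w) x" for w x
    using lin_form_extend[of N K] lin_form_extend[of N' K] by (auto simp: K_def e_def)
  then have "s * (lin_form N w x + lin_form N v y) + (lin_form N' w' x + lin_form N' v' y)
     = (s * lin_form K (e N w) x + 1 * lin_form K (e N' w') x) + (s * lin_form K (e N v) y + 1 * lin_form K (e N' v') y)" for x y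
    by (simp add: algebra_simps)
  then show ?thesis unfolding lin_form_lincomb by blast
qed

lemma continuous_lin_form: "continuous_on UNIV (lin_form N w)"
  unfolding lin_form_def by (intro continuous_intros continuous_on_product_coordinates)

lemma measurable_blinfun_apply[measurable (raw)]:
  fixes u :: "'e::real_normed_vector \<Rightarrow>\<^sub>L 'f::real_normed_vector"
  assumes "f \<in> borel_measurable M"
  shows "(\<lambda>x. blinfun_apply u (f x)) \<in> borel_measurable M"
  using measurable_compose[OF assms, of "blinfun_apply u" borel]
  by (simp add: borel_measurable_continuous_onI blinfun.continuous_on)

section \<open>The Gaussian law and its covariance form\<close>

locale gaussian =
  fixes \<Sigma> :: "('e :: {banach, second_countable_topology}) dual_op" and \<mu> :: "'e measure"
  assumes law: "gaussian_law \<Sigma> \<mu>"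
begin

sublocale prob_space \<mu>
  using law by (simp add: gaussian_law_def)

lemma sets_eq[measurable_cong, simp]: "sets \<mu> = sets borel"
  using law by (simp add: gaussian_law_def)

lemma space_eq[simp]: "space \<mu> = UNIV"
  using sets_eq_imp_space_eq[OF sets_eq] by simp

definition cov :: "('e \<Rightarrow>\<^sub>L real) \<Rightarrow> ('e \<Rightarrow>\<^sub>L real) \<Rightarrow> real" where
  "cov u v = blinfun_apply u (blinfun_apply \<Sigma> v)"

lemma cov_integral: "has_bochner_integral \<mu> (\<lambda>x. blinfun_apply u x * blinfun_apply v x) (cov u v)"
proof -
  have "has_bochner_integral \<mu> (\<lambda>x. blinfun_apply u (blinfun_apply v x *\<^sub>R x)) (blinfun_apply u (blinfun_apply \<Sigma> v))"
    by (rule has_bochner_integral_bounded_linear[OF blinfun.bounded_linear_right])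
      (use law in \<open>unfold gaussian_law_def, blast\<close>)
  then show ?thesis by (simp add: cov_def blinfun.scaleR_right mult.commute)
qed

lemma cov_commute: "cov u v = cov v u"
proof -
  have "has_bochner_integral \<mu> (\<lambda>x. blinfun_apply u x * blinfun_apply v x) (cov v u)"
    using cov_integral[of v u] by (simp only: mult.commute)
  then show ?thesis by (rule has_bochner_integral_eq[OF cov_integral])
qed

lemma cov_nonneg: "0 \<le> cov u u"
proof -
  have "0 \<le> (\<integral>x. blinfun_apply u x * blinfun_apply u x \<partial>\<mu>)"
    by (intro Bochner_Integration.integral_nonneg) simp
  then show ?thesis by (simp only: has_bochner_integral_integral_eq[OF cov_integral])
qed

lemma cov_bilinear:
  "cov (a *\<^sub>R u + b *\<^sub>R v) w = a * cov u w + b * cov v w"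
  "cov w (a *\<^sub>R u + b *\<^sub>R v) = a * cov w u + b * cov w v"
  by (simp_all add: cov_def blinfun.add_left blinfun.scaleR_left blinfun.add_right blinfun.scaleR_right)

lemma cov_Cauchy_Schwarz: "(cov u v)\<^sup>2 \<le> cov u u * cov v v"
proof -
  have quad: "0 \<le> cov u u * t\<^sup>2 + 2 * cov u v * t + cov v v" for t
    using cov_nonneg[of "t *\<^sub>R u + 1 *\<^sub>R v"] unfolding cov_bilinear cov_commute[of v u]
    by (simp add: algebra_simps power2_eq_square)
  show ?thesis
  proof (cases "cov u u = 0")
    case True
    have "cov u v = 0"
    proof (rule ccontr)
      assume "cov u v \<noteq> 0"
      then show False
        \<comment> \<open>This argument makes the quadratic equal to -1, since its leading
          coefficient vanishes here; the form is only semidefinite.\<close>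
        using quad[of "- (cov v v + 1) / (2 * cov u v)"] True by simp
    qed
    then show ?thesis using True by simp
  next
    case False
    then have pos: "0 < cov u u" using cov_nonneg[of u] by simp
    have "cov u u * (- cov u v / cov u u)\<^sup>2 + 2 * cov u v * (- cov u v / cov u u) + cov v v
      = cov v v - (cov u v)\<^sup>2 / cov u u"
      using pos by (simp add: power2_eq_square)
    then have "(cov u v)\<^sup>2 / cov u u \<le> cov v v"
      using quad[of "- cov u v / cov u u"] by simp
    then show ?thesis using pos by (simp add: divide_le_eq mult.commute)
  qed
qed

text \<open>The definition of the law only promises some standard deviation; comparing second
  moments identifies its square with the covariance form.\<close>

lemma distr_functional: "distr \<mu> borel (blinfun_apply u) = centered_normal (sqrt (cov u u))"
proof -
  obtain \<sigma> where \<sigma>: "0 \<le> \<sigma>" "distr \<mu> borel (\<lambda>x. blinfun_apply u x) = centered_normal \<sigma>"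
    using law unfolding gaussian_law_def by blast
  have "\<sigma>\<^sup>2 = (\<integral>x. x\<^sup>2 \<partial>distr \<mu> borel (\<lambda>x. blinfun_apply u x))"
    using centered_normal_second_moment(2)[OF \<sigma>(1)] \<sigma>(2) by simp
  also have "\<dots> = (\<integral>x. (blinfun_apply u x)\<^sup>2 \<partial>\<mu>)"
    by (subst integral_distr) auto
  also have "\<dots> = cov u u"
    using has_bochner_integral_integral_eq[OF cov_integral[of u u]] by (simp add: power2_eq_square)
  finally have "\<sigma> = sqrt (cov u u)" using \<sigma>(1) by (metis real_sqrt_unique)
  then show ?thesis using \<sigma>(2) by simp
qed

lemma char_functional: "(CLINT x|\<mu>. iexp (blinfun_apply u x)) = exp (- cov u u / 2)"
proof -
  have "(CLINT x|\<mu>. iexp (blinfun_apply u x)) = char (distr \<mu> borel (blinfun_apply u)) 1"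
    unfolding char_def by (subst integral_distr) simp_all
  also have "\<dots> = exp (- (sqrt (cov u u) * 1)\<^sup>2 / 2)"
    unfolding distr_functional by (rule char_centered_normal) (simp add: cov_nonneg)
  finally show ?thesis by (simp add: cov_nonneg)
qed

text \<open>Infinitely many coordinates let one measure serve all purposes and all n: the sample
  occupies coordinates 1 to n, while Chevet's comparison also uses coordinate 0 and the block from n
  + 1 to 2n. Under \<open>P\<close> the form \<open>qf\<close> below is the covariance of two linear
  forms.\<close>

definition P :: "(nat \<Rightarrow> 'e) measure" where
  "P = PiM UNIV (\<lambda>_. \<mu>)"

sublocale P: prob_space P
  unfolding P_def by (rule prob_space_PiM) (rule prob_space_axioms)

lemma sets_P[measurable_cong, simp]: "sets P = sets borel"
proof -
  have "sets P = sets (PiM UNIV (\<lambda>_::nat. borel :: 'e measure))"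
    unfolding P_def by (intro sets_PiM_cong) auto
  then show ?thesis by (simp add: sets_PiM_equal_borel)
qed

lemma space_P[simp]: "space P = UNIV"
  using sets_eq_imp_space_eq[OF sets_P] by simp

lemma measurable_P_continuous:
  "continuous_on UNIV f \<Longrightarrow> f \<in> borel_measurable P"
  by (simp add: borel_measurable_continuous_onI cong: measurable_cong_sets)

lemma measurable_P_coord: "(\<lambda>x. x k) \<in> borel_measurable P"
  by (intro measurable_P_continuous continuous_on_product_coordinates)

lemma measurable_lin_form[measurable]: "lin_form N w \<in> borel_measurable P"
  by (intro measurable_P_continuous continuous_lin_form)

lemma distr_P_coord: "distr P borel (\<lambda>x. x k) = \<mu>"
proof -
  have "distr P borel (\<lambda>x. x k) = distr P \<mu> (\<lambda>x. x k)"
    by (intro distr_cong) auto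
  then show ?thesis
    unfolding P_def using distr_PiM_component[of UNIV "\<lambda>_. \<mu>" k] prob_space_axioms by simp
qed

lemma nn_integral_P_coord:
  assumes [measurable]: "f \<in> borel_measurable borel"
  shows "(\<integral>\<^sup>+x. f (x k) \<partial>P) = (\<integral>\<^sup>+z. f z \<partial>\<mu>)"
proof -
  note measurable_P_coord[measurable]
  have "(\<integral>\<^sup>+x. f (x k) \<partial>P) = (\<integral>\<^sup>+z. f z \<partial>distr P borel (\<lambda>x. x k))"
    by (subst nn_integral_distr) auto
  then show ?thesis by (simp add: distr_P_coord)
qed

lemma distr_P_restrict:
  assumes "finite J"
  shows "distr P (PiM J (\<lambda>_. \<mu>)) (\<lambda>x. restrict x J) = PiM J (\<lambda>_. \<mu>)"
proof -
  interpret Q: product_prob_space "\<lambda>_::nat. \<mu>" UNIV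
    by unfold_locales
  show ?thesis
    unfolding P_def using assms by (intro Q.distr_PiM_restrict_finite) auto
qed

lemma restrict_measurable_P[measurable]: "(\<lambda>x. restrict x J) \<in> measurable P (PiM J (\<lambda>_. \<mu>))"
  unfolding P_def by (rule measurable_restrict_subset) auto

lemma nn_integral_P_prod:
  assumes [measurable]: "\<And>k. f k \<in> borel_measurable borel" and "finite J"
  shows "(\<integral>\<^sup>+x. (\<Prod>k\<in>J. f k (x k)) \<partial>P) = (\<Prod>k\<in>J. \<integral>\<^sup>+z. f k z \<partial>\<mu>)"
proof -
  interpret Q: product_sigma_finite "\<lambda>_::nat. \<mu>" by unfold_locales
  have [measurable]: "f k \<in> borel_measurable \<mu>" for k
    using assms(1)[of k] by (simp cong: measurable_cong_sets)
  have "(\<integral>\<^sup>+x. (\<Prod>k\<in>J. f k (x k)) \<partial>P) = (\<integral>\<^sup>+x. (\<Prod>k\<in>J. f k (restrict x J k)) \<partial>P)"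
    by (intro nn_integral_cong prod.cong) auto
  also have "\<dots> = (\<integral>\<^sup>+x. (\<Prod>k\<in>J. f k (x k)) \<partial>distr P (PiM J (\<lambda>_. \<mu>)) (\<lambda>x. restrict x J))"
    by (subst nn_integral_distr) auto
  also have "\<dots> = (\<Prod>k\<in>J. \<integral>\<^sup>+z. f k z \<partial>\<mu>)"
    unfolding distr_P_restrict[OF \<open>finite J\<close>] using \<open>finite J\<close>
    by (intro Q.product_nn_integral_prod) auto
  finally show ?thesis .
qed

lemma integral_P_prod:
  fixes f :: "nat \<Rightarrow> 'e \<Rightarrow> complex"
  assumes int: "\<And>k. integrable \<mu> (f k)" and "finite J"
  shows "(\<integral>x. (\<Prod>k\<in>J. f k (x k)) \<partial>P) = (\<Prod>k\<in>J. \<integral>z. f k z \<partial>\<mu>)"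
proof -
  interpret Q: product_sigma_finite "\<lambda>_::nat. \<mu>" by unfold_locales
  have [measurable]: "f k \<in> borel_measurable \<mu>" for k
    using int by auto
  have "(\<integral>x. (\<Prod>k\<in>J. f k (x k)) \<partial>P) = (\<integral>x. (\<Prod>k\<in>J. f k (restrict x J k)) \<partial>P)"
    by (intro Bochner_Integration.integral_cong prod.cong) auto
  also have "\<dots> = (\<integral>x. (\<Prod>k\<in>J. f k (x k)) \<partial>distr P (PiM J (\<lambda>_. \<mu>)) (\<lambda>x. restrict x J))"
    by (subst integral_distr) auto
  also have "\<dots> = (\<Prod>k\<in>J. \<integral>z. f k z \<partial>\<mu>)"
    unfolding distr_P_restrict[OF \<open>finite J\<close>] using \<open>finite J\<close> int
    by (intro Q.product_integral_prod) auto
  finally show ?thesis .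
qed

definition qf :: "nat \<Rightarrow> (nat \<Rightarrow> 'e \<Rightarrow>\<^sub>L real) \<Rightarrow> (nat \<Rightarrow> 'e \<Rightarrow>\<^sub>L real) \<Rightarrow> real" where
  "qf N w v = (\<Sum>k<N. cov (w k) (v k))"

lemma qf_nonneg: "0 \<le> qf N w w"
  unfolding qf_def by (intro sum_nonneg cov_nonneg)

lemma qf_commute: "qf N w v = qf N v w"
  unfolding qf_def by (intro sum.cong refl cov_commute)

lemma qf_bilinear:
  "qf N (\<lambda>k. a *\<^sub>R u k + b *\<^sub>R v k) w = a * qf N u w + b * qf N v w"
  "qf N w (\<lambda>k. a *\<^sub>R u k + b *\<^sub>R v k) = a * qf N w u + b * qf N w v"
  by (simp_all add: qf_def cov_bilinear sum.distrib sum_distrib_left)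

lemma char_lin_form: "(CLINT x|P. iexp (lin_form N w x)) = exp (- qf N w w / 2)"
proof -
  have int: "integrable \<mu> (\<lambda>z. iexp (blinfun_apply (w k) z))" for k
    by (rule integrable_const_bound[where B = 1]) auto
  have "(CLINT x|P. iexp (lin_form N w x)) = (CLINT x|P. (\<Prod>k<N. iexp (blinfun_apply (w k) (x k))))"
    by (simp add: lin_form_def sum_distrib_left exp_sum)
  also have "\<dots> = (\<Prod>k<N. CLINT z|\<mu>. iexp (blinfun_apply (w k) z))"
    using integral_P_prod[OF int, of "{..<N}"] by simp
  also have "\<dots> = (\<Prod>k<N. exp (of_real (- cov (w k) (w k) / 2)))"
    by (simp add: char_functional flip: exp_of_real)
  also have "\<dots> = exp (of_real (\<Sum>k<N. - cov (w k) (w k) / 2))"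
    by (subst exp_sum[symmetric]) auto
  also have "\<dots> = exp (- qf N w w / 2)"
    by (simp add: qf_def sum_negf sum_divide_distrib flip: exp_of_real)
  finally show ?thesis .
qed

lemma distr_lin_form: "distr P borel (lin_form N w) = centered_normal (sqrt (qf N w w))"
proof (rule Levy_uniqueness)
  show "real_distribution (distr P borel (lin_form N w))"
    by (simp add: P.real_distribution_distr)
  show "real_distribution (centered_normal (sqrt (qf N w w)))"
    using qf_nonneg by (intro real_distribution_centered_normal) auto
  show "char (distr P borel (lin_form N w)) = char (centered_normal (sqrt (qf N w w)))"
  proof
    fix t
    have "char (distr P borel (lin_form N w)) t = (CLINT x|P. iexp (t * lin_form N w x))"
      unfolding char_def by (subst integral_distr) auto
    also have "\<dots> = (CLINT x|P. iexp (lin_form N (\<lambda>k. t *\<^sub>R w k + 0 *\<^sub>R w k) x))"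
      unfolding lin_form_lincomb[symmetric] by simp
    also have "\<dots> = exp (- (t * (t * qf N w w)) / 2)"
      unfolding char_lin_form qf_bilinear by simp
    finally show "char (distr P borel (lin_form N w)) t = char (centered_normal (sqrt (qf N w w))) t"
      using qf_nonneg[of N w] by (simp add: char_centered_normal power_mult_distrib power2_eq_square mult_ac)
  qed
qed

lemma lin_form_square: "has_bochner_integral P (\<lambda>x. (lin_form N w x)\<^sup>2) (qf N w w)"
proof -
  have s: "0 \<le> sqrt (qf N w w)" using qf_nonneg by simp
  have "integrable (distr P borel (lin_form N w)) (\<lambda>x. x\<^sup>2)"
    "(\<integral>x. x\<^sup>2 \<partial>distr P borel (lin_form N w)) = qf N w w"
    using centered_normal_second_moment[OF s] qf_nonneg[of N w] by (auto simp: distr_lin_form)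
  then show ?thesis
    by (simp add: has_bochner_integral_iff integrable_distr_eq integral_distr)
qed

lemma lin_form_mult: "has_bochner_integral P (\<lambda>x. lin_form N w x * lin_form N v x) (qf N w v)"
proof -
  have eq: "lin_form N w x * lin_form N v x
    = (1/4) * ((lin_form N (\<lambda>k. 1 *\<^sub>R w k + 1 *\<^sub>R v k) x)\<^sup>2 - (lin_form N (\<lambda>k. 1 *\<^sub>R w k + (-1) *\<^sub>R v k) x)\<^sup>2)" for x
    unfolding lin_form_lincomb[symmetric] by (simp add: power2_eq_square algebra_simps)
  have qeq: "qf N w v = (1/4) * (qf N (\<lambda>k. 1 *\<^sub>R w k + 1 *\<^sub>R v k) (\<lambda>k. 1 *\<^sub>R w k + 1 *\<^sub>R v k)
     - qf N (\<lambda>k. 1 *\<^sub>R w k + (-1) *\<^sub>R v k) (\<lambda>k. 1 *\<^sub>R w k + (-1) *\<^sub>R v k))"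
    unfolding qf_bilinear qf_commute[of N v w] by simp
  show ?thesis
    unfolding eq qeq by (intro has_bochner_integral_mult_right has_bochner_integral_diff lin_form_square)
qed

lemma lin_form_exp_square:
  assumes "qf N w w \<le> v" "0 < v" "a \<le> 1 / (4 * v)"
  shows "(\<integral>\<^sup>+x. ennreal (exp (a * (lin_form N w x)\<^sup>2)) \<partial>P) \<le> 2"
  using assms qf_nonneg[of N w] by (intro normal_exp_square_le[OF distr_lin_form]) auto

lemma functional_exp_square:
  assumes "cov u u \<le> v" "0 < v" "a \<le> 1 / (4 * v)"
  shows "(\<integral>\<^sup>+x. ennreal (exp (a * (blinfun_apply u x)\<^sup>2)) \<partial>\<mu>) \<le> 2"
  using assms cov_nonneg[of u] by (intro normal_exp_square_le[OF distr_functional]) auto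

lemma lin_form_exp_abs: "integrable P (\<lambda>x. exp \<bar>lin_form N w x\<bar>)"
proof (rule integrableI_nonneg)
  \<comment> \<open>The added 1 keeps the variance bound positive for degenerate forms.\<close>
  define v where "v = qf N w w + 1"
  have v: "0 < v" "qf N w w \<le> v" using qf_nonneg[of N w] by (auto simp: v_def)
  have le: "\<bar>t\<bar> \<le> v + (1 / (4 * v)) * t\<^sup>2" for t
  proof -
    have "0 \<le> (2 * v - \<bar>t\<bar>)\<^sup>2" by simp
    also have "(2 * v - \<bar>t\<bar>)\<^sup>2 = (v + (1 / (4 * v)) * t\<^sup>2 - \<bar>t\<bar>) * (4 * v)"
      using v by (simp add: power2_eq_square field_simps)
    finally show ?thesis using v by (simp add: zero_le_mult_iff)
  qed
  have "(\<integral>\<^sup>+x. ennreal (exp \<bar>lin_form N w x\<bar>) \<partial>P) \<le> (\<integral>\<^sup>+x. ennreal (exp v) * ennreal (exp ((1 / (4 * v)) * (lin_form N w x)\<^sup>2)) \<partial>P)"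
    using le by (intro nn_integral_mono) (auto simp flip: ennreal_mult exp_add intro!: ennreal_leI)
  also have "\<dots> = ennreal (exp v) * (\<integral>\<^sup>+x. ennreal (exp ((1 / (4 * v)) * (lin_form N w x)\<^sup>2)) \<partial>P)"
    by (intro nn_integral_cmult) measurable
  also have "\<dots> \<le> ennreal (exp v) * 2"
    using v by (intro mult_left_mono lin_form_exp_square) auto
  also have "\<dots> < \<infinity>" by (simp add: ennreal_mult_less_top)
  finally show "(\<integral>\<^sup>+x. ennreal (exp \<bar>lin_form N w x\<bar>) \<partial>P) < \<infinity>" .
qed auto

text \<open>A form with a single nonzero coefficient is a functional of one coordinate, so weak
  measurability settles each coordinate. This verifies the generation hypothesis of
  \<open>prob_measure_eqI_char\<close> and the measurability of rotations.\<close>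

lemma measurable_identity_P:
  assumes "\<And>N w. (\<lambda>z. lin_form N w (g z)) \<in> borel_measurable Q"
  shows "g \<in> measurable Q P"
proof -
  have "(\<lambda>z. g z k) \<in> borel_measurable Q" for k
  proof (rule borel_measurable_weakly)
    fix u :: "'e \<Rightarrow>\<^sub>L real"
    have "lin_form (Suc k) (\<lambda>j. if j = k then u else 0) x = blinfun_apply u (x k)" for x
    proof -
      have "lin_form (Suc k) (\<lambda>j. if j = k then u else 0) x = (\<Sum>j<Suc k. if j = k then blinfun_apply u (x k) else 0)"
        unfolding lin_form_def by (intro sum.cong) auto
      then show ?thesis by simp
    qed
    then show "(\<lambda>z. blinfun_apply u (g z k)) \<in> borel_measurable Q"
      using assms[of "Suc k" "\<lambda>j. if j = k then u else 0"] by simp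
  qed
  then have "(\<lambda>z. g z) \<in> measurable Q (PiM UNIV (\<lambda>_. \<mu>))"
    by (intro measurable_PiM_single') (auto cong: measurable_cong_sets)
  then show ?thesis by (simp add: P_def)
qed

section \<open>Two independent copies and their rotations\<close>

lemma char_pair:
  "(CLINT z|P \<Otimes>\<^sub>M P. iexp (lin_form N w (fst z) + lin_form N v (snd z))) = exp (- (qf N w w + qf N v v) / 2)"
proof -
  interpret PP: pair_prob_space P P by unfold_locales
  have int: "complex_integrable (P \<Otimes>\<^sub>M P) (\<lambda>(x, y). iexp (lin_form N w x + lin_form N v y))"
    by (rule PP.P.integrable_const_bound[where B = 1]) auto
  have "(CLINT z|P \<Otimes>\<^sub>M P. iexp (lin_form N w (fst z) + lin_form N v (snd z)))
    = (CLINT x|P. CLINT y|P. iexp (lin_form N w x + lin_form N v y))"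
    using PP.integral_fst'[OF int] by (simp add: case_prod_unfold)
  also have "\<dots> = (CLINT x|P. iexp (lin_form N w x) * (CLINT y|P. iexp (lin_form N v y)))"
    by (simp add: exp_add ring_distribs)
  also have "\<dots> = exp (of_real (- qf N w w / 2)) * exp (of_real (- qf N v v / 2))"
    unfolding char_lin_form by (simp add: char_lin_form flip: exp_of_real)
  also have "\<dots> = exp (- (qf N w w + qf N v v) / 2)"
    by (simp add: add_divide_distrib diff_divide_distrib mult_exp_exp flip: exp_of_real)
  finally show ?thesis .
qed

text \<open>For \<open>c = cos t\<close> and \<open>s = sin t\<close> the second component is the
  derivative of the first in t. Velocities along the rotation are thus again independent of
  positions, which integration by parts and the Maurey-Pisier argument exploit.\<close>

definition rot :: "real \<Rightarrow> real \<Rightarrow> (nat \<Rightarrow> 'e) \<times> (nat \<Rightarrow> 'e) \<Rightarrow> (nat \<Rightarrow> 'e) \<times> (nat \<Rightarrow> 'e)" where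
  "rot c s z = ((\<lambda>k. c *\<^sub>R fst z k + s *\<^sub>R snd z k), (\<lambda>k. (- s) *\<^sub>R fst z k + c *\<^sub>R snd z k))"

lemma lin_form_rot:
  "lin_form N w (fst (rot c s z)) = c * lin_form N w (fst z) + s * lin_form N w (snd z)"
  "lin_form N w (snd (rot c s z)) = (- s) * lin_form N w (fst z) + c * lin_form N w (snd z)"
  unfolding rot_def fst_conv snd_conv by (rule lin_form_lincomb_right)+

lemma rot_measurable[measurable]: "rot c s \<in> measurable (P \<Otimes>\<^sub>M P) (P \<Otimes>\<^sub>M P)"
proof (rule measurable_pair)
  have *: "(\<lambda>z. lin_form N w (fst z)) \<in> borel_measurable (P \<Otimes>\<^sub>M P)"
    "(\<lambda>z. lin_form N w (snd z)) \<in> borel_measurable (P \<Otimes>\<^sub>M P)" for N w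
    by measurable
  show "fst \<circ> rot c s \<in> measurable (P \<Otimes>\<^sub>M P) P"
    by (rule measurable_identity_P, unfold comp_def lin_form_rot(1))
      (intro borel_measurable_add borel_measurable_times borel_measurable_const *)
  show "snd \<circ> rot c s \<in> measurable (P \<Otimes>\<^sub>M P) P"
    by (rule measurable_identity_P, unfold comp_def lin_form_rot(2))
      (intro borel_measurable_add borel_measurable_times borel_measurable_const *)
qed

text \<open>The characteristic functional of the pair depends on the coefficients only through
  \<open>qf N w w + qf N v v\<close>; the transposed rotation acts on the coefficients and preserves
  this quantity, the cross terms cancelling.\<close>

theorem rotation_invariance:
  assumes cs: "c\<^sup>2 + s\<^sup>2 = 1"
  shows "distr (P \<Otimes>\<^sub>M P) (P \<Otimes>\<^sub>M P) (rot c s) = P \<Otimes>\<^sub>M P"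
proof -
  interpret PP: pair_prob_space P P by unfold_locales
  define U where "U = {u. \<exists>N w v. u = (\<lambda>z :: (nat \<Rightarrow> 'e) \<times> (nat \<Rightarrow> 'e).
    lin_form N w (fst z) + lin_form N v (snd z))}"
  show ?thesis
  proof (rule prob_measure_eqI_char[where U = U])
    show "prob_space (distr (P \<Otimes>\<^sub>M P) (P \<Otimes>\<^sub>M P) (rot c s))"
      by (intro PP.P.prob_space_distr) measurable
    show "prob_space (P \<Otimes>\<^sub>M P)" by unfold_locales
    show "(\<lambda>_. 0) \<in> U" unfolding U_def by (auto intro!: exI[of _ 0] simp: lin_form_def)
    show "(\<lambda>x. r * u x + v x) \<in> U" if "u \<in> U" "v \<in> U" for u v r
      using that lin_form_lincomb_exists[of r] unfolding U_def by (fastforce simp: fun_eq_iff)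
    show "u \<in> borel_measurable (distr (P \<Otimes>\<^sub>M P) (P \<Otimes>\<^sub>M P) (rot c s))" if "u \<in> U" for u
      using that unfolding U_def by auto
    show "(\<lambda>x. x) \<in> measurable Q (distr (P \<Otimes>\<^sub>M P) (P \<Otimes>\<^sub>M P) (rot c s))"
      if meas: "\<And>u. u \<in> U \<Longrightarrow> u \<in> borel_measurable Q" for Q
    proof -
      have fst_snd: "(\<lambda>z. lin_form N w (fst z)) \<in> U" "(\<lambda>z. lin_form N w (snd z)) \<in> U" for N w
        unfolding U_def
        by (rule CollectI, rule exI[of _ N], rule exI[of _ w], rule exI[of _ "\<lambda>_. 0"], simp add: lin_form_def)
           (rule CollectI, rule exI[of _ N], rule exI[of _ "\<lambda>_. 0"], rule exI[of _ w], simp add: lin_form_def)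
      have "fst \<in> measurable Q P" "snd \<in> measurable Q P"
        by (rule measurable_identity_P, rule meas, rule fst_snd)+
      then have "(\<lambda>x. x) \<in> measurable Q (P \<Otimes>\<^sub>M P)"
        by (intro measurable_pair) (auto simp: comp_def)
      then show ?thesis by (simp cong: measurable_cong_sets)
    qed
    fix u assume "u \<in> U"
    then obtain N w v where u: "u = (\<lambda>z. lin_form N w (fst z) + lin_form N v (snd z))"
      by (auto simp: U_def)
    define w' where "w' k = c *\<^sub>R w k + (- s) *\<^sub>R v k" for k
    define v' where "v' k = s *\<^sub>R w k + c *\<^sub>R v k" for k
    have ur: "u (rot c s z) = lin_form N w' (fst z) + lin_form N v' (snd z)" for z
      unfolding u w'_def v'_def lin_form_lincomb[symmetric] lin_form_rot by (simp add: algebra_simps)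
    have [measurable]: "u \<in> borel_measurable (P \<Otimes>\<^sub>M P)" unfolding u by measurable
    have q: "qf N w' w' + qf N v' v' = qf N w w + qf N v v"
    proof -
      have "qf N w' w' + qf N v' v' = (c\<^sup>2 + s\<^sup>2) * (qf N w w + qf N v v)"
        unfolding w'_def v'_def qf_bilinear qf_commute[of N v w]
        by (simp add: power2_eq_square algebra_simps)
      then show ?thesis using cs by simp
    qed
    have "(CLINT x|distr (P \<Otimes>\<^sub>M P) (P \<Otimes>\<^sub>M P) (rot c s). iexp (u x)) = (CLINT z|P \<Otimes>\<^sub>M P. iexp (u (rot c s z)))"
      by (subst integral_distr) auto
    also have "\<dots> = (CLINT x|P \<Otimes>\<^sub>M P. iexp (u x))"
      unfolding ur unfolding u char_pair q ..
    finally show "(CLINT x|distr (P \<Otimes>\<^sub>M P) (P \<Otimes>\<^sub>M P) (rot c s). iexp (u x)) = (CLINT x|P \<Otimes>\<^sub>M P. iexp (u x))" .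
  qed auto
qed

text \<open>Stability of the Gaussian law, again by characteristic functionals. It reduces the mixed
  term of Chevet's bound, conditionally on the scalar weights, to one rescaled copy of X.\<close>

lemma distr_weighted_sum:
  "distr P borel (\<lambda>x. \<Sum>k<N. a k *\<^sub>R x k) = distr \<mu> borel (\<lambda>z. sqrt (\<Sum>k<N. (a k)\<^sup>2) *\<^sub>R z)"
proof (rule prob_measure_eqI_char[where U = "range (blinfun_apply :: ('e \<Rightarrow>\<^sub>L real) \<Rightarrow> _)"])
  have [measurable]: "(\<lambda>x. \<Sum>k<N. a k *\<^sub>R x k) \<in> borel_measurable P"
    by (intro borel_measurable_sum borel_measurable_scaleR borel_measurable_const measurable_P_coord)
  have [measurable]: "(\<lambda>z. r *\<^sub>R z) \<in> borel_measurable \<mu>" for r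
    unfolding measurable_cong_sets[OF sets_eq refl]
    by (intro borel_measurable_continuous_onI continuous_intros)
  show "prob_space (distr P borel (\<lambda>x. \<Sum>k<N. a k *\<^sub>R x k))"
    by (intro P.prob_space_distr) measurable
  show "prob_space (distr \<mu> borel (\<lambda>z. sqrt (\<Sum>k<N. (a k)\<^sup>2) *\<^sub>R z))"
    by (intro prob_space_distr) measurable
  show "(\<lambda>_. 0) \<in> range (blinfun_apply :: ('e \<Rightarrow>\<^sub>L real) \<Rightarrow> _)"
    by (rule range_eqI[where x = 0]) auto
  show "(\<lambda>x. s * u x + v x) \<in> range blinfun_apply" if "u \<in> range blinfun_apply" "v \<in> range blinfun_apply"
    for s and u v :: "'e \<Rightarrow> real"
  proof -
    from that obtain u' v' :: "'e \<Rightarrow>\<^sub>L real" where "u = blinfun_apply u'" "v = blinfun_apply v'" by blast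
    then show ?thesis
      by (intro range_eqI[where x = "s *\<^sub>R u' + v'"]) (auto simp: blinfun.add_left blinfun.scaleR_left)
  qed
  show "(\<lambda>x. x) \<in> measurable Q (distr P borel (\<lambda>x. \<Sum>k<N. a k *\<^sub>R x k))"
    if "\<And>u :: 'e \<Rightarrow> real. u \<in> range blinfun_apply \<Longrightarrow> u \<in> borel_measurable Q" for Q :: "'e measure"
  proof -
    have "(\<lambda>x. x) \<in> borel_measurable Q"
      by (rule borel_measurable_weakly, rule that, rule rangeI)
    then show ?thesis
      by (subst measurable_cong_sets[OF refl sets_distr])
  qed
  fix u :: "'e \<Rightarrow> real" assume "u \<in> range blinfun_apply"
  then obtain u' :: "'e \<Rightarrow>\<^sub>L real" where u: "u = blinfun_apply u'" by blast
  have "(CLINT x|distr P borel (\<lambda>x. \<Sum>k<N. a k *\<^sub>R x k). iexp (u x)) = (CLINT x|P. iexp (lin_form N (\<lambda>k. a k *\<^sub>R u') x))"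
    unfolding u by (subst integral_distr)
      (auto simp: lin_form_def blinfun.sum_right blinfun.scaleR_right blinfun.scaleR_left)
  also have "\<dots> = exp (- ((\<Sum>k<N. (a k)\<^sup>2) * cov u' u') / 2)"
    unfolding char_lin_form qf_def
    by (simp add: cov_def blinfun.scaleR_left blinfun.scaleR_right sum_distrib_right power2_eq_square mult.assoc)
  also have "\<dots> = (CLINT x|\<mu>. iexp (blinfun_apply (sqrt (\<Sum>k<N. (a k)\<^sup>2) *\<^sub>R u') x))"
  proof -
    have "0 \<le> (\<Sum>k<N. (a k)\<^sup>2)" by (intro sum_nonneg) auto
    then show ?thesis
      unfolding char_functional by (simp add: cov_def blinfun.scaleR_left blinfun.scaleR_right flip: mult.assoc)
  qed
  also have "\<dots> = (CLINT x|distr \<mu> borel (\<lambda>z. sqrt (\<Sum>k<N. (a k)\<^sup>2) *\<^sub>R z). iexp (u x))"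
    unfolding u by (subst integral_distr) (auto simp: blinfun.scaleR_left blinfun.scaleR_right)
  finally show "(CLINT x|distr P borel (\<lambda>x. \<Sum>k<N. a k *\<^sub>R x k). iexp (u x))
    = (CLINT x|distr \<mu> borel (\<lambda>z. sqrt (\<Sum>k<N. (a k)\<^sup>2) *\<^sub>R z). iexp (u x))" .
qed auto

end

section \<open>Integration by parts and Gaussian comparison\<close>

lemma (in pair_sigma_finite) has_bochner_integral_mult_pair:
  fixes f g :: "_ \<Rightarrow> real"
  assumes f: "integrable M1 f" and g: "integrable M2 g"
  shows "has_bochner_integral (M1 \<Otimes>\<^sub>M M2) (\<lambda>z. f (fst z) * g (snd z)) ((\<integral>x. f x \<partial>M1) * (\<integral>y. g y \<partial>M2))"
proof -
  have [measurable]: "f \<in> borel_measurable M1" "g \<in> borel_measurable M2"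
    using f g by auto
  have int: "integrable (M1 \<Otimes>\<^sub>M M2) (\<lambda>z. f (fst z) * g (snd z))"
  proof (rule Fubini_integrable)
    show "integrable M1 (\<lambda>x. \<integral>y. norm (f (fst (x, y)) * g (snd (x, y))) \<partial>M2)"
      using f by (simp add: abs_mult)
    show "AE x in M1. integrable M2 (\<lambda>y. f (fst (x, y)) * g (snd (x, y)))"
      using g by simp
  qed measurable
  have "(\<integral>z. f (fst z) * g (snd z) \<partial>(M1 \<Otimes>\<^sub>M M2)) = (\<integral>x. \<integral>y. f x * g y \<partial>M2 \<partial>M1)"
    using integral_fst'[OF int] by simp
  then show ?thesis using int by (simp add: has_bochner_integral_iff)
qed

lemma trig_fst_measurable:
  "(\<lambda>p. cos (fst p :: real)) \<in> borel_measurable (lborel \<Otimes>\<^sub>M Q)"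
  "(\<lambda>p. sin (fst p :: real)) \<in> borel_measurable (lborel \<Otimes>\<^sub>M Q)"
  "(\<lambda>p. - sin (fst p :: real)) \<in> borel_measurable (lborel \<Otimes>\<^sub>M Q)"
proof -
  have comp: "(\<lambda>p. g (fst p)) \<in> borel_measurable (lborel \<Otimes>\<^sub>M Q)" if "continuous_on UNIV g" for g :: "real \<Rightarrow> real"
    by (rule measurable_compose[OF measurable_fst]) (simp add: borel_measurable_continuous_onI that)
  show "(\<lambda>p. cos (fst p :: real)) \<in> borel_measurable (lborel \<Otimes>\<^sub>M Q)"
    by (rule comp[of cos]) (intro continuous_intros)
  show "(\<lambda>p. sin (fst p :: real)) \<in> borel_measurable (lborel \<Otimes>\<^sub>M Q)"
    by (rule comp[of sin]) (intro continuous_intros)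
  show "(\<lambda>p. - sin (fst p :: real)) \<in> borel_measurable (lborel \<Otimes>\<^sub>M Q)"
    by (rule comp[of "\<lambda>t. - sin t"]) (intro continuous_intros)
qed

context gaussian
begin

lemma rot_zero: "rot 1 0 z = z"
  by (simp add: rot_def)

lemma rot_right_angle: "rot 0 1 z = (snd z, \<lambda>k. - fst z k)"
  by (simp add: rot_def)

lemma rot_joint_measurable[measurable]:
  "(\<lambda>p. rot (cos (fst p)) (sin (fst p)) (snd p)) \<in> measurable (lborel \<Otimes>\<^sub>M (P \<Otimes>\<^sub>M P)) (P \<Otimes>\<^sub>M P)"
proof (rule measurable_pair)
  have fs[measurable]: "(\<lambda>p. lin_form N w (fst (snd p))) \<in> borel_measurable (lborel \<Otimes>\<^sub>M (P \<Otimes>\<^sub>M P))"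
    "(\<lambda>p. lin_form N w (snd (snd p))) \<in> borel_measurable (lborel \<Otimes>\<^sub>M (P \<Otimes>\<^sub>M P))" for N w
    by measurable
  show "fst \<circ> (\<lambda>p. rot (cos (fst p)) (sin (fst p)) (snd p)) \<in> measurable (lborel \<Otimes>\<^sub>M (P \<Otimes>\<^sub>M P)) P"
    by (rule measurable_identity_P, unfold comp_def lin_form_rot(1))
      (intro borel_measurable_add borel_measurable_times fs trig_fst_measurable)
  show "snd \<circ> (\<lambda>p. rot (cos (fst p)) (sin (fst p)) (snd p)) \<in> measurable (lborel \<Otimes>\<^sub>M (P \<Otimes>\<^sub>M P)) P"
    by (rule measurable_identity_P, unfold comp_def lin_form_rot(2))
      (intro borel_measurable_add borel_measurable_times fs trig_fst_measurable)
qed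

lemma distr_rot: "distr (P \<Otimes>\<^sub>M P) (P \<Otimes>\<^sub>M P) (rot (cos t) (sin t)) = P \<Otimes>\<^sub>M P"
  by (rule rotation_invariance) simp

text \<open>Differentiating the invariance under rotations replaces Gaussian integration by parts:
  the expectation of the infinitesimal generator of the rotation group vanishes.\<close>

theorem rotation_generator_integral_zero:
  fixes F G :: "(nat \<Rightarrow> 'e) \<times> (nat \<Rightarrow> 'e) \<Rightarrow> real"
  assumes deriv: "\<And>z t. ((\<lambda>t. F (rot (cos t) (sin t) z)) has_real_derivative G (rot (cos t) (sin t) z)) (at t)"
    and cont: "\<And>z. continuous_on UNIV (\<lambda>t. G (rot (cos t) (sin t) z))"
    and intF: "integrable (P \<Otimes>\<^sub>M P) F" and intG: "integrable (P \<Otimes>\<^sub>M P) G"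
  shows "(\<integral>z. G z \<partial>(P \<Otimes>\<^sub>M P)) = 0"
proof -
  interpret PP: pair_prob_space P P by unfold_locales
  interpret L: pair_sigma_finite lborel "P \<Otimes>\<^sub>M P" by unfold_locales
  have [measurable]: "F \<in> borel_measurable (P \<Otimes>\<^sub>M P)" "G \<in> borel_measurable (P \<Otimes>\<^sub>M P)"
    using intF intG by auto
  have inv: "(\<integral>z. f (rot (cos t) (sin t) z) \<partial>(P \<Otimes>\<^sub>M P)) = (\<integral>z. f z \<partial>(P \<Otimes>\<^sub>M P))"
    if "f \<in> borel_measurable (P \<Otimes>\<^sub>M P)" for f :: "_ \<Rightarrow> real" and t
    using that by (subst (2) distr_rot[of t, symmetric], subst integral_distr) auto
  have invint: "integrable (P \<Otimes>\<^sub>M P) (\<lambda>z. f (rot (cos t) (sin t) z))"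
    if "integrable (P \<Otimes>\<^sub>M P) f" for f :: "_ \<Rightarrow> real" and t
    using that by (subst integrable_distr_eq[symmetric, where N = "P \<Otimes>\<^sub>M P"]) (auto simp: distr_rot)
  \<comment> \<open>Since the integrals of F and G are rotation invariant, integrating over a whole
    interval of angles avoids a limit of difference quotients; length 1 leaves exactly the integral
    of G.\<close>
  have ftc: "F (rot (cos 1) (sin 1) z) - F z = (\<integral>t. indicator {0..1} t * G (rot (cos t) (sin t) z) \<partial>lborel)" for z
    using integral_FTC_Icc_real[where a = 0 and b = 1 and F = "\<lambda>t. F (rot (cos t) (sin t) z)" and f = "\<lambda>t. G (rot (cos t) (sin t) z)"]
      deriv[of z] cont[of z] by (simp add: rot_zero mult.commute continuous_on_eq_continuous_at)
  define c where "c = (\<integral>z. \<bar>G z\<bar> \<partial>(P \<Otimes>\<^sub>M P))"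
  have int: "integrable (lborel \<Otimes>\<^sub>M (P \<Otimes>\<^sub>M P)) (\<lambda>p. indicator {0..1} (fst p) * G (rot (cos (fst p)) (sin (fst p)) (snd p)))"
  proof (rule L.Fubini_integrable)
    have "(\<integral>y. norm (indicator {0..1} x * G (rot (cos x) (sin x) y)) \<partial>(P \<Otimes>\<^sub>M P)) = indicator {0..1} x * c" for x
      using inv[of "\<lambda>z. \<bar>G z\<bar>" x] by (simp add: abs_mult c_def)
    then show "integrable lborel (\<lambda>x. \<integral>y. norm (indicator {0..1} (fst (x, y)) * G (rot (cos (fst (x, y))) (sin (fst (x, y))) (snd (x, y)))) \<partial>(P \<Otimes>\<^sub>M P))"
      by simp
    show "AE x in lborel. integrable (P \<Otimes>\<^sub>M P) (\<lambda>y. indicator {0..1} (fst (x, y)) * G (rot (cos (fst (x, y))) (sin (fst (x, y))) (snd (x, y))))"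
      using invint[OF intG] by simp
  qed measurable
  have "0 = (\<integral>z. F (rot (cos 1) (sin 1) z) - F z \<partial>(P \<Otimes>\<^sub>M P))"
    using inv[of F 1] invint[OF intF, of 1] intF by simp
  also have "\<dots> = (\<integral>z. (\<integral>t. indicator {0..1} t * G (rot (cos t) (sin t) z) \<partial>lborel) \<partial>(P \<Otimes>\<^sub>M P))"
    unfolding ftc ..
  also have "\<dots> = (\<integral>t. (\<integral>z. indicator {0..1} t * G (rot (cos t) (sin t) z) \<partial>(P \<Otimes>\<^sub>M P)) \<partial>lborel)"
    using L.Fubini_integral[of "\<lambda>t z. indicator {0..1} t * G (rot (cos t) (sin t) z)"] int
    by (simp add: case_prod_unfold)
  also have "\<dots> = (\<integral>t. indicator {0..1::real} t * (\<integral>z. G z \<partial>(P \<Otimes>\<^sub>M P)) \<partial>lborel)"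
    using inv[of G] by simp
  also have "\<dots> = (\<integral>z. G z \<partial>(P \<Otimes>\<^sub>M P))" by simp
  finally show ?thesis by simp
qed

text \<open>The larger of \<open>\<bar>a + b\<bar>\<close> and \<open>\<bar>a - b\<bar>\<close>
  equals \<open>\<bar>a\<bar> + \<bar>b\<bar>\<close>, so each summand is absorbed into the leading
  form at the price of a sum of two exponentials. These functions are the majorants for all
  integrability claims of the comparison.\<close>

lemma exp_abs_sum_integrable:
  "integrable P (\<lambda>x. exp (\<bar>lin_form N w x\<bar> + (\<Sum>v\<leftarrow>L. \<bar>lin_form N v x\<bar>)))"
proof (induction L arbitrary: w)
  case Nil
  then show ?case using lin_form_exp_abs by simp
next
  case (Cons b L)
  let ?R = "\<lambda>x. (\<Sum>v\<leftarrow>L. \<bar>lin_form N v x\<bar>)"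
  have meas[measurable]: "(\<lambda>x. \<Sum>v\<leftarrow>K. \<bar>lin_form N v x\<bar>) \<in> borel_measurable P" for K
    by (induct K) simp_all
  have "integrable P (\<lambda>x. exp (\<bar>lin_form N (\<lambda>k. 1 *\<^sub>R w k + 1 *\<^sub>R b k) x\<bar> + ?R x) + exp (\<bar>lin_form N (\<lambda>k. 1 *\<^sub>R w k + (-1) *\<^sub>R b k) x\<bar> + ?R x))"
    by (intro Bochner_Integration.integrable_add Cons.IH)
  then show ?case
  proof (rule Bochner_Integration.integrable_bound)
    show "AE x in P. norm (exp (\<bar>lin_form N w x\<bar> + (\<Sum>v\<leftarrow>b # L. \<bar>lin_form N v x\<bar>)))
      \<le> norm (exp (\<bar>lin_form N (\<lambda>k. 1 *\<^sub>R w k + 1 *\<^sub>R b k) x\<bar> + ?R x) + exp (\<bar>lin_form N (\<lambda>k. 1 *\<^sub>R w k + (-1) *\<^sub>R b k) x\<bar> + ?R x))"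
    proof (intro AE_I2)
      fix x
      have "\<bar>lin_form N w x\<bar> + \<bar>lin_form N b x\<bar> \<le> \<bar>lin_form N w x + lin_form N b x\<bar>
        \<or> \<bar>lin_form N w x\<bar> + \<bar>lin_form N b x\<bar> \<le> \<bar>lin_form N w x - lin_form N b x\<bar>"
        by linarith
      then have "exp (\<bar>lin_form N w x\<bar> + \<bar>lin_form N b x\<bar> + ?R x) \<le> exp (\<bar>lin_form N w x + lin_form N b x\<bar> + ?R x)
        \<or> exp (\<bar>lin_form N w x\<bar> + \<bar>lin_form N b x\<bar> + ?R x) \<le> exp (\<bar>lin_form N w x - lin_form N b x\<bar> + ?R x)"
        by auto
      then have "exp (\<bar>lin_form N w x\<bar> + \<bar>lin_form N b x\<bar> + ?R x) \<le> exp (\<bar>lin_form N w x + lin_form N b x\<bar> + ?R x)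
        + exp (\<bar>lin_form N w x - lin_form N b x\<bar> + ?R x)"
        by (smt (verit) exp_gt_zero)
      then show "norm (exp (\<bar>lin_form N w x\<bar> + (\<Sum>v\<leftarrow>b # L. \<bar>lin_form N v x\<bar>)))
      \<le> norm (exp (\<bar>lin_form N (\<lambda>k. 1 *\<^sub>R w k + 1 *\<^sub>R b k) x\<bar> + ?R x) + exp (\<bar>lin_form N (\<lambda>k. 1 *\<^sub>R w k + (-1) *\<^sub>R b k) x\<bar> + ?R x))"
        unfolding lin_form_lincomb[symmetric] by (simp add: add_ac)
    qed
  qed measurable
qed

end

text \<open>\<open>soft_max\<close> is a smooth substitute for \<open>exp (max z)\<close>, and \<open>soft_grad\<close> is its gradient.\<close>

definition part_fn :: "'i set \<Rightarrow> real \<Rightarrow> ('i \<Rightarrow> real) \<Rightarrow> real" where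
  "part_fn I \<beta> z = (\<Sum>i\<in>I. exp (\<beta> * z i))"

definition soft_max :: "'i set \<Rightarrow> real \<Rightarrow> ('i \<Rightarrow> real) \<Rightarrow> real" where
  "soft_max I \<beta> z = exp (ln (part_fn I \<beta> z) / \<beta>)"

definition gibbs :: "'i set \<Rightarrow> real \<Rightarrow> ('i \<Rightarrow> real) \<Rightarrow> 'i \<Rightarrow> real" where
  "gibbs I \<beta> z i = exp (\<beta> * z i) / part_fn I \<beta> z"

definition soft_grad :: "'i set \<Rightarrow> real \<Rightarrow> ('i \<Rightarrow> real) \<Rightarrow> 'i \<Rightarrow> real" where
  "soft_grad I \<beta> z i = soft_max I \<beta> z * gibbs I \<beta> z i"

section \<open>Bounds and derivatives of the soft maximum\<close>

locale soft =
  fixes I :: "'i set" and \<beta> :: real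
  assumes finI: "finite I" and neI: "I \<noteq> {}" and beta: "1 \<le> \<beta>"
begin

lemma part_pos: "0 < part_fn I \<beta> z"
  unfolding part_fn_def using finI neI by (intro sum_pos) auto

lemma gibbs_nonneg: "0 \<le> gibbs I \<beta> z i"
  using part_pos[of z] by (simp add: gibbs_def)

lemma gibbs_sum: "(\<Sum>i\<in>I. gibbs I \<beta> z i) = 1"
  using part_pos[of z] by (simp add: gibbs_def part_fn_def flip: sum_divide_distrib)

lemma gibbs_le_1: "i \<in> I \<Longrightarrow> gibbs I \<beta> z i \<le> 1"
  using gibbs_sum[of z] finI gibbs_nonneg[of z] by (metis member_le_sum)

lemma soft_max_pos: "0 < soft_max I \<beta> z"
  by (simp add: soft_max_def)

lemma soft_grad_nonneg: "0 \<le> soft_grad I \<beta> z i"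
  using soft_max_pos[of z] gibbs_nonneg[of z i] by (simp add: soft_grad_def)

text \<open>\<open>soft_max\<close> is the norm of exponent \<beta> of the family
  \<open>exp (z i)\<close>, and such norms decrease in \<beta>. The point is an integrable majorant
  that does not involve \<beta>.\<close>

lemma soft_max_le: "soft_max I \<beta> z \<le> (\<Sum>i\<in>I. exp \<bar>z i\<bar>)"
proof -
  define S where "S = (\<Sum>i\<in>I. exp \<bar>z i\<bar>)"
  have S: "0 < S" unfolding S_def using finI neI by (intro sum_pos) auto
  have zle: "z i \<le> ln S" if "i \<in> I" for i
  proof -
    have "exp \<bar>z i\<bar> \<le> S" unfolding S_def using finI that by (intro member_le_sum) auto
    then have "\<bar>z i\<bar> \<le> ln S" using S by (simp add: ln_ge_iff)
    then show ?thesis by simp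
  qed
  have "part_fn I \<beta> z \<le> (\<Sum>i\<in>I. exp \<bar>z i\<bar> * exp ((\<beta> - 1) * ln S))"
    unfolding part_fn_def
  proof (intro sum_mono)
    fix i assume i: "i \<in> I"
    have "(\<beta> - 1) * z i \<le> (\<beta> - 1) * ln S" using zle[OF i] beta by (intro mult_left_mono) auto
    then have "\<beta> * z i \<le> \<bar>z i\<bar> + (\<beta> - 1) * ln S" by (simp add: algebra_simps)
    then show "exp (\<beta> * z i) \<le> exp \<bar>z i\<bar> * exp ((\<beta> - 1) * ln S)" by (simp flip: exp_add)
  qed
  also have "\<dots> = exp (ln S) * exp ((\<beta> - 1) * ln S)" using S by (simp add: S_def flip: sum_distrib_right)
  also have "\<dots> = exp (\<beta> * ln S)" by (simp add: algebra_simps flip: exp_add)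
  finally have "ln (part_fn I \<beta> z) \<le> \<beta> * ln S" using part_pos[of z] by (metis exp_gt_zero ln_exp ln_le_cancel_iff)
  then have "ln (part_fn I \<beta> z) / \<beta> \<le> ln S" using beta by (simp add: divide_le_eq mult.commute)
  then have "soft_max I \<beta> z \<le> exp (ln S)" by (simp add: soft_max_def)
  then show ?thesis using S by (simp add: S_def)
qed

lemma soft_max_ge:
  assumes "i \<in> I"
  shows "exp (z i) \<le> soft_max I \<beta> z"
proof -
  have "exp (\<beta> * z i) \<le> part_fn I \<beta> z"
    unfolding part_fn_def using finI assms by (intro member_le_sum) auto
  then have "\<beta> * z i \<le> ln (part_fn I \<beta> z)" using part_pos[of z] by (simp add: ln_ge_iff)
  then have "z i \<le> ln (part_fn I \<beta> z) / \<beta>" using beta by (simp add: le_divide_eq mult.commute)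
  then show ?thesis by (simp add: soft_max_def)
qed

text \<open>A family of k members costs a factor k^(1/\<beta>), and at \<open>\<beta> = k\<close>
  this is at most 2 because k is at most 2^k. A fixed \<beta> thus replaces the limit of large
  \<beta>, and the comparison theorem inherits the factor 2.\<close>

lemma soft_max_le_card:
  assumes "\<And>i. i \<in> I \<Longrightarrow> z i \<le> m" and "\<beta> = card I"
  shows "soft_max I \<beta> z \<le> 2 * exp m"
proof -
  have "part_fn I \<beta> z \<le> (\<Sum>i\<in>I. exp (\<beta> * m))"
    unfolding part_fn_def using assms(1) beta by (intro sum_mono) auto
  also have "\<dots> = \<beta> * exp (\<beta> * m)" using assms(2) by simp
  also have "\<dots> \<le> exp (\<beta> * ln 2) * exp (\<beta> * m)"
  proof (intro mult_right_mono)
    have "real (card I) \<le> 2 ^ card I" using less_exp[of "card I"] by (metis less_imp_le of_nat_le_iff of_nat_numeral of_nat_power)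
    also have "(2::real) ^ card I = exp (\<beta> * ln 2)" unfolding assms(2) by (simp add: exp_of_nat_mult)
    finally show "\<beta> \<le> exp (\<beta> * ln 2)" using assms(2) by simp
  qed simp
  also have "\<dots> = exp (\<beta> * (ln 2 + m))" by (simp add: algebra_simps flip: exp_add)
  finally have "ln (part_fn I \<beta> z) \<le> \<beta> * (ln 2 + m)" using part_pos[of z] by (metis exp_gt_zero ln_exp ln_le_cancel_iff)
  then have "ln (part_fn I \<beta> z) / \<beta> \<le> ln 2 + m" using beta by (simp add: divide_le_eq mult.commute)
  then have "soft_max I \<beta> z \<le> exp (ln 2 + m)" by (simp add: soft_max_def)
  then show ?thesis by (simp add: exp_add)
qed

lemma part_deriv:
  assumes "\<And>i. ((\<lambda>t. z t i) has_real_derivative d i) (at t)"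
  shows "((\<lambda>t. part_fn I \<beta> (z t)) has_real_derivative part_fn I \<beta> (z t) * (\<beta> * (\<Sum>j\<in>I. gibbs I \<beta> (z t) j * d j))) (at t)"
proof -
  have "((\<lambda>t. part_fn I \<beta> (z t)) has_real_derivative (\<Sum>i\<in>I. exp (\<beta> * z t i) * (\<beta> * d i))) (at t)"
    unfolding part_fn_def using assms by (auto intro!: derivative_eq_intros sum.cong simp: mult.commute)
  also have "(\<Sum>i\<in>I. exp (\<beta> * z t i) * (\<beta> * d i)) = part_fn I \<beta> (z t) * (\<beta> * (\<Sum>j\<in>I. gibbs I \<beta> (z t) j * d j))"
    using part_pos[of "z t"] by (simp add: gibbs_def sum_distrib_left mult_ac)
  finally show ?thesis .
qed

lemma soft_max_deriv:
  assumes "\<And>i. ((\<lambda>t. z t i) has_real_derivative d i) (at t)"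
  shows "((\<lambda>t. soft_max I \<beta> (z t)) has_real_derivative (\<Sum>j\<in>I. soft_grad I \<beta> (z t) j * d j)) (at t)"
proof -
  have "((\<lambda>t. soft_max I \<beta> (z t)) has_real_derivative soft_max I \<beta> (z t) * (\<Sum>j\<in>I. gibbs I \<beta> (z t) j * d j)) (at t)"
    unfolding soft_max_def using part_pos[of "z t"] beta
    by (auto intro!: derivative_eq_intros part_deriv assms simp: field_simps)
  then show ?thesis by (simp add: soft_grad_def sum_distrib_left mult.assoc)
qed

text \<open>Writing the gradient as a single exponential makes the second derivatives explicit.
  Their off-diagonal part carries the factor \<open>\<beta> - 1\<close>, whose sign decides the
  comparison; this is where \<open>1 \<le> \<beta>\<close> matters.\<close>

lemma soft_grad_deriv:
  assumes "\<And>i. ((\<lambda>t. z t i) has_real_derivative d i) (at t)"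
  shows "((\<lambda>t. soft_grad I \<beta> (z t) i) has_real_derivative
    \<beta> * soft_grad I \<beta> (z t) i * d i - (\<beta> - 1) * (\<Sum>j\<in>I. soft_grad I \<beta> (z t) i * gibbs I \<beta> (z t) j * d j)) (at t)"
proof -
  define s where "s = (\<Sum>j\<in>I. gibbs I \<beta> (z t) j * d j)"
  have eq: "soft_grad I \<beta> z i = exp ((1 / \<beta> - 1) * ln (part_fn I \<beta> z) + \<beta> * z i)" for z
  proof -
    have "exp ((1 / \<beta> - 1) * ln (part_fn I \<beta> z) + \<beta> * z i) = exp (ln (part_fn I \<beta> z) / \<beta>) * exp (\<beta> * z i) / exp (ln (part_fn I \<beta> z))"
      by (simp add: algebra_simps flip: exp_add exp_diff)
    then show ?thesis
      using part_pos[of z] by (simp add: soft_grad_def soft_max_def gibbs_def)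
  qed
  have ln: "((\<lambda>t. ln (part_fn I \<beta> (z t))) has_real_derivative \<beta> * s) (at t)"
    using part_pos[of "z t"] by (auto intro!: derivative_eq_intros part_deriv assms simp: s_def)
  have "((\<lambda>t. soft_grad I \<beta> (z t) i) has_real_derivative soft_grad I \<beta> (z t) i * ((1 / \<beta> - 1) * (\<beta> * s) + \<beta> * d i)) (at t)"
    unfolding eq by (intro DERIV_fun_exp DERIV_add DERIV_cmult ln assms)
  moreover have "soft_grad I \<beta> (z t) i * ((1 / \<beta> - 1) * (\<beta> * s) + \<beta> * d i)
    = \<beta> * soft_grad I \<beta> (z t) i * d i - (\<beta> - 1) * (soft_grad I \<beta> (z t) i * s)"
    using beta by (simp add: field_simps)
  moreover have "soft_grad I \<beta> (z t) i * s = (\<Sum>j\<in>I. soft_grad I \<beta> (z t) i * gibbs I \<beta> (z t) j * d j)"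
    by (simp add: s_def sum_distrib_left mult.assoc)
  ultimately show ?thesis by simp
qed

lemma soft_continuous:
  assumes "\<And>i. continuous_on S (\<lambda>t. z t i)"
  shows "continuous_on S (\<lambda>t. gibbs I \<beta> (z t) i)" "continuous_on S (\<lambda>t. soft_max I \<beta> (z t))"
    "continuous_on S (\<lambda>t. soft_grad I \<beta> (z t) i)"
proof -
  have A: "continuous_on S (\<lambda>t. part_fn I \<beta> (z t))"
    unfolding part_fn_def by (intro continuous_intros assms)
  show 1: "continuous_on S (\<lambda>t. gibbs I \<beta> (z t) i)" for i
    unfolding gibbs_def using A assms part_pos by (intro continuous_intros) (auto simp: less_imp_neq[symmetric])
  show 2: "continuous_on S (\<lambda>t. soft_max I \<beta> (z t))"
    unfolding soft_max_def using A part_pos beta by (intro continuous_intros) (auto simp: less_imp_neq[symmetric])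
  show "continuous_on S (\<lambda>t. soft_grad I \<beta> (z t) i)"
    unfolding soft_grad_def by (intro continuous_intros 1 2)
qed

lemma soft_measurable[measurable (raw)]:
  assumes [measurable]: "\<And>i. (\<lambda>x. z x i) \<in> borel_measurable M"
  shows "(\<lambda>x. gibbs I \<beta> (z x) i) \<in> borel_measurable M" "(\<lambda>x. soft_max I \<beta> (z x)) \<in> borel_measurable M"
    "(\<lambda>x. soft_grad I \<beta> (z x) i) \<in> borel_measurable M"
  unfolding soft_grad_def gibbs_def soft_max_def part_fn_def by measurable

lemma soft_grad_le:
  assumes "i \<in> I"
  shows "soft_grad I \<beta> z i \<le> (\<Sum>j\<in>I. exp \<bar>z j\<bar>)"
proof -
  have "soft_grad I \<beta> z i \<le> soft_max I \<beta> z * 1"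
    unfolding soft_grad_def using gibbs_le_1[OF assms] soft_max_pos[of z] by (intro mult_left_mono) auto
  then show ?thesis using soft_max_le[of z] by simp
qed

end

section \<open>Integration by parts for the soft maximum and the comparison theorem\<close>

context gaussian
begin

lemma deriv_rot:
  "((\<lambda>t. lin_form N w (fst (rot (cos t) (sin t) z))) has_real_derivative lin_form N w (snd (rot (cos t) (sin t) z))) (at t)"
  "((\<lambda>t. lin_form N w (snd (rot (cos t) (sin t) z))) has_real_derivative - lin_form N w (fst (rot (cos t) (sin t) z))) (at t)"
  unfolding lin_form_rot by (auto intro!: derivative_eq_intros)

lemma continuous_rot:
  "continuous_on UNIV (\<lambda>t. lin_form N w (fst (rot (cos t) (sin t) z)))"
  "continuous_on UNIV (\<lambda>t. lin_form N w (snd (rot (cos t) (sin t) z)))"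
  unfolding lin_form_rot by (intro continuous_intros)+

lemma soft_integrable:
  fixes ww :: "'i \<Rightarrow> nat \<Rightarrow> 'e \<Rightarrow>\<^sub>L real"
  assumes soft: "soft I \<beta>" and i: "i \<in> I" and j: "j \<in> I"
  shows "integrable P (\<lambda>x. soft_grad I \<beta> (\<lambda>i. lin_form N (ww i) x) i)"
    "integrable P (\<lambda>x. soft_grad I \<beta> (\<lambda>i. lin_form N (ww i) x) i * gibbs I \<beta> (\<lambda>i. lin_form N (ww i) x) j)"
    "integrable P (\<lambda>x. soft_grad I \<beta> (\<lambda>i. lin_form N (ww i) x) i * lin_form N v x)"
    "integrable P (\<lambda>x. soft_max I \<beta> (\<lambda>i. lin_form N (ww i) x))"
proof -
  interpret soft I \<beta> by fact
  let ?W = "\<lambda>x i. lin_form N (ww i) x"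
  have [measurable]: "(\<lambda>x. soft_grad I \<beta> (?W x) i) \<in> borel_measurable P" "(\<lambda>x. gibbs I \<beta> (?W x) i) \<in> borel_measurable P"
    "(\<lambda>x. soft_max I \<beta> (?W x)) \<in> borel_measurable P" for i
    by (intro soft_measurable; simp)+
  have int: "integrable P (\<lambda>x. \<Sum>j\<in>I. exp \<bar>?W x j\<bar>)"
    by (intro Bochner_Integration.integrable_sum lin_form_exp_abs)
  show 1: "integrable P (\<lambda>x. soft_grad I \<beta> (?W x) i)"
    by (rule Bochner_Integration.integrable_bound[OF int])
      (use soft_grad_le[OF i] soft_grad_nonneg in \<open>auto intro: order_trans[OF _ abs_ge_self]\<close>)
  show "integrable P (\<lambda>x. soft_max I \<beta> (?W x))"
    by (rule Bochner_Integration.integrable_bound[OF int])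
      (use soft_max_le soft_max_pos in \<open>auto intro: order_trans[OF _ abs_ge_self] simp: less_imp_le\<close>)
  show "integrable P (\<lambda>x. soft_grad I \<beta> (?W x) i * gibbs I \<beta> (?W x) j)"
    by (rule Bochner_Integration.integrable_bound[OF 1])
      (use gibbs_nonneg gibbs_le_1[OF j] soft_grad_nonneg in \<open>auto simp: abs_mult intro!: mult_left_le\<close>)
  have "integrable P (\<lambda>x. \<Sum>j\<in>I. exp (\<bar>lin_form N (ww j) x\<bar> + (\<Sum>v\<leftarrow>[v]. \<bar>lin_form N v x\<bar>)))"
    by (intro Bochner_Integration.integrable_sum exp_abs_sum_integrable)
  then show "integrable P (\<lambda>x. soft_grad I \<beta> (?W x) i * lin_form N v x)"
  proof (rule Bochner_Integration.integrable_bound)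
    show "AE x in P. norm (soft_grad I \<beta> (?W x) i * lin_form N v x) \<le> norm (\<Sum>j\<in>I. exp (\<bar>lin_form N (ww j) x\<bar> + (\<Sum>v\<leftarrow>[v]. \<bar>lin_form N v x\<bar>)))"
    proof (intro AE_I2)
      fix x
      have "\<bar>lin_form N v x\<bar> \<le> exp \<bar>lin_form N v x\<bar>"
        using exp_ge_add_one_self[of "\<bar>lin_form N v x\<bar>"] by linarith
      then have "soft_grad I \<beta> (?W x) i * \<bar>lin_form N v x\<bar> \<le> (\<Sum>j\<in>I. exp \<bar>?W x j\<bar>) * exp \<bar>lin_form N v x\<bar>"
        using soft_grad_le[OF i] soft_grad_nonneg by (intro mult_mono) (auto intro!: sum_nonneg)
      also have "\<dots> = (\<Sum>j\<in>I. exp (\<bar>lin_form N (ww j) x\<bar> + (\<Sum>v\<leftarrow>[v]. \<bar>lin_form N v x\<bar>)))"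
        by (simp add: sum_distrib_right exp_add)
      finally show "norm (soft_grad I \<beta> (?W x) i * lin_form N v x) \<le> norm (\<Sum>j\<in>I. exp (\<bar>lin_form N (ww j) x\<bar> + (\<Sum>v\<leftarrow>[v]. \<bar>lin_form N v x\<bar>)))"
        using soft_grad_nonneg[of "?W x" i] by (simp add: abs_mult sum_nonneg)
    qed
  qed measurable
qed

text \<open>The generator of the rotation is applied to the gradient at the first copy paired with
  the forms \<open>vv\<close> at the second. It produces the Hessian evaluated on two forms of the
  second copy, which integrates to \<open>qf\<close>, minus the gradient paired with the forms of
  the first copy; the total integral vanishes.\<close>

lemma soft_integration_by_parts:
  fixes ww vv :: "'i \<Rightarrow> nat \<Rightarrow> 'e \<Rightarrow>\<^sub>L real"
  assumes soft: "soft I \<beta>"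
  shows "(\<Sum>i\<in>I. \<integral>x. soft_grad I \<beta> (\<lambda>i. lin_form N (ww i) x) i * lin_form N (vv i) x \<partial>P)
    = (\<Sum>i\<in>I. \<beta> * ((\<integral>x. soft_grad I \<beta> (\<lambda>i. lin_form N (ww i) x) i \<partial>P) * qf N (ww i) (vv i))
       - (\<beta> - 1) * (\<Sum>j\<in>I. (\<integral>x. soft_grad I \<beta> (\<lambda>i. lin_form N (ww i) x) i * gibbs I \<beta> (\<lambda>i. lin_form N (ww i) x) j \<partial>P) * qf N (ww j) (vv i)))"
proof -
  interpret soft I \<beta> by fact
  interpret PP: pair_prob_space P P by unfold_locales
  define W where "W x i = lin_form N (ww i) x" for x i
  define F where "F z = (\<Sum>i\<in>I. soft_grad I \<beta> (W (fst z)) i * lin_form N (vv i) (snd z))" for z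
  define G where "G z = (\<Sum>i\<in>I. (\<beta> * soft_grad I \<beta> (W (fst z)) i * W (snd z) i
      - (\<beta> - 1) * (\<Sum>j\<in>I. soft_grad I \<beta> (W (fst z)) i * gibbs I \<beta> (W (fst z)) j * W (snd z) j)) * lin_form N (vv i) (snd z)
      + (- lin_form N (vv i) (fst z)) * soft_grad I \<beta> (W (fst z)) i)" for z
  have G_eq: "G z = (\<Sum>i\<in>I. \<beta> * (soft_grad I \<beta> (W (fst z)) i * (lin_form N (ww i) (snd z) * lin_form N (vv i) (snd z)))
      - (\<beta> - 1) * (\<Sum>j\<in>I. (soft_grad I \<beta> (W (fst z)) i * gibbs I \<beta> (W (fst z)) j) * (lin_form N (ww j) (snd z) * lin_form N (vv i) (snd z)))
      - (soft_grad I \<beta> (W (fst z)) i * lin_form N (vv i) (fst z)) * 1)" for z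
    unfolding G_def by (intro sum.cong refl) (simp add: W_def algebra_simps sum_distrib_left sum_distrib_right)
  have int: "integrable P (\<lambda>x. soft_grad I \<beta> (W x) i)"
    "integrable P (\<lambda>x. soft_grad I \<beta> (W x) i * gibbs I \<beta> (W x) j)"
    "integrable P (\<lambda>x. soft_grad I \<beta> (W x) i * lin_form N v x)" if "i \<in> I" "j \<in> I" for i j v
    using soft_integrable[OF soft that, of N ww] by (simp_all add: W_def[abs_def])
  have int2: "integrable P (\<lambda>x. lin_form N u x * lin_form N v x)" "(\<integral>x. lin_form N u x * lin_form N v x \<partial>P) = qf N u v" for u v
    using lin_form_mult[of N u v] by (simp_all add: has_bochner_integral_iff)
  have int3: "integrable P (\<lambda>x. lin_form N v x)" for v
    by (rule Bochner_Integration.integrable_bound[OF lin_form_exp_abs[of N v]])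
      (use exp_ge_add_one_self in \<open>auto intro!: AE_I2 simp: order_trans[OF _ exp_ge_add_one_self]\<close>)
  have intG: "has_bochner_integral (P \<Otimes>\<^sub>M P) G (\<Sum>i\<in>I. \<beta> * ((\<integral>x. soft_grad I \<beta> (W x) i \<partial>P) * (\<integral>x. lin_form N (ww i) x * lin_form N (vv i) x \<partial>P))
      - (\<beta> - 1) * (\<Sum>j\<in>I. (\<integral>x. soft_grad I \<beta> (W x) i * gibbs I \<beta> (W x) j \<partial>P) * (\<integral>x. lin_form N (ww j) x * lin_form N (vv i) x \<partial>P))
      - (\<integral>x. soft_grad I \<beta> (W x) i * lin_form N (vv i) x \<partial>P) * (\<integral>x. 1 \<partial>P))"
    unfolding G_eq
    by (intro has_bochner_integral_sum has_bochner_integral_diff has_bochner_integral_mult_right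
        PP.has_bochner_integral_mult_pair int int2 P.integrable_const)
  have intF: "integrable (P \<Otimes>\<^sub>M P) F"
    unfolding F_def
  proof (intro Bochner_Integration.integrable_sum)
    fix i assume "i \<in> I"
    then show "integrable (P \<Otimes>\<^sub>M P) (\<lambda>z. soft_grad I \<beta> (W (fst z)) i * lin_form N (vv i) (snd z))"
      using PP.has_bochner_integral_mult_pair[OF int(1)[of i i] int3[of "vv i"]] by (simp add: has_bochner_integral_iff)
  qed
  have "(\<integral>z. G z \<partial>(P \<Otimes>\<^sub>M P)) = 0"
  proof (rule rotation_generator_integral_zero[where F = F])
    show "((\<lambda>t. F (rot (cos t) (sin t) z)) has_real_derivative G (rot (cos t) (sin t) z)) (at t)" for z t
      unfolding F_def G_def
      by (intro DERIV_sum DERIV_mult soft_grad_deriv deriv_rot; unfold W_def; intro deriv_rot)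
    show "continuous_on UNIV (\<lambda>t. G (rot (cos t) (sin t) z))" for z
      unfolding G_def
      by (intro continuous_intros soft_continuous continuous_rot; unfold W_def; intro continuous_rot)
  qed (use intF intG in \<open>auto simp: has_bochner_integral_iff\<close>)
  then show ?thesis
    using has_bochner_integral_integral_eq[OF intG] P.prob_space
    by (simp add: int2 sum_subtractf W_def[abs_def])
qed

text \<open>Interpolation in the manner of Sudakov and Fernique: by \<open>cross\<close> the two
  families are uncorrelated, and along \<open>cos t * Z + sin t * Y\<close> the mean of
  \<open>soft_max\<close> does not decrease. The exponential of a maximum, unlike the maximum, also
  grows when a common independent variable is added to all members; the condition \<open>var\<close>
  on the variances controls this part.\<close>

theorem gaussian_exp_comparison:
  fixes zw yw :: "'i \<Rightarrow> nat \<Rightarrow> 'e \<Rightarrow>\<^sub>L real"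
  assumes I: "finite I" "I \<noteq> {}"
    and cross: "\<And>i j. qf N (zw i) (yw j) = 0"
    and var: "\<And>i. i \<in> I \<Longrightarrow> qf N (zw i) (zw i) \<le> qf N (yw i) (yw i)"
    and incr: "\<And>i j. i \<in> I \<Longrightarrow> j \<in> I \<Longrightarrow>
      qf N (zw i) (zw i) - 2 * qf N (zw i) (zw j) + qf N (zw j) (zw j)
      \<le> qf N (yw i) (yw i) - 2 * qf N (yw i) (yw j) + qf N (yw j) (yw j)"
    and m[measurable]: "m \<in> borel_measurable P"
    and m_ge: "\<And>x i. i \<in> I \<Longrightarrow> lin_form N (yw i) x \<le> m x"
  shows "(\<integral>\<^sup>+x. ennreal (exp (Max ((\<lambda>i. lin_form N (zw i) x) ` I))) \<partial>P) \<le> 2 * (\<integral>\<^sup>+x. ennreal (exp (m x)) \<partial>P)"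
proof -
  \<comment> \<open>The value at which \<open>soft_max_le_card\<close> loses only a factor
    2.\<close>
  define \<beta> where "\<beta> = real (card I)"
  have beta: "1 \<le> \<beta>" using I by (simp add: \<beta>_def Suc_le_eq card_gt_0_iff)
  have soft: "soft I \<beta>" using I beta by unfold_locales
  interpret soft I \<beta> by fact
  interpret L: pair_sigma_finite lborel P by unfold_locales
  define Z where "Z x i = lin_form N (zw i) x" for x i
  define Y where "Y x i = lin_form N (yw i) x" for x i
  define wt where "wt t i k = cos t *\<^sub>R zw i k + sin t *\<^sub>R yw i k" for t i k
  define vt where "vt t i k = (- sin t) *\<^sub>R zw i k + cos t *\<^sub>R yw i k" for t i k
  define W where "W t x i = lin_form N (wt t i) x" for t x i
  define V where "V t x i = lin_form N (vt t i) x" for t x i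
  have W: "W t x i = cos t * Z x i + sin t * Y x i" and V: "V t x i = (- sin t) * Z x i + cos t * Y x i" for t x i
    unfolding W_def V_def Z_def Y_def wt_def vt_def by (rule lin_form_lincomb[symmetric])+
  define g where "g t x = (\<Sum>i\<in>I. soft_grad I \<beta> (W t x) i * V t x i)" for t x
  define \<Delta> where "\<Delta> i j = qf N (yw i) (yw j) - qf N (zw i) (zw j)" for i j
  have \<Delta>_diag: "0 \<le> \<Delta> i i" if "i \<in> I" for i using var[OF that] by (simp add: \<Delta>_def)
  have \<Delta>_le: "\<Delta> i j \<le> (\<Delta> i i + \<Delta> j j) / 2" if "i \<in> I" "j \<in> I" for i j
    using incr[OF that] by (simp add: \<Delta>_def)
  have qf_wv: "qf N (wt t j) (vt t i) = cos t * sin t * \<Delta> j i" for t i j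
  proof -
    have "qf N (wt t j) (vt t i) = cos t * (- sin t * qf N (zw j) (zw i) + cos t * qf N (zw j) (yw i))
        + sin t * (- sin t * qf N (yw j) (zw i) + cos t * qf N (yw j) (yw i))"
      unfolding wt_def vt_def qf_bilinear by simp
    then show ?thesis
      unfolding cross qf_commute[of N "yw j" "zw i"] by (simp add: \<Delta>_def algebra_simps)
  qed
  have int_grad: "integrable P (\<lambda>x. soft_grad I \<beta> (W t x) i)"
    "integrable P (\<lambda>x. soft_grad I \<beta> (W t x) i * gibbs I \<beta> (W t x) j)"
    "integrable P (\<lambda>x. soft_grad I \<beta> (W t x) i * V t x j)" if "i \<in> I" "j \<in> I" for i j t
    using soft_integrable[OF soft that, of N "wt t"] by (simp_all add: W_def[abs_def] V_def)
  have g_nonneg: "0 \<le> (\<integral>x. g t x \<partial>P)" if t: "0 \<le> t" "t \<le> pi / 2" for t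
  proof -
    define q where "q x = (\<Sum>i\<in>I. \<beta> * (soft_grad I \<beta> (W t x) i * \<Delta> i i)
      - (\<beta> - 1) * (\<Sum>j\<in>I. soft_grad I \<beta> (W t x) i * gibbs I \<beta> (W t x) j * \<Delta> j i))" for x
    have q_nonneg: "0 \<le> q x" for x
    proof -
      define d where "d = (\<Sum>i\<in>I. soft_grad I \<beta> (W t x) i * \<Delta> i i)"
      have d0: "0 \<le> d" unfolding d_def using soft_grad_nonneg \<Delta>_diag by (intro sum_nonneg mult_nonneg_nonneg) auto
      \<comment> \<open>The increment condition bounds \<open>\<Delta> j i\<close> by the mean of
        two diagonal terms. As \<open>soft_grad\<close> is proportional to \<open>gibbs\<close>,
        whose weights sum to 1, each half contributes \<open>d / 2\<close>. Then
        \<open>\<beta> * d - (\<beta> - 1) * d = d\<close> remains, nonnegative by the variance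
        condition.\<close>
      have "(\<Sum>i\<in>I. \<Sum>j\<in>I. soft_grad I \<beta> (W t x) i * gibbs I \<beta> (W t x) j * \<Delta> j i)
        \<le> (\<Sum>i\<in>I. \<Sum>j\<in>I. soft_grad I \<beta> (W t x) i * gibbs I \<beta> (W t x) j * ((\<Delta> j j + \<Delta> i i) / 2))"
        using \<Delta>_le soft_grad_nonneg gibbs_nonneg by (intro sum_mono mult_left_mono mult_nonneg_nonneg) auto
      also have "\<dots> = (1/2) * (\<Sum>i\<in>I. soft_grad I \<beta> (W t x) i * (\<Sum>j\<in>I. gibbs I \<beta> (W t x) j * \<Delta> j j))
        + (1/2) * (\<Sum>i\<in>I. soft_grad I \<beta> (W t x) i * \<Delta> i i * (\<Sum>j\<in>I. gibbs I \<beta> (W t x) j))"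
        by (simp add: sum_distrib_left sum.distrib[symmetric] field_simps)
      also have "(\<Sum>i\<in>I. soft_grad I \<beta> (W t x) i * (\<Sum>j\<in>I. gibbs I \<beta> (W t x) j * \<Delta> j j))
        = soft_max I \<beta> (W t x) * (\<Sum>i\<in>I. gibbs I \<beta> (W t x) i) * (\<Sum>j\<in>I. gibbs I \<beta> (W t x) j * \<Delta> j j)"
        unfolding soft_grad_def sum_distrib_right[symmetric] sum_distrib_left[symmetric] ..
      also have "\<dots> = d" by (simp add: gibbs_sum d_def soft_grad_def sum_distrib_left mult.assoc)
      also have "(\<Sum>i\<in>I. soft_grad I \<beta> (W t x) i * \<Delta> i i * (\<Sum>j\<in>I. gibbs I \<beta> (W t x) j)) = d"
        by (simp add: gibbs_sum d_def)
      finally have le: "(\<Sum>i\<in>I. \<Sum>j\<in>I. soft_grad I \<beta> (W t x) i * gibbs I \<beta> (W t x) j * \<Delta> j i) \<le> d" by simp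
      have "q x = \<beta> * d - (\<beta> - 1) * (\<Sum>i\<in>I. \<Sum>j\<in>I. soft_grad I \<beta> (W t x) i * gibbs I \<beta> (W t x) j * \<Delta> j i)"
        by (simp add: q_def d_def sum_subtractf sum_distrib_left)
      also have "\<dots> \<ge> \<beta> * d - (\<beta> - 1) * d"
        using le beta by (intro diff_left_mono mult_left_mono) auto
      finally show ?thesis using d0 by (simp add: algebra_simps)
    qed
    have "(\<integral>x. g t x \<partial>P) = (\<Sum>i\<in>I. \<integral>x. soft_grad I \<beta> (W t x) i * V t x i \<partial>P)"
      unfolding g_def using int_grad(3) by (intro Bochner_Integration.integral_sum) auto
    also have "\<dots> = (\<Sum>i\<in>I. \<beta> * ((\<integral>x. soft_grad I \<beta> (W t x) i \<partial>P) * (cos t * sin t * \<Delta> i i))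
      - (\<beta> - 1) * (\<Sum>j\<in>I. (\<integral>x. soft_grad I \<beta> (W t x) i * gibbs I \<beta> (W t x) j \<partial>P) * (cos t * sin t * \<Delta> j i)))"
      using soft_integration_by_parts[OF soft, of N "wt t" "vt t"] by (simp add: W_def[abs_def] V_def[abs_def] qf_wv)
    also have "\<dots> = cos t * sin t * (\<Sum>i\<in>I. \<beta> * ((\<integral>x. soft_grad I \<beta> (W t x) i \<partial>P) * \<Delta> i i)
      - (\<beta> - 1) * (\<Sum>j\<in>I. (\<integral>x. soft_grad I \<beta> (W t x) i * gibbs I \<beta> (W t x) j \<partial>P) * \<Delta> j i))"
      unfolding sum_distrib_left by (intro sum.cong refl) (simp add: right_diff_distrib sum_distrib_left mult_ac)
    also have "(\<Sum>i\<in>I. \<beta> * ((\<integral>x. soft_grad I \<beta> (W t x) i \<partial>P) * \<Delta> i i)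
      - (\<beta> - 1) * (\<Sum>j\<in>I. (\<integral>x. soft_grad I \<beta> (W t x) i * gibbs I \<beta> (W t x) j \<partial>P) * \<Delta> j i)) = (\<integral>x. q x \<partial>P)"
    proof -
      have "has_bochner_integral P q (\<Sum>i\<in>I. \<beta> * ((\<integral>x. soft_grad I \<beta> (W t x) i \<partial>P) * \<Delta> i i)
        - (\<beta> - 1) * (\<Sum>j\<in>I. (\<integral>x. soft_grad I \<beta> (W t x) i * gibbs I \<beta> (W t x) j \<partial>P) * \<Delta> j i))"
        unfolding q_def using int_grad
        by (intro has_bochner_integral_sum has_bochner_integral_diff has_bochner_integral_mult_right
            has_bochner_integral_mult_left has_bochner_integral_integrable)
      then show ?thesis by (rule has_bochner_integral_integral_eq[symmetric])
    qed
    finally have "(\<integral>x. g t x \<partial>P) = cos t * sin t * (\<integral>x. q x \<partial>P)" .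
    moreover have "0 \<le> cos t" "0 \<le> sin t"
      using t by (auto intro!: cos_ge_zero sin_ge_zero)
    moreover have "0 \<le> (\<integral>x. q x \<partial>P)" using q_nonneg by simp
    ultimately show ?thesis by simp
  qed
  have deriv: "((\<lambda>t. soft_max I \<beta> (W t x)) has_real_derivative g t x) (at t)" for t x
    unfolding g_def
    by (rule soft_max_deriv) (auto simp: W V intro!: derivative_eq_intros)
  have cont: "continuous_on UNIV (\<lambda>t. g t x)" for x
    unfolding g_def by (intro continuous_intros soft_continuous; unfold W V; intro continuous_intros)
  have ftc: "soft_max I \<beta> (Y x) - soft_max I \<beta> (Z x) = (\<integral>t. indicator {0..pi/2} t * g t x \<partial>lborel)" for x
  proof -
    have "W 0 x = Z x" "W (pi / 2) x = Y x" by (auto simp: W fun_eq_iff)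
    then show ?thesis
      using integral_FTC_Icc_real[where a = 0 and b = "pi / 2" and F = "\<lambda>t. soft_max I \<beta> (W t x)" and f = "\<lambda>t. g t x"]
        deriv[of x] cont[of x] by (simp add: mult.commute continuous_on_eq_continuous_at)
  qed
  \<comment> \<open>A majorant of the derivative that is independent of t, needed to exchange the
    integrals over time and space.\<close>
  define D where "D x = (\<Sum>i\<in>I. \<Sum>j\<in>I. exp (\<bar>Z x j\<bar> + (\<Sum>v\<leftarrow>[yw j, zw i, yw i]. \<bar>lin_form N v x\<bar>)))" for x
  have D_int: "integrable P D"
    unfolding D_def Z_def by (intro Bochner_Integration.integrable_sum exp_abs_sum_integrable)
  have g_le: "\<bar>g t x\<bar> \<le> D x" for t x
  proof -
    have comb: "\<bar>a * p + b * q\<bar> \<le> \<bar>p\<bar> + \<bar>q\<bar>" if "\<bar>a\<bar> \<le> 1" "\<bar>b\<bar> \<le> 1" for a b p q :: real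
      using mult_right_mono[OF that(1), of "\<bar>p\<bar>"] mult_right_mono[OF that(2), of "\<bar>q\<bar>"]
        abs_triangle_ineq[of "a * p" "b * q"] by (simp add: abs_mult)
    have WZ: "\<bar>W t x i\<bar> \<le> \<bar>Z x i\<bar> + \<bar>Y x i\<bar>" "\<bar>V t x i\<bar> \<le> \<bar>Z x i\<bar> + \<bar>Y x i\<bar>" for i
      unfolding W V by (intro comb; simp)+
    have "\<bar>g t x\<bar> \<le> (\<Sum>i\<in>I. soft_grad I \<beta> (W t x) i * \<bar>V t x i\<bar>)"
      unfolding g_def using soft_grad_nonneg by (intro order_trans[OF sum_abs]) (simp add: abs_mult)
    also have "\<dots> \<le> (\<Sum>i\<in>I. (\<Sum>j\<in>I. exp (\<bar>Z x j\<bar> + \<bar>Y x j\<bar>)) * exp (\<bar>Z x i\<bar> + \<bar>Y x i\<bar>))"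
    proof (intro sum_mono mult_mono)
      fix i assume i: "i \<in> I"
      have "soft_grad I \<beta> (W t x) i \<le> (\<Sum>j\<in>I. exp \<bar>W t x j\<bar>)" by (rule soft_grad_le[OF i])
      also have "\<dots> \<le> (\<Sum>j\<in>I. exp (\<bar>Z x j\<bar> + \<bar>Y x j\<bar>))" using WZ by (intro sum_mono) simp
      finally show "soft_grad I \<beta> (W t x) i \<le> (\<Sum>j\<in>I. exp (\<bar>Z x j\<bar> + \<bar>Y x j\<bar>))" .
      show "\<bar>V t x i\<bar> \<le> exp (\<bar>Z x i\<bar> + \<bar>Y x i\<bar>)"
        using WZ(2)[of i] exp_ge_add_one_self[of "\<bar>Z x i\<bar> + \<bar>Y x i\<bar>"] by linarith
    qed (auto intro!: sum_nonneg)
    also have "\<dots> = D x"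
      by (simp add: D_def sum_distrib_right Z_def Y_def add_ac flip: exp_add)
    finally show ?thesis .
  qed
  have mZ[measurable]: "(\<lambda>p. Z (snd p) i) \<in> borel_measurable (lborel \<Otimes>\<^sub>M P)" "(\<lambda>p. Y (snd p) i) \<in> borel_measurable (lborel \<Otimes>\<^sub>M P)" for i
    unfolding Z_def Y_def by measurable
  have mind: "(\<lambda>p. indicator {0..pi/2} (fst p) :: real) \<in> borel_measurable (lborel \<Otimes>\<^sub>M P)"
    by (rule measurable_compose[OF measurable_fst]) simp
  have mW: "(\<lambda>p. W (fst p) (snd p) i) \<in> borel_measurable (lborel \<Otimes>\<^sub>M P)" "(\<lambda>p. V (fst p) (snd p) i) \<in> borel_measurable (lborel \<Otimes>\<^sub>M P)" for i
    unfolding W V by (intro borel_measurable_add borel_measurable_times mZ trig_fst_measurable)+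
  have mg: "(\<lambda>p. g (fst p) (snd p)) \<in> borel_measurable (lborel \<Otimes>\<^sub>M P)"
    unfolding g_def by (intro borel_measurable_sum borel_measurable_times soft_measurable mW)
  have int: "integrable (lborel \<Otimes>\<^sub>M P) (\<lambda>p. indicator {0..pi/2} (fst p) * g (fst p) (snd p))"
  proof (rule Bochner_Integration.integrable_bound)
    have "integrable lborel (\<lambda>t. indicator {0..pi/2} t :: real)" by simp
    from L.has_bochner_integral_mult_pair[OF this D_int]
    show "integrable (lborel \<Otimes>\<^sub>M P) (\<lambda>p. indicator {0..pi/2} (fst p) * D (snd p))"
      by (simp add: has_bochner_integral_iff)
    show "(\<lambda>p. indicator {0..pi/2} (fst p) * g (fst p) (snd p)) \<in> borel_measurable (lborel \<Otimes>\<^sub>M P)"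
      by (intro borel_measurable_times mg mind)
    show "AE p in lborel \<Otimes>\<^sub>M P. norm (indicator {0..pi/2} (fst p) * g (fst p) (snd p)) \<le> norm (indicator {0..pi/2} (fst p) * D (snd p))"
      using g_le by (intro AE_I2) (auto simp: indicator_def intro: order_trans[OF _ abs_ge_self])
  qed
  obtain i0 where i0: "i0 \<in> I" using I by blast
  have int_max: "integrable P (\<lambda>x. soft_max I \<beta> (Z x))" "integrable P (\<lambda>x. soft_max I \<beta> (Y x))"
    using soft_integrable(4)[OF soft i0 i0, of N zw] soft_integrable(4)[OF soft i0 i0, of N yw]
    by (simp_all add: Z_def[abs_def] Y_def[abs_def])
  have "(\<integral>x. soft_max I \<beta> (Y x) \<partial>P) - (\<integral>x. soft_max I \<beta> (Z x) \<partial>P) = (\<integral>x. soft_max I \<beta> (Y x) - soft_max I \<beta> (Z x) \<partial>P)"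
    using int_max by simp
  also have "\<dots> = (\<integral>x. (\<integral>t. indicator {0..pi/2} t * g t x \<partial>lborel) \<partial>P)"
    unfolding ftc ..
  also have "\<dots> = (\<integral>t. (\<integral>x. indicator {0..pi/2} t * g t x \<partial>P) \<partial>lborel)"
    using L.Fubini_integral[of "\<lambda>t x. indicator {0..pi/2} t * g t x"] int
    by (simp add: case_prod_unfold)
  also have "\<dots> \<ge> 0"
  proof (rule Bochner_Integration.integral_nonneg)
    show "0 \<le> (\<integral>x. indicator {0..pi/2} t * g t x \<partial>P)" for t
      using g_nonneg[of t] by (cases "t \<in> {0..pi/2}") auto
  qed
  finally have main: "(\<integral>x. soft_max I \<beta> (Z x) \<partial>P) \<le> (\<integral>x. soft_max I \<beta> (Y x) \<partial>P)" by simp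
  have "(\<integral>\<^sup>+x. ennreal (exp (Max ((\<lambda>i. lin_form N (zw i) x) ` I))) \<partial>P) \<le> (\<integral>\<^sup>+x. ennreal (soft_max I \<beta> (Z x)) \<partial>P)"
  proof (intro nn_integral_mono ennreal_leI)
    fix x
    have "Max (Z x ` I) \<in> Z x ` I" using I by (intro Max_in) auto
    then show "exp (Max ((\<lambda>i. lin_form N (zw i) x) ` I)) \<le> soft_max I \<beta> (Z x)"
      using soft_max_ge[of _ "Z x"] by (auto simp: Z_def[abs_def])
  qed
  also have "\<dots> = ennreal (\<integral>x. soft_max I \<beta> (Z x) \<partial>P)"
    using int_max soft_max_pos by (intro nn_integral_eq_integral) (auto simp: less_imp_le)
  also have "\<dots> \<le> ennreal (\<integral>x. soft_max I \<beta> (Y x) \<partial>P)" using main by (rule ennreal_leI)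
  also have "\<dots> = (\<integral>\<^sup>+x. ennreal (soft_max I \<beta> (Y x)) \<partial>P)"
    using int_max soft_max_pos by (intro nn_integral_eq_integral[symmetric]) (auto simp: less_imp_le)
  also have "\<dots> \<le> (\<integral>\<^sup>+x. 2 * ennreal (exp (m x)) \<partial>P)"
  proof (intro nn_integral_mono)
    fix x
    have "soft_max I \<beta> (Y x) \<le> 2 * exp (m x)"
      using m_ge by (intro soft_max_le_card) (auto simp: Y_def \<beta>_def)
    then have "ennreal (soft_max I \<beta> (Y x)) \<le> ennreal (2 * exp (m x))" by (rule ennreal_leI)
    then show "ennreal (soft_max I \<beta> (Y x)) \<le> 2 * ennreal (exp (m x))" by (simp add: ennreal_mult)
  qed
  also have "\<dots> = 2 * (\<integral>\<^sup>+x. ennreal (exp (m x)) \<partial>P)"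
    by (intro nn_integral_cmult) measurable
  finally show ?thesis .
qed

end

section \<open>Rank-one operators and Fernique's theorem\<close>

definition tens :: "'e \<Rightarrow> 'e \<Rightarrow> ('e::{banach, second_countable_topology}) dual_op" where
  "tens x y = Blinfun (\<lambda>u. blinfun_apply u y *\<^sub>R x)"

lemma tens_apply: "blinfun_apply (tens x y) u = blinfun_apply u y *\<^sub>R x"
proof -
  have "bounded_linear (\<lambda>u :: 'a \<Rightarrow>\<^sub>L real. blinfun_apply u y *\<^sub>R x)"
    by (intro bounded_linear_intros)
  then show ?thesis unfolding tens_def by (simp add: bounded_linear_Blinfun_apply)
qed

lemma norm_tens_le: "norm (tens x y) \<le> norm x * norm y"
proof (rule norm_blinfun_bound)
  fix u :: "'a \<Rightarrow>\<^sub>L real"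
  have "norm (blinfun_apply (tens x y) u) = \<bar>blinfun_apply u y\<bar> * norm x" by (simp add: tens_apply)
  also have "\<dots> \<le> (norm u * norm y) * norm x"
    using norm_blinfun[of u y] by (intro mult_right_mono) auto
  finally show "norm (blinfun_apply (tens x y) u) \<le> norm x * norm y * norm u" by (simp add: mult_ac)
qed simp

lemma bounded_bilinear_tens: "bounded_bilinear tens"
proof
  show "\<exists>K. \<forall>a b. norm (tens a b) \<le> norm a * norm b * K"
    using norm_tens_le by (intro exI[of _ 1]) auto
qed (auto intro!: blinfun_eqI simp: tens_apply blinfun.add_left blinfun.add_right blinfun.scaleR_left
    blinfun.scaleR_right scaleR_left_distrib scaleR_right_distrib)

interpretation tens: bounded_bilinear tens
  by (rule bounded_bilinear_tens)

definition tens_sum :: "nat \<Rightarrow> (nat \<Rightarrow> 'e) \<Rightarrow> (nat \<Rightarrow> 'e) \<Rightarrow> ('e::{banach, second_countable_topology}) dual_op" where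
  "tens_sum n x y = (\<Sum>k=1..n. tens (x k) (y k))"

definition emp_cov :: "nat \<Rightarrow> (nat \<Rightarrow> 'e) \<Rightarrow> ('e::{banach, second_countable_topology}) dual_op" where
  "emp_cov n x = (1 / real n) *\<^sub>R tens_sum n x x"

lemma tens_sum_apply: "blinfun_apply (tens_sum n x y) u = (\<Sum>k=1..n. blinfun_apply u (y k) *\<^sub>R x k)"
  by (simp add: tens_sum_def blinfun.sum_left tens_apply)

lemma sample_cov_eq_emp_cov: "sample_cov n X \<omega> = emp_cov n (\<lambda>j. X j \<omega>)"
  by (intro blinfun_eqI) (simp add: sample_cov_apply emp_cov_def blinfun.scaleR_left tens_sum_apply)

lemma tens_sum_scale:
  "tens_sum n (\<lambda>k. a *\<^sub>R x k) (\<lambda>k. b *\<^sub>R y k) = (a * b) *\<^sub>R tens_sum n x y"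
  by (simp add: tens_sum_def tens.scaleR_left tens.scaleR_right scaleR_sum_right mult.commute)

lemma continuous_tens_sum[continuous_intros]:
  assumes "\<And>k. continuous_on S (\<lambda>z. f z k)" "\<And>k. continuous_on S (\<lambda>z. g z k)"
  shows "continuous_on S (\<lambda>z. tens_sum n (f z) (g z))"
  unfolding tens_sum_def by (intro continuous_on_sum tens.continuous_on assms)

lemma continuous_emp_cov: "continuous_on UNIV (emp_cov n)"
  unfolding emp_cov_def by (intro continuous_intros continuous_on_product_coordinates)

lemma norm_emp_cov_le: "norm (emp_cov n x) \<le> (1 / real n) * (\<Sum>k=1..n. (norm (x k))\<^sup>2)"
proof -
  have "norm (tens_sum n x x) \<le> (\<Sum>k=1..n. norm (x k) * norm (x k))"
    unfolding tens_sum_def by (intro order_trans[OF norm_sum] sum_mono norm_tens_le)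
  then show ?thesis
    by (simp add: emp_cov_def power2_eq_square divide_right_mono)
qed

text \<open>The sum of squares is \<open>n\<close> times the quadratic form of the empirical
  covariance at u. Through this bound the deviation to be estimated enters its own estimate.\<close>

lemma emp_cov_quadratic:
  assumes u: "norm u \<le> 1" and n: "1 \<le> n"
  shows "(\<Sum>k=1..n. (blinfun_apply u (x k))\<^sup>2) \<le> real n * norm (emp_cov n x)"
proof -
  have "blinfun_apply u (blinfun_apply (emp_cov n x) u) = (1 / real n) * (\<Sum>k=1..n. (blinfun_apply u (x k))\<^sup>2)"
    by (simp add: emp_cov_def blinfun.scaleR_left tens_sum_apply blinfun.scaleR_right blinfun.sum_right power2_eq_square)
  then have "(\<Sum>k=1..n. (blinfun_apply u (x k))\<^sup>2) = real n * blinfun_apply u (blinfun_apply (emp_cov n x) u)"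
    using n by simp
  also have "blinfun_apply u (blinfun_apply (emp_cov n x) u) \<le> norm (blinfun_apply (emp_cov n x) u)"
    using functional_le_norm[OF u] by (simp add: abs_le_iff)
  also have "\<dots> \<le> norm (emp_cov n x) * norm u" by (rule norm_blinfun)
  also have "\<dots> \<le> norm (emp_cov n x)" using u by (intro mult_left_le) auto
  finally show ?thesis by (simp add: mult_left_mono)
qed

text \<open>A norming functional for the value at a normalized v reduces the operator norm to scalar
  quantities, which have means without any separability of the operator space.\<close>

lemma norm_dual_op_le:
  fixes A :: "('e::{banach, second_countable_topology}) dual_op"
  assumes "0 \<le> c" and le: "\<And>u v. norm u \<le> 1 \<Longrightarrow> norm v \<le> 1 \<Longrightarrow> blinfun_apply u (blinfun_apply A v) \<le> c"
  shows "norm A \<le> c"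
proof (rule norm_blinfun_bound[OF \<open>0 \<le> c\<close>])
  fix v :: "'e \<Rightarrow>\<^sub>L real"
  show "norm (blinfun_apply A v) \<le> c * norm v"
  proof (cases "v = 0")
    case False
    define w where "w = (1 / norm v) *\<^sub>R v"
    have w: "norm w \<le> 1" "v = norm v *\<^sub>R w" using False by (auto simp: w_def)
    obtain u :: "'e \<Rightarrow>\<^sub>L real" where u: "norm u \<le> 1" "blinfun_apply u (blinfun_apply A w) = norm (blinfun_apply A w)"
      using norming_functional_exists by blast
    have "norm (blinfun_apply A w) \<le> c" using le[OF u(1) w(1)] u(2) by simp
    then have "norm v * norm (blinfun_apply A w) \<le> norm v * c" by (intro mult_left_mono) auto
    moreover have "norm (blinfun_apply A v) = norm v * norm (blinfun_apply A w)"
      by (subst w(2)) (simp add: blinfun.scaleR_right)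
    ultimately show ?thesis by (simp add: mult.commute)
  qed simp
qed

context gaussian
begin

lemma measurable_PP_continuous:
  fixes f :: "(nat \<Rightarrow> 'e) \<times> (nat \<Rightarrow> 'e) \<Rightarrow> 'b::topological_space"
  assumes "continuous_on UNIV f"
  shows "f \<in> borel_measurable (P \<Otimes>\<^sub>M P)"
proof -
  have "sets (P \<Otimes>\<^sub>M P) = sets (borel :: ((nat \<Rightarrow> 'e) \<times> (nat \<Rightarrow> 'e)) measure)"
    by (subst sets_pair_measure_cong[OF sets_P sets_P], subst borel_prod, rule refl)
  then show ?thesis
    using assms by (simp add: borel_measurable_continuous_onI cong: measurable_cong_sets)
qed

section \<open>Fernique's theorem and the second moment of the norm\<close>

definition tail :: "real \<Rightarrow> real" where
  "tail t = measure P {x. t < norm (x 0)}"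

lemma tail_set[measurable]: "{x. t < norm (x 0)} \<in> sets P" "{x. norm (x 0) \<le> t} \<in> sets P"
proof -
  have "{x \<in> space P. t < norm (x 0)} \<in> sets P" "{x \<in> space P. norm (x 0) \<le> t} \<in> sets P"
    by measurable
  then show "{x. t < norm (x 0)} \<in> sets P" "{x. norm (x 0) \<le> t} \<in> sets P" by simp_all
qed

text \<open>Rotation by 45 degrees. If the scaled difference of x and y has norm at most s and the
  scaled sum has norm above \<open>s + sqrt 2 * t\<close>, then both x and y have norm above
  t.\<close>

lemma tail_rotation: "(1 - tail s) * tail (s + sqrt 2 * t) \<le> (tail t)\<^sup>2"
proof -
  interpret PP: pair_prob_space P P by unfold_locales
  let ?A = "{x :: nat \<Rightarrow> 'e. s + sqrt 2 * t < norm (x 0)}" and ?B = "{x :: nat \<Rightarrow> 'e. norm (x 0) \<le> s}"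
  let ?T = "{x :: nat \<Rightarrow> 'e. t < norm (x 0)}"
  define c where "c = 1 / sqrt 2"
  have c: "c\<^sup>2 + c\<^sup>2 = 1" "0 < c" "sqrt 2 * c = 1" by (auto simp: c_def power_divide)
  have prod: "measure (P \<Otimes>\<^sub>M P) (C \<times> D) = measure P C * measure P D" if "C \<in> sets P" "D \<in> sets P" for C D
    using P.emeasure_pair_measure_Times[OF that] by (simp add: measure_def enn2real_mult)
  have "measure P ?A * measure P ?B = measure (P \<Otimes>\<^sub>M P) (?A \<times> ?B)"
    by (rule prod[symmetric]) measurable
  also have "\<dots> = measure (distr (P \<Otimes>\<^sub>M P) (P \<Otimes>\<^sub>M P) (rot c c)) (?A \<times> ?B)"
    by (simp add: rotation_invariance[OF c(1)])
  also have "\<dots> = measure (P \<Otimes>\<^sub>M P) (rot c c -` (?A \<times> ?B) \<inter> space (P \<Otimes>\<^sub>M P))"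
    by (intro measure_distr rot_measurable pair_measureI tail_set)
  also have "\<dots> \<le> measure (P \<Otimes>\<^sub>M P) (?T \<times> ?T)"
  proof (intro PP.P.finite_measure_mono pair_measureI tail_set subsetI)
    fix z assume "z \<in> rot c c -` (?A \<times> ?B) \<inter> space (P \<Otimes>\<^sub>M P)"
    then have a: "s + sqrt 2 * t < norm (c *\<^sub>R fst z 0 + c *\<^sub>R snd z 0)"
      and b: "norm ((- c) *\<^sub>R fst z 0 + c *\<^sub>R snd z 0) \<le> s"
      by (auto simp: rot_def)
    have dbl: "(2 * c) *\<^sub>R v = c *\<^sub>R v + c *\<^sub>R v" for v :: 'e
      by (simp flip: scaleR_add_left)
    have two: "2 * c * r = sqrt 2 * r" for r using c(3) by (simp add: c_def real_div_sqrt)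
    have "norm (c *\<^sub>R fst z 0 + c *\<^sub>R snd z 0) \<le> norm ((- c) *\<^sub>R fst z 0 + c *\<^sub>R snd z 0) + norm ((2 * c) *\<^sub>R fst z 0)"
      by (rule order_trans[OF eq_refl norm_triangle_ineq]) (simp add: dbl add.commute)
    then have "sqrt 2 * t < 2 * c * norm (fst z 0)" using a b c(2) by simp
    then have 1: "t < norm (fst z 0)" unfolding two by simp
    have "norm (c *\<^sub>R fst z 0 + c *\<^sub>R snd z 0) \<le> norm (c *\<^sub>R fst z 0 + (- c) *\<^sub>R snd z 0) + norm ((2 * c) *\<^sub>R snd z 0)"
      by (rule order_trans[OF eq_refl norm_triangle_ineq]) (simp add: dbl add.commute)
    moreover have "norm (c *\<^sub>R fst z 0 + (- c) *\<^sub>R snd z 0) = norm ((- c) *\<^sub>R fst z 0 + c *\<^sub>R snd z 0)"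
      using norm_minus_commute[of "c *\<^sub>R fst z 0" "c *\<^sub>R snd z 0"] by simp
    ultimately have "sqrt 2 * t < 2 * c * norm (snd z 0)" using a b c(2) by simp
    then have 2: "t < norm (snd z 0)" unfolding two by simp
    show "z \<in> ?T \<times> ?T" using 1 2 by (cases z) auto
  qed
  also have "\<dots> = (tail t)\<^sup>2"
    unfolding tail_def power2_eq_square by (rule prod) measurable
  finally have "measure P ?B * tail (s + sqrt 2 * t) \<le> (tail t)\<^sup>2"
    by (simp add: tail_def mult.commute)
  moreover have "measure P ?B = 1 - tail s"
  proof -
    have "?B = space P - {x. s < norm (x 0)}" by auto
    then show ?thesis unfolding tail_def using P.prob_compl[OF tail_set(1)[of s]] by simp
  qed
  ultimately show ?thesis by simp
qed

text \<open>The thresholds solve \<open>t\<^sub>0 = s\<close> and \<open>t\<^sub>n\<^sub>+\<^sub>1 = s + sqrt 2 * t\<^sub>n\<close>.\<close>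

theorem Fernique:
  assumes s: "0 < s" and tail_s: "tail s \<le> 1 / 10"
  shows "(\<integral>\<^sup>+z. ennreal (exp ((norm z)\<^sup>2 / (50 * s\<^sup>2))) \<partial>\<mu>) \<le> 2"
proof -
  define t where "t n = s * ((2 + sqrt 2) * sqrt 2 ^ n - (1 + sqrt 2))" for n :: nat
  have t0: "t 0 = s" by (simp add: t_def)
  have tSuc: "t (Suc n) = s + sqrt 2 * t n" for n by (simp add: t_def algebra_simps)
  have tail0: "0 \<le> tail r" for r by (simp add: tail_def)
  \<comment> \<open>By the rotation inequality, \<open>10/9\<close> times the tail is at most
    squared at each threshold, and it starts at no more than \<open>1/9\<close>.\<close>
  have tail_t: "tail (t n) \<le> (9/10) * (1/9) ^ (2 ^ n)" for n
  proof (induction n)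
    case 0
    then show ?case using tail_s by (simp add: t0)
  next
    case (Suc n)
    have "(9/10) * tail (t (Suc n)) \<le> (1 - tail s) * tail (t (Suc n))"
      using tail_s tail0 by (intro mult_right_mono) auto
    also have "\<dots> \<le> (tail (t n))\<^sup>2" unfolding tSuc by (rule tail_rotation)
    also have "\<dots> \<le> ((9/10) * (1/9) ^ (2 ^ n))\<^sup>2" using Suc tail0 by (intro power_mono) auto
    also have "\<dots> = (9/10) * ((9/10) * (1/9) ^ (2 ^ Suc n))"
      by (simp only: power_mult_distrib power2_eq_square power_Suc mult_2 power_add)
    finally show ?case by simp
  qed
  have tpos: "0 \<le> t n" for n
    by (induction n) (use s in \<open>auto simp: t0 tSuc\<close>)
  have sq2: "sqrt 2 \<le> 1.4143" by (rule real_le_lsqrt) (auto simp: power2_eq_square)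
  have t_le: "(t n)\<^sup>2 \<le> 12 * 2 ^ n * s\<^sup>2" for n
  proof -
    have "t n \<le> s * ((2 + sqrt 2) * sqrt 2 ^ n)" unfolding t_def using s real_sqrt_ge_zero[of 2] by (intro mult_left_mono; linarith)
    then have "(t n)\<^sup>2 \<le> (s * ((2 + sqrt 2) * sqrt 2 ^ n))\<^sup>2" using tpos by (intro power_mono) auto
    also have "\<dots> = s\<^sup>2 * (2 + sqrt 2)\<^sup>2 * ((sqrt 2)\<^sup>2) ^ n"
      by (simp only: power_mult_distrib power_mult[symmetric] mult.commute[of n] mult.assoc)
    also have "\<dots> = s\<^sup>2 * 2 ^ n * (2 + sqrt 2)\<^sup>2" by simp
    also have "\<dots> \<le> s\<^sup>2 * 2 ^ n * 12"
    proof (intro mult_left_mono)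
      have "(2 + sqrt 2)\<^sup>2 \<le> (3.4143)\<^sup>2" using sq2 by (intro power_mono) auto
      then show "(2 + sqrt 2)\<^sup>2 \<le> 12" by (simp add: power2_eq_square)
    qed simp
    finally show ?thesis by (simp add: mult_ac)
  qed
  \<comment> \<open>Linear growth is enough to see that the thresholds exhaust the space.\<close>
  have t_ge: "(real n + 1) * s \<le> t n" for n
  proof (induction n)
    case (Suc n)
    have "1 * t n \<le> sqrt 2 * t n" using tpos[of n] by (intro mult_right_mono) auto
    then show ?case using Suc unfolding tSuc by (simp add: algebra_simps)
  qed (simp add: t0)
  define \<alpha> where "\<alpha> = 1 / (50 * s\<^sup>2)"
  have \<alpha>: "0 < \<alpha>" "\<alpha> * s\<^sup>2 = 1 / 50" using s by (auto simp: \<alpha>_def)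
  \<comment> \<open>On the shell between consecutive thresholds the integrand is at most its value
    at the outer radius.\<close>
  define g where "g n x = ennreal (exp (\<alpha> * (t (Suc n))\<^sup>2)) * indicator {x. t n < norm (x 0)} x" for n and x :: "nat \<Rightarrow> 'e"
  have "(\<integral>\<^sup>+z. ennreal (exp ((norm z)\<^sup>2 / (50 * s\<^sup>2))) \<partial>\<mu>) = (\<integral>\<^sup>+x. ennreal (exp (\<alpha> * (norm (x 0))\<^sup>2)) \<partial>P)"
    using nn_integral_P_coord[of "\<lambda>z. ennreal (exp (\<alpha> * (norm z)\<^sup>2))" 0] by (simp add: \<alpha>_def)
  also have "\<dots> \<le> (\<integral>\<^sup>+x. ennreal (exp (\<alpha> * s\<^sup>2)) + (\<Sum>n. g n x) \<partial>P)"
  proof (rule nn_integral_mono)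
    fix x :: "nat \<Rightarrow> 'e"
    show "ennreal (exp (\<alpha> * (norm (x 0))\<^sup>2)) \<le> ennreal (exp (\<alpha> * s\<^sup>2)) + (\<Sum>n. g n x)"
    proof (cases "norm (x 0) \<le> s")
      case True
      then have "exp (\<alpha> * (norm (x 0))\<^sup>2) \<le> exp (\<alpha> * s\<^sup>2)" using \<alpha> by (auto intro!: mult_left_mono power_mono)
      then have "ennreal (exp (\<alpha> * (norm (x 0))\<^sup>2)) \<le> ennreal (exp (\<alpha> * s\<^sup>2))" by (rule ennreal_leI)
      then show ?thesis by (simp add: add_increasing2)
    next
      case False
      obtain k where k: "norm (x 0) \<le> t k"
      proof -
        obtain k where "norm (x 0) / s \<le> real k" using real_arch_simple by blast
        then have "norm (x 0) \<le> real k * s" using s by (simp add: divide_le_eq)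
        then have "norm (x 0) \<le> t k" using t_ge[of k] s by (simp add: algebra_simps)
        then show ?thesis by (rule that)
      qed
      define j where "j = (LEAST k. norm (x 0) \<le> t k)"
      have j: "norm (x 0) \<le> t j" unfolding j_def using k by (rule LeastI)
      have "j \<noteq> 0" using False j by (metis t0)
      then obtain n where n: "j = Suc n" by (cases j) auto
      have "\<not> norm (x 0) \<le> t n" using not_less_Least[of n "\<lambda>k. norm (x 0) \<le> t k"] n by (simp add: j_def)
      then have gn: "g n x = ennreal (exp (\<alpha> * (t (Suc n))\<^sup>2))" by (simp add: g_def)
      have "ennreal (exp (\<alpha> * (norm (x 0))\<^sup>2)) \<le> g n x"
        unfolding gn using j n \<alpha> by (auto intro!: ennreal_leI mult_left_mono power_mono)
      also have "\<dots> = (\<Sum>n\<in>{n}. g n x)" by simp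
      also have "\<dots> \<le> (\<Sum>n. g n x)" by (intro sum_le_suminf) auto
      finally show ?thesis by (simp add: add_increasing)
    qed
  qed
  also have "\<dots> = ennreal (exp (\<alpha> * s\<^sup>2)) + (\<Sum>n. \<integral>\<^sup>+x. g n x \<partial>P)"
  proof -
    have [measurable]: "g n \<in> borel_measurable P" for n unfolding g_def by measurable
    show ?thesis
      by (subst nn_integral_add) (auto simp: nn_integral_suminf P.emeasure_space_1[unfolded space_P])
  qed
  \<comment> \<open>The factor 50 keeps the exponent on shell n below \<open>2^n / 2\<close>. As
    \<open>exp (1/2) \<le> 9/5\<close>, the growth \<open>(9/5)^(2^n)\<close> against the tail
    \<open>(1/9)^(2^n)\<close> leaves \<open>(1/5)^(2^n)\<close>, which a geometric series
    dominates.\<close>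
  also have "\<dots> \<le> ennreal (1.04) + (\<Sum>n. ennreal ((1/5) ^ Suc n))"
  proof (intro add_mono suminf_le ennreal_leI)
    have "norm (exp (1 / 50 :: real)) \<le> 1 + 2 * norm (1 / 50 :: real)" by (intro exp_bound_lemma) auto
    then show "exp (\<alpha> * s\<^sup>2) \<le> 1.04" unfolding \<alpha>(2) by simp
    fix n
    have e: "exp (\<alpha> * (t (Suc n))\<^sup>2) \<le> (9 / 5) ^ (2 ^ n)"
    proof -
      have "\<alpha> * (t (Suc n))\<^sup>2 \<le> \<alpha> * (12 * 2 ^ Suc n * s\<^sup>2)" by (intro mult_left_mono t_le less_imp_le[OF \<alpha>(1)])
      also have "\<dots> = (24 * 2 ^ n) * (\<alpha> * s\<^sup>2)" by simp
      also have "\<dots> \<le> real (2 ^ n) * (1 / 2)" unfolding \<alpha>(2) by simp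
      finally have "exp (\<alpha> * (t (Suc n))\<^sup>2) \<le> exp (1 / 2) ^ (2 ^ n)"
        by (simp flip: exp_of_nat_mult)
      also have "\<dots> \<le> (9 / 5) ^ (2 ^ n)"
      proof (intro power_mono)
        have "(exp (1 / 2 :: real))\<^sup>2 \<le> 3" using exp_le by (simp flip: exp_double)
        also have "\<dots> \<le> (9 / 5)\<^sup>2" by (simp add: power2_eq_square)
        finally show "exp (1 / 2 :: real) \<le> 9 / 5" by (rule power2_le_imp_le) simp
      qed simp
      finally show ?thesis .
    qed
    have "(\<integral>\<^sup>+x. g n x \<partial>P) = ennreal (exp (\<alpha> * (t (Suc n))\<^sup>2)) * emeasure P {x. t n < norm (x 0)}"
      unfolding g_def by (subst nn_integral_cmult_indicator) auto
    also have "\<dots> = ennreal (exp (\<alpha> * (t (Suc n))\<^sup>2) * tail (t n))"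
      by (simp add: tail_def P.emeasure_eq_measure ennreal_mult)
    also have "\<dots> \<le> ennreal ((9 / 5) ^ (2 ^ n) * (1 / 9) ^ (2 ^ n))"
    proof (intro ennreal_leI mult_mono e)
      show "tail (t n) \<le> (1 / 9) ^ (2 ^ n)"
        using tail_t[of n] zero_le_power[of "1/9::real" "2 ^ n"] by linarith
    qed (use tail0 in auto)
    also have "(9 / 5) ^ (2 ^ n) * (1 / 9) ^ (2 ^ n) = (1 / 5 :: real) ^ (2 ^ n)"
      by (simp flip: power_mult_distrib)
    also have "ennreal \<dots> \<le> ennreal ((1 / 5) ^ Suc n)"
    proof (intro ennreal_leI power_decreasing)
      show "Suc n \<le> 2 ^ n" by (induction n) auto
    qed auto
    finally show "(\<integral>\<^sup>+x. g n x \<partial>P) \<le> ennreal ((1 / 5) ^ Suc n)" .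
  qed auto
  also have "(\<Sum>n. ennreal ((1/5) ^ Suc n)) = ennreal (1 / 4)"
  proof -
    have "(\<lambda>n. (1/5::real) ^ Suc n) sums ((1/5) * (1 / (1 - 1/5)))"
      unfolding power_Suc by (intro sums_mult geometric_sums) simp
    then show ?thesis by (intro suminf_ennreal_eq) auto
  qed
  also have "ennreal 1.04 + ennreal (1 / 4) = ennreal (1.04 + 1 / 4)"
    by (rule ennreal_plus[symmetric]) auto
  also have "\<dots> \<le> ennreal 2"
    by (rule ennreal_leI) simp
  finally show ?thesis by simp
qed

definition m2 :: real where "m2 = (\<integral>z. (norm z)\<^sup>2 \<partial>\<mu>)"

text \<open>A qualitative use of Fernique: tails of a finite measure vanish, so some threshold
  qualifies, though with no control on its size. It provides the finiteness that makes the
  quantitative version below possible.\<close>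

lemma norm_square_integrable: "integrable \<mu> (\<lambda>z. (norm z)\<^sup>2)"
proof -
  have "(\<lambda>k. measure P {x. real k < norm (x 0)}) \<longlonglongrightarrow> measure P (\<Inter>k. {x. real k < norm (x 0)})"
    by (intro P.finite_Lim_measure_decseq) (auto simp: decseq_def)
  moreover have "(\<Inter>k. {x :: nat \<Rightarrow> 'e. real k < norm (x 0)}) = {}"
  proof (rule equals0I)
    fix x :: "nat \<Rightarrow> 'e" assume "x \<in> (\<Inter>k. {x. real k < norm (x 0)})"
    then have "real k < norm (x 0)" for k by auto
    then show False using real_arch_simple[of "norm (x 0)"] by (meson leD)
  qed
  ultimately have "(\<lambda>k. tail (real k)) \<longlonglongrightarrow> 0" by (simp add: tail_def)
  then have "\<forall>\<^sub>F k in sequentially. tail (real k) < 1 / 10"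
    by (rule order_tendstoD) simp
  then obtain k where "tail (real k) < 1 / 10" "0 < k"
    unfolding eventually_sequentially by (metis le_add1 le_add2 less_add_one add.commute gr0I not_one_le_zero)
  then have F: "(\<integral>\<^sup>+z. ennreal (exp ((norm z)\<^sup>2 / (50 * (real k)\<^sup>2))) \<partial>\<mu>) \<le> 2" and k: "0 < real k"
    by (auto intro!: Fernique)
  show ?thesis
  proof (rule integrableI_nonneg)
    have "(\<integral>\<^sup>+z. ennreal ((norm z)\<^sup>2) \<partial>\<mu>) \<le> (\<integral>\<^sup>+z. ennreal (50 * (real k)\<^sup>2) * ennreal (exp ((norm z)\<^sup>2 / (50 * (real k)\<^sup>2))) \<partial>\<mu>)"
    proof (intro nn_integral_mono)
      fix z :: 'e
      have "(norm z)\<^sup>2 / (50 * (real k)\<^sup>2) \<le> exp ((norm z)\<^sup>2 / (50 * (real k)\<^sup>2))"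
        using exp_ge_add_one_self[of "(norm z)\<^sup>2 / (50 * (real k)\<^sup>2)"] by linarith
      then have "(norm z)\<^sup>2 \<le> 50 * (real k)\<^sup>2 * exp ((norm z)\<^sup>2 / (50 * (real k)\<^sup>2))"
        using k by (simp add: divide_le_eq mult.commute)
      then show "ennreal ((norm z)\<^sup>2) \<le> ennreal (50 * (real k)\<^sup>2) * ennreal (exp ((norm z)\<^sup>2 / (50 * (real k)\<^sup>2)))"
        by (simp add: ennreal_leI flip: ennreal_mult)
    qed
    also have "\<dots> = ennreal (50 * (real k)\<^sup>2) * (\<integral>\<^sup>+z. ennreal (exp ((norm z)\<^sup>2 / (50 * (real k)\<^sup>2))) \<partial>\<mu>)"
      by (intro nn_integral_cmult) measurable
    also have "\<dots> \<le> ennreal (50 * (real k)\<^sup>2) * 2" using F by (intro mult_left_mono) auto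
    also have "\<dots> < \<infinity>" by (simp add: ennreal_mult_less_top)
    finally show "(\<integral>\<^sup>+z. ennreal ((norm z)\<^sup>2) \<partial>\<mu>) < \<infinity>" .
  qed auto
qed

lemma m2_nonneg: "0 \<le> m2"
  by (simp add: m2_def)

lemma norm_cov_le_m2: "norm \<Sigma> \<le> m2"
proof (rule norm_dual_op_le[OF m2_nonneg])
  fix u v :: "'e \<Rightarrow>\<^sub>L real" assume uv: "norm u \<le> 1" "norm v \<le> 1"
  have "cov u v = (\<integral>x. blinfun_apply u x * blinfun_apply v x \<partial>\<mu>)"
    using has_bochner_integral_integral_eq[OF cov_integral[of u v]] by simp
  also have "\<dots> \<le> (\<integral>x. (norm x)\<^sup>2 \<partial>\<mu>)"
  proof (intro integral_mono norm_square_integrable has_bochner_integral_integrable cov_integral)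
    show "integrable \<mu> (\<lambda>x. blinfun_apply u x * blinfun_apply v x)"
      using cov_integral[of u v] by (simp add: has_bochner_integral_iff)
    fix x
    have "blinfun_apply u x * blinfun_apply v x \<le> \<bar>blinfun_apply u x\<bar> * \<bar>blinfun_apply v x\<bar>"
      by (simp flip: abs_mult)
    also have "\<dots> \<le> norm x * norm x" using functional_le_norm[OF uv(1)] functional_le_norm[OF uv(2)] by (intro mult_mono) auto
    finally show "blinfun_apply u x * blinfun_apply v x \<le> (norm x)\<^sup>2" by (simp add: power2_eq_square)
  qed
  finally show "blinfun_apply u (blinfun_apply \<Sigma> v) \<le> m2" by (simp add: cov_def m2_def)
qed

text \<open>Now that the second moment is finite, Markov's inequality qualifies the threshold with
  \<open>s^2 = 10 * m2\<close>, and the \<open>50 * s^2\<close> of Fernique becomes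
  \<open>500 * m2\<close>.\<close>

lemma norm_exp_square:
  assumes m: "0 < m2" and a: "a \<le> 1 / (500 * m2)"
  shows "(\<integral>\<^sup>+z. ennreal (exp (a * (norm z)\<^sup>2)) \<partial>\<mu>) \<le> 2"
proof -
  define s where "s = sqrt (10 * m2)"
  have s: "0 < s" "s\<^sup>2 = 10 * m2" using m by (auto simp: s_def)
  have "tail s \<le> measure \<mu> {z\<in>space \<mu>. s\<^sup>2 \<le> (norm z)\<^sup>2}"
  proof -
    have "tail s = measure \<mu> {z. s < norm z}"
    proof -
      have "{x :: nat \<Rightarrow> 'e. s < norm (x 0)} = (\<lambda>x. x 0) -` {z. s < norm z} \<inter> space P" by auto
      moreover have "{z :: 'e. s < norm z} \<in> sets borel" by measurable
      ultimately have "tail s = measure (distr P borel (\<lambda>x. x 0)) {z. s < norm z}"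
        unfolding tail_def by (subst measure_distr) auto
      then show ?thesis by (simp add: distr_P_coord)
    qed
    also have "\<dots> \<le> measure \<mu> {z\<in>space \<mu>. s\<^sup>2 \<le> (norm z)\<^sup>2}"
    proof (rule finite_measure_mono)
      show "{z. s < norm z} \<subseteq> {z\<in>space \<mu>. s\<^sup>2 \<le> (norm z)\<^sup>2}"
        using s(1) by (auto intro!: power_mono)
    qed measurable
    finally show ?thesis .
  qed
  also have "\<dots> \<le> (\<integral>z. (norm z)\<^sup>2 \<partial>\<mu>) / s\<^sup>2"
    using s m by (intro integral_Markov_inequality_measure[where A = "{}"] norm_square_integrable) auto
  also have "\<dots> = 1 / 10" using m by (simp add: s(2) m2_def[symmetric])
  finally have "(\<integral>\<^sup>+z. ennreal (exp ((norm z)\<^sup>2 / (50 * s\<^sup>2))) \<partial>\<mu>) \<le> 2"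
    using s by (intro Fernique) auto
  moreover have "(\<integral>\<^sup>+z. ennreal (exp (a * (norm z)\<^sup>2)) \<partial>\<mu>) \<le> (\<integral>\<^sup>+z. ennreal (exp ((norm z)\<^sup>2 / (50 * s\<^sup>2))) \<partial>\<mu>)"
  proof (intro nn_integral_mono ennreal_leI iffD2[OF exp_le_cancel_iff])
    fix z :: 'e
    show "a * (norm z)\<^sup>2 \<le> (norm z)\<^sup>2 / (50 * s\<^sup>2)"
      using mult_right_mono[OF a, of "(norm z)\<^sup>2"] by (simp add: s(2))
  qed
  ultimately show ?thesis by (rule order_trans[rotated])
qed

lemma cov_le_norm:
  assumes "norm u \<le> 1"
  shows "cov u u \<le> norm \<Sigma>"
proof -
  have "cov u u \<le> norm (blinfun_apply \<Sigma> u)"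
    unfolding cov_def using functional_le_norm[OF assms, of "blinfun_apply \<Sigma> u"] by (simp add: abs_le_iff)
  also have "\<dots> \<le> norm \<Sigma> * norm u" by (rule norm_blinfun)
  also have "\<dots> \<le> norm \<Sigma>" using assms by (intro mult_left_le) auto
  finally show ?thesis .
qed

text \<open>If all variances on the dual ball were below a quarter of the norm, Cauchy-Schwarz would
  bound the whole bilinear form by that quarter. The functional turns coordinates of
  \<open>P\<close> into scalar Gaussians of variance comparable to \<open>norm \<Sigma>\<close>, so
  Chevet's comparison needs no further probability space.\<close>

lemma almost_extremal_functional_exists:
  obtains v where "norm v \<le> 1" "norm \<Sigma> \<le> 4 * cov v v"
proof (cases "\<Sigma> = 0")
  case True
  then show ?thesis using that[of 0] unfolding cov_def by simp
next
  case False
  have "\<exists>v. norm v \<le> 1 \<and> norm \<Sigma> \<le> 4 * cov v v"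
  proof (rule ccontr)
    assume "\<not> ?thesis"
    then have less: "cov v v \<le> norm \<Sigma> / 4" if "norm v \<le> 1" for v using that by force
    have "norm \<Sigma> \<le> norm \<Sigma> / 4"
    proof (rule norm_dual_op_le)
      fix u v :: "'e \<Rightarrow>\<^sub>L real" assume uv: "norm u \<le> 1" "norm v \<le> 1"
      have "(cov u v)\<^sup>2 \<le> cov u u * cov v v" by (rule cov_Cauchy_Schwarz)
      also have "\<dots> \<le> (norm \<Sigma> / 4) * (norm \<Sigma> / 4)" using less uv cov_nonneg by (intro mult_mono) auto
      finally have "(cov u v)\<^sup>2 \<le> (norm \<Sigma> / 4)\<^sup>2" by (simp add: power2_eq_square)
      then show "blinfun_apply u (blinfun_apply \<Sigma> v) \<le> norm \<Sigma> / 4"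
        unfolding cov_def[symmetric] by (rule power2_le_imp_le) simp
    qed simp
    then show False using False by simp
  qed
  then show ?thesis using that by blast
qed

end

section \<open>Chevet's inequality and decoupling\<close>

lemma continuous_on_coord:
  fixes f :: "'a::topological_space \<Rightarrow> 'i \<Rightarrow> 'b::topological_space"
  assumes "continuous_on S f"
  shows "continuous_on S (\<lambda>z. f z k)"
  by (rule continuous_on_compose2[OF continuous_on_product_coordinates assms]) auto

text \<open>Jensen's inequality, from the tangent to \<open>exp\<close> at the mean.\<close>

lemma (in prob_space) exp_integral_le:
  assumes g: "integrable M g"
  shows "ennreal (exp (\<integral>x. g x \<partial>M)) \<le> (\<integral>\<^sup>+x. ennreal (exp (g x)) \<partial>M)"
proof (cases "(\<integral>\<^sup>+x. ennreal (exp (g x)) \<partial>M) = \<infinity>")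
  case False
  have [measurable]: "g \<in> borel_measurable M" using g by auto
  define c where "c = (\<integral>x. g x \<partial>M)"
  have int: "integrable M (\<lambda>x. exp (g x))"
    using False by (intro integrableI_nonneg) (auto simp: top.not_eq_extremum)
  have "exp c = (\<integral>x. exp c * (1 + g x - c) \<partial>M)"
    using g by (simp add: c_def prob_space)
  also have "\<dots> \<le> (\<integral>x. exp (g x) \<partial>M)"
  proof (rule integral_mono[OF _ int])
    show "integrable M (\<lambda>x. exp c * (1 + g x - c))" using g by simp
    fix x
    have "exp c * (1 + (g x - c)) \<le> exp c * exp (g x - c)"
      by (intro mult_left_mono exp_ge_add_one_self) simp
    then show "exp c * (1 + g x - c) \<le> exp (g x)" by (simp add: algebra_simps flip: exp_add)
  qed
  finally show ?thesis
    using nn_integral_eq_integral[OF int] by (simp add: c_def ennreal_leI)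
qed simp

lemma exp_mean_le:
  fixes b :: "nat \<Rightarrow> real"
  assumes "1 \<le> n"
  shows "exp ((1 / real n) * (\<Sum>k=1..n. b k)) \<le> (1 / real n) * (\<Sum>k=1..n. exp (b k))"
proof -
  define c where "c = (1 / real n) * (\<Sum>k=1..n. b k)"
  have sb: "(\<Sum>k=1..n. b k) = real n * c" using assms by (simp add: c_def)
  have "(\<Sum>k=1..n. exp c * (1 + (b k - c))) \<le> (\<Sum>k=1..n. exp c * exp (b k - c))"
    by (intro sum_mono mult_left_mono exp_ge_add_one_self) simp
  also have "\<dots> = (\<Sum>k=1..n. exp (b k))" by (simp flip: exp_add)
  also have "(\<Sum>k=1..n. exp c * (1 + (b k - c))) = exp c * (\<Sum>k=1..n. 1 + (b k - c))"
    by (simp add: sum_distrib_left)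
  also have "(\<Sum>k=1..n. 1 + (b k - c)) = real n"
    by (simp add: sum.distrib sum_subtractf sb del: One_nat_def)
  finally have "exp c \<le> (1 / real n) * (\<Sum>k=1..n. exp (b k))"
    using assms by (simp add: field_simps del: One_nat_def)
  then show ?thesis by (simp only: c_def)
qed

lemma sum_three_blocks:
  fixes h :: "nat \<Rightarrow> real"
  shows "(\<Sum>k<Suc (2 * n). h k) = h 0 + (\<Sum>k=1..n. h k) + (\<Sum>k=1..n. h (n + k))"
proof -
  have "(\<Sum>k<Suc (2 * n). h k) = (\<Sum>k=0..n + n. h k)"
    by (simp add: lessThan_Suc_atMost atLeast0AtMost mult_2)
  also have "\<dots> = h 0 + (\<Sum>k=1..n + n. h k)" by (subst sum.atLeast_Suc_atMost) auto
  also have "(\<Sum>k=1..n + n. h k) = (\<Sum>k=1..n. h k) + (\<Sum>k=n + 1..n + n. h k)"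
    by (rule sum.ub_add_nat) simp
  also have "(\<Sum>k=n + 1..n + n. h k) = (\<Sum>k=1..n. h (n + k))"
    using sum.shift_bounds_cl_nat_ivl[of h 1 n n] by (simp add: add.commute)
  finally show ?thesis by simp
qed

context gaussian
begin

lemma cov_scale: "cov (a *\<^sub>R u) (b *\<^sub>R v) = a * b * cov u v"
  by (simp add: cov_def blinfun.scaleR_left blinfun.scaleR_right)

lemma cov_zero: "cov 0 v = 0" "cov v 0 = 0"
  unfolding cov_def by simp_all

text \<open>With x fixed, coordinates 1 to n of y carry the bilinear form, coordinate 0 a
  vector-valued Gaussian, and coordinates n + 1 to 2n the scalar Gaussians
  \<open>v0 (y (n + k))\<close>. The factor 2 lifts the variance of the latter to at least
  \<open>norm \<Sigma>\<close>; the factor \<open>sqrt 2\<close> pays for splitting an increment of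
  products into two parts.\<close>

lemma Chevet_exp:
  fixes x :: "nat \<Rightarrow> 'e"
  assumes s0: "0 \<le> s" and s: "\<And>u. norm u \<le> 1 \<Longrightarrow> (\<Sum>k=1..n. (blinfun_apply u (x k))\<^sup>2) \<le> s\<^sup>2"
    and v0: "norm \<Sigma> \<le> 4 * cov v0 v0"
  shows "(\<integral>\<^sup>+y. ennreal (exp (norm (tens_sum n x y))) \<partial>P)
    \<le> 2 * (\<integral>\<^sup>+y. ennreal (exp (sqrt 2 * (s * norm (y 0) + 2 * norm (\<Sum>k=1..n. blinfun_apply v0 (y (n + k)) *\<^sub>R x k)))) \<partial>P)"
proof -
  obtain \<nu> :: "nat \<Rightarrow> 'e \<Rightarrow>\<^sub>L real" where \<nu>: "\<And>i. norm (\<nu> i) \<le> 1"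
    "\<And>x c. (\<And>i. blinfun_apply (\<nu> i) x \<le> c) \<Longrightarrow> norm x \<le> c"
    using norming_sequence_exists by blast
  define N where "N = Suc (2 * n)"
  define a where "a i k = blinfun_apply (\<nu> i) (x k)" for i k
  define A where "A i j = (\<Sum>k=1..n. a i k * a j k)" for i j
  define zw where "zw p k = (if 1 \<le> k \<and> k \<le> n then a (fst p) k *\<^sub>R \<nu> (snd p) else 0)" for p :: "nat \<times> nat" and k
  define yw where "yw p k = (if k = 0 then (sqrt 2 * s) *\<^sub>R \<nu> (snd p)
    else if n < k then (2 * sqrt 2 * a (fst p) (k - n)) *\<^sub>R v0 else 0)" for p :: "nat \<times> nat" and k
  define m where "m y = sqrt 2 * (s * norm (y 0) + 2 * norm (\<Sum>k=1..n. blinfun_apply v0 (y (n + k)) *\<^sub>R x k))" for y :: "nat \<Rightarrow> 'e"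
  have [measurable]: "m \<in> borel_measurable P"
    unfolding m_def
    by (intro measurable_P_continuous continuous_intros continuous_on_product_coordinates)
  have blocks: "(\<Sum>k<N. h k) = h 0 + (\<Sum>k=1..n. h k) + (\<Sum>k=1..n. h (n + k))" for h :: "nat \<Rightarrow> real"
    unfolding N_def by (rule sum_three_blocks)
  have Z: "lin_form N (zw p) y = (\<Sum>k=1..n. a (fst p) k * blinfun_apply (\<nu> (snd p)) (y k))" for p y
    unfolding lin_form_def blocks by (simp add: zw_def blinfun.scaleR_left)
  have Y: "lin_form N (yw p) y = sqrt 2 * (s * blinfun_apply (\<nu> (snd p)) (y 0) + 2 * (\<Sum>k=1..n. a (fst p) k * blinfun_apply v0 (y (n + k))))" for p y
    unfolding lin_form_def blocks
    by (simp add: yw_def blinfun.scaleR_left sum_distrib_left algebra_simps)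
  have Y_le: "lin_form N (yw p) y \<le> m y" for p y
  proof -
    have "(\<Sum>k=1..n. a (fst p) k * blinfun_apply v0 (y (n + k))) = blinfun_apply (\<nu> (fst p)) (\<Sum>k=1..n. blinfun_apply v0 (y (n + k)) *\<^sub>R x k)"
      by (simp add: a_def blinfun.sum_right blinfun.scaleR_right mult.commute)
    also have "\<dots> \<le> norm (\<Sum>k=1..n. blinfun_apply v0 (y (n + k)) *\<^sub>R x k)"
      using functional_le_norm[OF \<nu>(1)] abs_le_D1 by blast
    finally have 1: "(\<Sum>k=1..n. a (fst p) k * blinfun_apply v0 (y (n + k))) \<le> norm (\<Sum>k=1..n. blinfun_apply v0 (y (n + k)) *\<^sub>R x k)" .
    have "blinfun_apply (\<nu> (snd p)) (y 0) \<le> norm (y 0)"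
      using functional_le_norm[OF \<nu>(1)] abs_le_D1 by blast
    then have 2: "s * blinfun_apply (\<nu> (snd p)) (y 0) \<le> s * norm (y 0)" using s0 by (rule mult_left_mono)
    show ?thesis unfolding Y m_def using 1 2 by (intro mult_left_mono) auto
  qed
  define \<sigma> where "\<sigma> i j = cov (\<nu> i) (\<nu> j)" for i j
  have qZ: "qf N (zw p) (zw q) = A (fst p) (fst q) * \<sigma> (snd p) (snd q)" for p q
    unfolding qf_def blocks by (simp add: zw_def cov_scale cov_zero A_def \<sigma>_def sum_distrib_right)
  have qY: "qf N (yw p) (yw q) = 2 * s\<^sup>2 * \<sigma> (snd p) (snd q) + 8 * cov v0 v0 * A (fst p) (fst q)" for p q
  proof -
    have "qf N (yw p) (yw q) = (sqrt 2 * s) * (sqrt 2 * s) * \<sigma> (snd p) (snd q)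
      + (\<Sum>k=1..n. (2 * sqrt 2 * a (fst p) k) * (2 * sqrt 2 * a (fst q) k) * cov v0 v0)"
      unfolding qf_def blocks by (simp add: yw_def cov_scale cov_zero \<sigma>_def)
    also have "(\<Sum>k=1..n. (2 * sqrt 2 * a (fst p) k) * (2 * sqrt 2 * a (fst q) k) * cov v0 v0) = (\<Sum>k=1..n. 8 * cov v0 v0 * (a (fst p) k * a (fst q) k))"
      by (intro sum.cong refl) (simp add: algebra_simps)
    also have "\<dots> = 8 * cov v0 v0 * A (fst p) (fst q)" by (simp add: A_def sum_distrib_left)
    also have "(sqrt 2 * s) * (sqrt 2 * s) = 2 * s\<^sup>2" by (simp add: power2_eq_square)
    finally show ?thesis .
  qed
  have qZY: "qf N (zw p) (yw q) = 0" for p q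
    unfolding qf_def blocks by (simp add: zw_def yw_def cov_zero)
  have A_le: "A i i \<le> s\<^sup>2" and A_nonneg: "0 \<le> A i i" for i
    using s[OF \<nu>(1), of i] by (auto simp: A_def a_def power2_eq_square intro!: sum_nonneg)
  have \<sigma>_nonneg: "0 \<le> \<sigma> i i" and \<sigma>_le: "\<sigma> i i \<le> 4 * cov v0 v0" for i
    using cov_nonneg[of "\<nu> i"] cov_le_norm[OF \<nu>(1), of i] v0 by (auto simp: \<sigma>_def)
  have bound: "(\<integral>\<^sup>+y. ennreal (exp (Max ((\<lambda>p. lin_form N (zw p) y) ` ({..M} \<times> {..M})))) \<partial>P) \<le> 2 * (\<integral>\<^sup>+y. ennreal (exp (m y)) \<partial>P)" for M
  proof (rule gaussian_exp_comparison[where yw = yw])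
    show "qf N (zw i) (yw j) = 0" for i j by (rule qZY)
    show "qf N (zw p) (zw p) \<le> qf N (yw p) (yw p)" for p
    proof -
      have "A (fst p) (fst p) * \<sigma> (snd p) (snd p) \<le> s\<^sup>2 * \<sigma> (snd p) (snd p)"
        using A_le \<sigma>_nonneg by (intro mult_right_mono) auto
      moreover have "0 \<le> s\<^sup>2 * \<sigma> (snd p) (snd p)" using \<sigma>_nonneg by simp
      moreover have "0 \<le> 8 * cov v0 v0 * A (fst p) (fst p)" using cov_nonneg A_nonneg by simp
      ultimately show ?thesis unfolding qZ qY by linarith
    qed
    show "qf N (zw p) (zw p) - 2 * qf N (zw p) (zw q) + qf N (zw q) (zw q)
      \<le> qf N (yw p) (yw p) - 2 * qf N (yw p) (yw q) + qf N (yw q) (yw q)" for p q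
    proof -
      obtain i j where p: "p = (i, j)" by (cases p)
      obtain i' j' where q: "q = (i', j')" by (cases q)
      \<comment> \<open>An increment of products is A + B, where A changes the second factor and B
        the first. The form w is A - B, and its nonnegative variance shows that the variance of A +
        B is at most twice the sum of those of A and B.\<close>
      define w where "w k = a i k *\<^sub>R \<nu> j + (a i' k - 2 * a i k) *\<^sub>R \<nu> j'" for k
      have cw: "cov (w k) (w k) = (\<sigma> j j - 4 * \<sigma> j j' + 4 * \<sigma> j' j') * (a i k * a i k)
        + (2 * \<sigma> j j' - 4 * \<sigma> j' j') * (a i k * a i' k) + \<sigma> j' j' * (a i' k * a i' k)" for k
        unfolding w_def cov_bilinear cov_commute[of "\<nu> j'" "\<nu> j"] \<sigma>_def by (simp add: algebra_simps)
      have "0 \<le> (\<Sum>k=1..n. cov (w k) (w k))" by (intro sum_nonneg cov_nonneg)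
      also have "\<dots> = (\<sigma> j j - 4 * \<sigma> j j' + 4 * \<sigma> j' j') * A i i + (2 * \<sigma> j j' - 4 * \<sigma> j' j') * A i i' + \<sigma> j' j' * A i' i'"
        unfolding cw by (simp add: sum.distrib sum_distrib_left A_def)
      finally have 1: "0 \<le> (\<sigma> j j - 4 * \<sigma> j j' + 4 * \<sigma> j' j') * A i i + (2 * \<sigma> j j' - 4 * \<sigma> j' j') * A i i' + \<sigma> j' j' * A i' i'" .
      have "0 \<le> cov (1 *\<^sub>R \<nu> j + (-1) *\<^sub>R \<nu> j') (1 *\<^sub>R \<nu> j + (-1) *\<^sub>R \<nu> j')" by (rule cov_nonneg)
      then have X: "0 \<le> \<sigma> j j - 2 * \<sigma> j j' + \<sigma> j' j'"
        unfolding cov_bilinear cov_commute[of "\<nu> j'" "\<nu> j"] by (simp add: \<sigma>_def)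
      have "0 \<le> (\<Sum>k=1..n. (a i k - a i' k)\<^sup>2)" by (intro sum_nonneg) simp
      also have "\<dots> = A i i - 2 * A i i' + A i' i'"
        by (simp add: A_def power2_eq_square algebra_simps sum.distrib sum_subtractf sum_distrib_left)
      finally have Y': "0 \<le> A i i - 2 * A i i' + A i' i'" .
      have 2: "A i i * (\<sigma> j j - 2 * \<sigma> j j' + \<sigma> j' j') \<le> s\<^sup>2 * (\<sigma> j j - 2 * \<sigma> j j' + \<sigma> j' j')"
        by (intro mult_right_mono A_le X)
      have 3: "\<sigma> j' j' * (A i i - 2 * A i i' + A i' i') \<le> (4 * cov v0 v0) * (A i i - 2 * A i i' + A i' i')"
        by (intro mult_right_mono \<sigma>_le Y')
      show ?thesis using 1 2 3 unfolding p q qZ qY fst_conv snd_conv by (simp add: algebra_simps)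
    qed
  qed (use Y_le in auto)
  \<comment> \<open>The comparison concerns finite families; the norm is reached through growing
    squares of indices and monotone convergence.\<close>
  have "(\<integral>\<^sup>+y. ennreal (exp (norm (tens_sum n x y))) \<partial>P)
    \<le> (\<integral>\<^sup>+y. (SUP M. ennreal (exp (Max ((\<lambda>p. lin_form N (zw p) y) ` ({..M} \<times> {..M}))))) \<partial>P)"
  proof (rule nn_integral_mono)
    fix y :: "nat \<Rightarrow> 'e"
    define B where "B = (SUP M. ennreal (exp (Max ((\<lambda>p. lin_form N (zw p) y) ` ({..M} \<times> {..M})))))"
    have le_B: "ennreal (exp (lin_form N (zw (i, j)) y)) \<le> B" for i j
    proof -
      have "lin_form N (zw (i, j)) y \<le> Max ((\<lambda>p. lin_form N (zw p) y) ` ({..max i j} \<times> {..max i j}))"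
        by (intro Max_ge) auto
      then have "ennreal (exp (lin_form N (zw (i, j)) y)) \<le> ennreal (exp (Max ((\<lambda>p. lin_form N (zw p) y) ` ({..max i j} \<times> {..max i j}))))"
        by (intro ennreal_leI) simp
      also have "\<dots> \<le> B" unfolding B_def by (rule SUP_upper) simp
      finally show ?thesis .
    qed
    show "ennreal (exp (norm (tens_sum n x y))) \<le> B"
    proof (cases B)
      case (real b)
      have eb: "exp (lin_form N (zw (i, j)) y) \<le> b" for i j
        using le_B[of i j] real by (simp add: ennreal_le_iff)
      then have b: "0 < b" by (meson exp_gt_zero less_le_trans)
      have ij: "blinfun_apply (\<nu> j) (\<Sum>k=1..n. a i k *\<^sub>R y k) \<le> ln b" for i j
        using eb[of i j] b by (simp add: Z blinfun.sum_right blinfun.scaleR_right ln_ge_iff)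
      have ni: "norm (\<Sum>k=1..n. a i k *\<^sub>R y k) \<le> ln b" for i
        using ij \<nu>(2) by blast
      have lnb: "0 \<le> ln b" using ni[of 0] norm_ge_zero order_trans by blast
      \<comment> \<open>The functional u ranges over a ball that need not be separable. Exchanging
        the roles of \<open>\<nu> i\<close> and u moves u onto a vector of E, whose norm the
        sequence already controls.\<close>
      have "norm (tens_sum n x y) \<le> ln b"
      proof (rule norm_blinfun_bound[OF lnb])
        fix u :: "'e \<Rightarrow>\<^sub>L real"
        show "norm (blinfun_apply (tens_sum n x y) u) \<le> ln b * norm u"
        proof (rule \<nu>(2))
          fix i
          have "blinfun_apply (\<nu> i) (blinfun_apply (tens_sum n x y) u) = blinfun_apply u (\<Sum>k=1..n. a i k *\<^sub>R y k)"
            by (simp add: tens_sum_apply a_def blinfun.sum_right blinfun.scaleR_right mult.commute)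
          also have "\<dots> \<le> norm u * norm (\<Sum>k=1..n. a i k *\<^sub>R y k)"
            using norm_blinfun[of u "\<Sum>k=1..n. a i k *\<^sub>R y k"] by simp
          also have "\<dots> \<le> norm u * ln b" using ni by (intro mult_left_mono) auto
          finally show "blinfun_apply (\<nu> i) (blinfun_apply (tens_sum n x y) u) \<le> ln b * norm u" by (simp add: mult.commute)
        qed
      qed
      then have "exp (norm (tens_sum n x y)) \<le> exp (ln b)" by simp
      then have "exp (norm (tens_sum n x y)) \<le> b" using b by simp
      then show ?thesis using real by (simp add: ennreal_leI)
    qed simp
  qed
  also have "\<dots> = (SUP M. \<integral>\<^sup>+y. ennreal (exp (Max ((\<lambda>p. lin_form N (zw p) y) ` ({..M} \<times> {..M})))) \<partial>P)"
  proof (rule nn_integral_monotone_convergence_SUP)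
    show "incseq (\<lambda>M y. ennreal (exp (Max ((\<lambda>p. lin_form N (zw p) y) ` ({..M} \<times> {..M})))))"
      by (auto simp: incseq_def le_fun_def intro!: ennreal_leI Max_mono)
  qed measurable
  also have "\<dots> \<le> 2 * (\<integral>\<^sup>+y. ennreal (exp (m y)) \<partial>P)"
    by (intro SUP_least bound)
  finally show ?thesis unfolding m_def .
qed

section \<open>Decoupling of the empirical covariance\<close>

lemma functional_mean:
  fixes u :: "'e \<Rightarrow>\<^sub>L real"
  shows "has_bochner_integral \<mu> (blinfun_apply u) 0"
proof -
  have s: "0 \<le> sqrt (cov u u)" using cov_nonneg by simp
  have "integrable std_normal_distribution (\<lambda>x. sqrt (cov u u) * x)"
    "(\<integral>x. sqrt (cov u u) * x \<partial>std_normal_distribution) = 0"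
    using integrable_std_normal_distribution_moment[of 1] integral_std_normal_distribution_moment_odd[of 1] by auto
  then have "integrable (distr \<mu> borel (blinfun_apply u)) (\<lambda>x. x)" "(\<integral>x. x \<partial>distr \<mu> borel (blinfun_apply u)) = 0"
    unfolding distr_functional centered_normal_eq_distr[OF s] by (simp_all add: integrable_distr_eq integral_distr)
  then show ?thesis by (simp add: has_bochner_integral_iff integrable_distr_eq integral_distr)
qed

lemma has_bochner_integral_P_coord:
  fixes f :: "'e \<Rightarrow> real"
  assumes "has_bochner_integral \<mu> f c"
  shows "has_bochner_integral P (\<lambda>y. f (y k)) c"
proof -
  have f: "integrable \<mu> f" "(\<integral>z. f z \<partial>\<mu>) = c" using assms by (auto simp: has_bochner_integral_iff)
  have [measurable]: "f \<in> borel_measurable borel"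
    using borel_measurable_integrable[OF f(1)] by (simp cong: measurable_cong_sets)
  have [measurable]: "(\<lambda>y. y k) \<in> borel_measurable P" by (rule measurable_P_coord)
  have "integrable (distr P borel (\<lambda>y. y k)) f" "(\<integral>z. f z \<partial>distr P borel (\<lambda>y. y k)) = c"
    using f by (simp_all add: distr_P_coord)
  then show ?thesis by (simp add: has_bochner_integral_iff integrable_distr_eq integral_distr)
qed

text \<open>A factored form of the difference of squares. Its two extra cross terms are linear in y
  and disappear in the mean over y, while up to scale the factors are the two components of a
  rotation by 45 degrees.\<close>

definition polar :: "nat \<Rightarrow> (nat \<Rightarrow> 'e) \<Rightarrow> (nat \<Rightarrow> 'e) \<Rightarrow> 'e dual_op" where
  "polar n x y = tens_sum n (\<lambda>k. x k + y k) (\<lambda>k. x k - y k)"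

lemma continuous_polar: "continuous_on UNIV (\<lambda>z. polar n (fst z) (snd z))"
  unfolding polar_def by (intro continuous_intros continuous_on_coord)

lemma continuous_polar_right: "continuous_on UNIV (polar n x)"
  unfolding polar_def by (intro continuous_intros continuous_on_product_coordinates)

lemma polar_mean:
  assumes n: "1 \<le> n"
  shows "has_bochner_integral P (\<lambda>y. blinfun_apply v (blinfun_apply (polar n x y) u))
    (real n * blinfun_apply v (blinfun_apply (emp_cov n x - \<Sigma>) u))"
proof -
  have eq: "blinfun_apply v (blinfun_apply (polar n x y) u)
    = (\<Sum>k=1..n. blinfun_apply u (x k) * blinfun_apply v (x k) + blinfun_apply u (x k) * blinfun_apply v (y k)
       - blinfun_apply v (x k) * blinfun_apply u (y k) - blinfun_apply u (y k) * blinfun_apply v (y k))" for y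
    by (simp add: polar_def tens_sum_apply blinfun.sum_right blinfun.scaleR_right blinfun.add_right blinfun.diff_right algebra_simps)
  have const: "has_bochner_integral P (\<lambda>y. r) r" for r :: real
    using P.prob_space by (simp add: has_bochner_integral_iff)
  have mean: "has_bochner_integral P (\<lambda>y. blinfun_apply w (y k)) 0" for w :: "'e \<Rightarrow>\<^sub>L real" and k
    using functional_mean by (rule has_bochner_integral_P_coord)
  have prod: "has_bochner_integral P (\<lambda>y. blinfun_apply u (y k) * blinfun_apply v (y k)) (cov u v)" for k
    using cov_integral by (rule has_bochner_integral_P_coord)
  have "has_bochner_integral P (\<lambda>y. blinfun_apply v (blinfun_apply (polar n x y) u))
    (\<Sum>k=1..n. blinfun_apply u (x k) * blinfun_apply v (x k) + blinfun_apply u (x k) * 0 - blinfun_apply v (x k) * 0 - cov u v)"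
    unfolding eq
    by (intro has_bochner_integral_sum has_bochner_integral_diff has_bochner_integral_add const prod mean has_bochner_integral_mult_right)
  also have "(\<Sum>k=1..n. blinfun_apply u (x k) * blinfun_apply v (x k) + blinfun_apply u (x k) * 0 - blinfun_apply v (x k) * 0 - cov u v)
    = real n * blinfun_apply v (blinfun_apply (emp_cov n x - \<Sigma>) u)"
    using n unfolding cov_commute[of u v]
    by (simp add: emp_cov_def blinfun.diff_left blinfun.diff_right blinfun.scaleR_left blinfun.scaleR_right
        tens_sum_apply blinfun.sum_right sum_subtractf cov_def right_diff_distrib)
  finally show ?thesis .
qed

text \<open>The deviation is the mean over y of \<open>polar\<close>, divided by n. The triangle
  inequality is applied weakly, through pairs of functionals, and Jensen's inequality then moves the
  exponential inside the integral.\<close>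

lemma decoupling_pointwise:
  assumes n: "1 \<le> n" and l: "0 < l"
  shows "ennreal (exp (l * norm (emp_cov n x - \<Sigma>))) \<le> (\<integral>\<^sup>+y. ennreal (exp ((l / real n) * norm (polar n x y))) \<partial>P)"
proof (cases "(\<integral>\<^sup>+y. ennreal (exp ((l / real n) * norm (polar n x y))) \<partial>P) = \<infinity>")
  case False
  define g where "g y = (l / real n) * norm (polar n x y)" for y
  have [measurable]: "(\<lambda>y. norm (polar n x y)) \<in> borel_measurable P"
    by (intro measurable_P_continuous continuous_on_norm continuous_polar_right)
  have int_exp: "integrable P (\<lambda>y. exp (g y))"
    using False by (intro integrableI_nonneg) (auto simp: top.not_eq_extremum g_def)
  have int_g: "integrable P g"
  proof (rule Bochner_Integration.integrable_bound[OF int_exp])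
    show "g \<in> borel_measurable P" unfolding g_def by measurable
    have "g y \<le> exp (g y)" for y using exp_ge_add_one_self[of "g y"] by linarith
    moreover have "0 \<le> g y" for y using l by (simp add: g_def)
    ultimately show "AE y in P. norm (g y) \<le> norm (exp (g y))" by simp
  qed
  have nl: "norm (polar n x y) = (real n / l) * g y" for y using n l by (simp add: g_def)
  have int_polar: "integrable P (\<lambda>y. norm (polar n x y))" unfolding nl using int_g by simp
  have "norm (emp_cov n x - \<Sigma>) \<le> (1 / real n) * (\<integral>y. norm (polar n x y) \<partial>P)"
  proof (rule norm_dual_op_le)
    fix u v :: "'e \<Rightarrow>\<^sub>L real" assume uv: "norm u \<le> 1" "norm v \<le> 1"
    note pm = polar_mean[OF n, of u x v]
    have "real n * blinfun_apply u (blinfun_apply (emp_cov n x - \<Sigma>) v) = (\<integral>y. blinfun_apply u (blinfun_apply (polar n x y) v) \<partial>P)"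
      using has_bochner_integral_integral_eq[OF pm] by simp
    also have "\<dots> \<le> (\<integral>y. norm (polar n x y) \<partial>P)"
    proof (rule integral_mono[OF _ int_polar])
      show "integrable P (\<lambda>y. blinfun_apply u (blinfun_apply (polar n x y) v))"
        using pm by (simp add: has_bochner_integral_iff)
      fix y
      have "blinfun_apply u (blinfun_apply (polar n x y) v) \<le> norm (blinfun_apply (polar n x y) v)"
        using functional_le_norm[OF uv(1)] abs_le_D1 by blast
      also have "\<dots> \<le> norm (polar n x y) * norm v" by (rule norm_blinfun)
      also have "\<dots> \<le> norm (polar n x y)" using uv(2) by (intro mult_left_le) auto
      finally show "blinfun_apply u (blinfun_apply (polar n x y) v) \<le> norm (polar n x y)" .
    qed
    finally show "blinfun_apply u (blinfun_apply (emp_cov n x - \<Sigma>) v) \<le> (1 / real n) * (\<integral>y. norm (polar n x y) \<partial>P)"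
      using n by (simp add: field_simps)
  qed simp
  then have "l * norm (emp_cov n x - \<Sigma>) \<le> l * ((1 / real n) * (\<integral>y. norm (polar n x y) \<partial>P))"
    using l by (intro mult_left_mono) auto
  also have "\<dots> = (\<integral>y. g y \<partial>P)" by (simp add: g_def)
  finally have "ennreal (exp (l * norm (emp_cov n x - \<Sigma>))) \<le> ennreal (exp (\<integral>y. g y \<partial>P))" by (intro ennreal_leI) simp
  also have "\<dots> \<le> (\<integral>\<^sup>+y. ennreal (exp (g y)) \<partial>P)" by (rule P.exp_integral_le[OF int_g])
  finally show ?thesis by (simp add: g_def)
qed simp

text \<open>The rotation replaces the two dependent factors of \<open>polar\<close> by independent
  copies. Each sheds a factor \<open>sqrt 2\<close>, which accounts for the 2 in
  \<open>2 * l / real n\<close>; the sign is lost in the norm.\<close>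

theorem decoupling:
  assumes n: "1 \<le> n" and l: "0 < l"
  shows "(\<integral>\<^sup>+x. ennreal (exp (l * norm (emp_cov n x - \<Sigma>))) \<partial>P)
    \<le> (\<integral>\<^sup>+x. (\<integral>\<^sup>+y. ennreal (exp (norm (tens_sum n (\<lambda>k. (2 * l / real n) *\<^sub>R x k) y))) \<partial>P) \<partial>P)"
proof -
  define c where "c = 1 / sqrt 2"
  have c: "c\<^sup>2 + c\<^sup>2 = 1" "2 * (c * c) = 1" by (auto simp: c_def power_divide)
  define H where "H z = ennreal (exp (norm (tens_sum n (\<lambda>k. (2 * l / real n) *\<^sub>R fst z k) (snd z))))" for z :: "(nat \<Rightarrow> 'e) \<times> (nat \<Rightarrow> 'e)"
  have H[measurable]: "H \<in> borel_measurable (P \<Otimes>\<^sub>M P)"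
    unfolding H_def
    by (intro measurable_compose[OF _ measurable_ennreal] measurable_PP_continuous continuous_intros continuous_on_coord)
  have G[measurable]: "(\<lambda>z. ennreal (exp ((l / real n) * norm (polar n (fst z) (snd z))))) \<in> borel_measurable (P \<Otimes>\<^sub>M P)"
    by (intro measurable_compose[OF _ measurable_ennreal] measurable_PP_continuous continuous_on_exp continuous_on_mult_left continuous_on_norm continuous_polar)
  have eq: "ennreal (exp ((l / real n) * norm (polar n (fst z) (snd z)))) = H (rot c c z)" for z
  proof -
    have "tens_sum n (\<lambda>k. (2 * l / real n) *\<^sub>R fst (rot c c z) k) (snd (rot c c z))
      = tens_sum n (\<lambda>k. (2 * l / real n * c) *\<^sub>R (fst z k + snd z k)) (\<lambda>k. (- c) *\<^sub>R (fst z k - snd z k))"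
      by (simp add: rot_def algebra_simps)
    also have "\<dots> = (- (l / real n * (2 * (c * c)))) *\<^sub>R polar n (fst z) (snd z)"
      unfolding tens_sum_scale polar_def by simp
    finally have "norm (tens_sum n (\<lambda>k. (2 * l / real n) *\<^sub>R fst (rot c c z) k) (snd (rot c c z))) = (l / real n) * norm (polar n (fst z) (snd z))"
      using l unfolding c(2) by simp
    then show ?thesis by (simp add: H_def)
  qed
  have "(\<integral>\<^sup>+x. ennreal (exp (l * norm (emp_cov n x - \<Sigma>))) \<partial>P)
    \<le> (\<integral>\<^sup>+x. (\<integral>\<^sup>+y. ennreal (exp ((l / real n) * norm (polar n x y))) \<partial>P) \<partial>P)"
    by (intro nn_integral_mono decoupling_pointwise n l)
  also have "\<dots> = (\<integral>\<^sup>+z. ennreal (exp ((l / real n) * norm (polar n (fst z) (snd z)))) \<partial>(P \<Otimes>\<^sub>M P))"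
    using P.nn_integral_fst[OF G] by simp
  also have "\<dots> = (\<integral>\<^sup>+z. H z \<partial>distr (P \<Otimes>\<^sub>M P) (P \<Otimes>\<^sub>M P) (rot c c))"
    unfolding eq by (subst nn_integral_distr) auto
  also have "\<dots> = (\<integral>\<^sup>+z. H z \<partial>(P \<Otimes>\<^sub>M P))" unfolding rotation_invariance[OF c(1)] ..
  also have "\<dots> = (\<integral>\<^sup>+x. (\<integral>\<^sup>+y. H (x, y) \<partial>P) \<partial>P)"
    using P.nn_integral_fst[OF H] by simp
  finally show ?thesis by (simp add: H_def)
qed

end

section \<open>The exponential moment of the covariance error\<close>

text \<open>From \<open>ln t \<le> t - 1\<close> at \<open>t = x / q\<close>. This converts one
  exponential moment into moments of every order with growth q^q.\<close>

lemma powr_le_exp: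
  fixes x q :: real
  assumes "0 \<le> x" "0 < q"
  shows "x powr q \<le> q powr q * exp x"
proof (cases "x = 0")
  case False
  then have x: "0 < x" using assms by simp
  have "ln (x / q) \<le> x / q - 1" using x assms by (intro ln_le_minus_one) simp
  then have "ln x \<le> ln q + x / q" using x assms by (simp add: ln_div)
  then have "q * ln x \<le> q * (ln q + x / q)" using assms by (intro mult_left_mono) auto
  then have "q * ln x \<le> q * ln q + x" using assms by (simp add: algebra_simps)
  then have "exp (q * ln x) \<le> exp (q * ln q + x)" by simp
  then show ?thesis using x assms by (simp add: powr_def exp_add)
qed simp

lemma ennreal_affine:
  "0 \<le> a \<Longrightarrow> 0 \<le> x \<Longrightarrow> 0 \<le> b \<Longrightarrow> ennreal (a * x + b) = ennreal a * ennreal x + ennreal b"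
  by (simp add: ennreal_plus ennreal_mult')

lemma ennreal_lincomb:
  "0 \<le> a \<Longrightarrow> 0 \<le> b \<Longrightarrow> 0 \<le> x \<Longrightarrow> 0 \<le> y \<Longrightarrow> 0 \<le> z \<Longrightarrow>
    ennreal (a * x + b * (y + z)) = ennreal a * ennreal x + ennreal b * (ennreal y + ennreal z)"
  by (simp add: ennreal_plus ennreal_mult')

text \<open>Young's inequality read as the tangent to \<open>y powr p\<close> at c, arranged so that
  all terms are nonnegative. Both Jensen inequalities for powers below rest on it.\<close>

lemma powr_tangent:
  fixes y c p :: real
  assumes "0 \<le> y" "0 \<le> c" "1 \<le> p"
  shows "p * c powr (p - 1) * y \<le> y powr p + (p - 1) * c powr p"
proof (cases "p = 1 \<or> c = 0")
  case True
  then show ?thesis using assms by (auto simp: powr_def)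
next
  case False
  then have p: "1 < p" and c: "0 < c" using assms by auto
  define q where "q = p / (p - 1)"
  have q: "1 < q" "1 / p + 1 / q = 1" "(p - 1) * q = p" "p / q = p - 1"
    using p by (auto simp: q_def field_simps)
  have "y * c powr (p - 1) \<le> y powr p / p + (c powr (p - 1)) powr q / q"
    using p q assms by (intro Youngs_inequality) auto
  then have "p * (y * c powr (p - 1)) \<le> p * (y powr p / p + c powr p / q)"
    using p q by (intro mult_left_mono) (auto simp: powr_powr)
  also have "\<dots> = y powr p + (p / q) * c powr p" using p by (simp add: algebra_simps)
  finally show ?thesis using q by (simp add: mult_ac)
qed

lemma (in prob_space) powr_integral_le:
  assumes h: "integrable M h" and p: "1 \<le> p"
  shows "ennreal (\<bar>\<integral>x. h x \<partial>M\<bar> powr p) \<le> (\<integral>\<^sup>+x. ennreal (\<bar>h x\<bar> powr p) \<partial>M)"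
proof (cases "(\<integral>\<^sup>+x. ennreal (\<bar>h x\<bar> powr p) \<partial>M) = \<infinity>")
  case False
  have [measurable]: "h \<in> borel_measurable M" using h by auto
  define c where "c = \<bar>\<integral>x. h x \<partial>M\<bar>"
  have int: "integrable M (\<lambda>x. \<bar>h x\<bar> powr p)"
    using False by (intro integrableI_nonneg) (auto simp: top.not_eq_extremum)
  have c0: "0 \<le> c" by (simp add: c_def)
  have "c \<le> (\<integral>x. \<bar>h x\<bar> \<partial>M)" unfolding c_def by (rule integral_abs_bound)
  then have "p * c powr (p - 1) * c \<le> p * c powr (p - 1) * (\<integral>x. \<bar>h x\<bar> \<partial>M)"
    using p by (intro mult_left_mono) auto
  also have "\<dots> = (\<integral>x. p * c powr (p - 1) * \<bar>h x\<bar> \<partial>M)" using h by simp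
  also have "\<dots> \<le> (\<integral>x. \<bar>h x\<bar> powr p + (p - 1) * c powr p \<partial>M)"
    using h int p c0 by (intro integral_mono powr_tangent) auto
  also have "\<dots> = (\<integral>x. \<bar>h x\<bar> powr p \<partial>M) + (p - 1) * c powr p" using int by (simp add: prob_space)
  also have "p * c powr (p - 1) * c = p * c powr p"
    using c0 by (cases "c = 0") (auto simp: powr_diff)
  finally have "c powr p \<le> (\<integral>x. \<bar>h x\<bar> powr p \<partial>M)" by (simp add: algebra_simps)
  then show ?thesis
    using nn_integral_eq_integral[OF int] by (simp add: c_def ennreal_leI)
qed simp

text \<open>Jensen's inequality for the average speed over the interval from 0 to h, with the
  tangent taken at the average \<open>I / h\<close>.\<close>

lemma FTC_powr_le:
  fixes F g :: "real \<Rightarrow> real"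
  assumes h: "0 < h" and p: "1 \<le> p"
    and deriv: "\<And>t. (F has_real_derivative g t) (at t)" and cont: "continuous_on UNIV g"
  shows "ennreal (\<bar>F h - F 0\<bar> powr p) \<le> ennreal (h powr (p - 1)) * (\<integral>\<^sup>+t. indicator {0..h} t * ennreal (\<bar>g t\<bar> powr p) \<partial>lborel)"
proof -
  have ci: "integrable lborel (\<lambda>t. indicator {0..h} t * k t)" if "continuous_on UNIV k" for k :: "real \<Rightarrow> real"
    using borel_integrable_atLeastAtMost'[of 0 h k] continuous_on_subset[OF that]
    by (simp add: set_integrable_def)
  have cp: "continuous_on UNIV (\<lambda>t. \<bar>g t\<bar> powr p)"
    using p by (intro continuous_on_powr' continuous_intros cont) auto
  have int_p: "integrable lborel (\<lambda>t. indicator {0..h} t * \<bar>g t\<bar> powr p)" by (rule ci[OF cp])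
  have int_1: "integrable lborel (\<lambda>t. indicator {0..h} t * \<bar>g t\<bar>)" by (intro ci continuous_intros cont)
  define I where "I = (\<integral>t. indicator {0..h} t * \<bar>g t\<bar> \<partial>lborel)"
  define J where "J = (\<integral>t. indicator {0..h} t * \<bar>g t\<bar> powr p \<partial>lborel)"
  have I0: "0 \<le> I" unfolding I_def by (intro Bochner_Integration.integral_nonneg) simp
  have "F h - F 0 = (\<integral>t. indicator {0..h} t * g t \<partial>lborel)"
    using integral_FTC_Icc_real[where a = 0 and b = h and F = F and f = g] h deriv cont
    by (simp add: mult.commute continuous_on_eq_continuous_at)
  then have "\<bar>F h - F 0\<bar> \<le> (\<integral>t. \<bar>indicator {0..h} t * g t\<bar> \<partial>lborel)"
    by (simp only: integral_abs_bound)
  also have "\<dots> = I" by (simp add: I_def abs_mult)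
  finally have FI: "\<bar>F h - F 0\<bar> \<le> I" .
  define c where "c = I / h"
  have c0: "0 \<le> c" using I0 h by (simp add: c_def)
  have ind: "(\<integral>t. indicator {0..h} t \<partial>lborel) = h" using h by simp
  have int_ind: "integrable lborel (indicator {0..h} :: real \<Rightarrow> real)"
    by (rule integrable_real_indicator) (auto simp: emeasure_lborel_Icc_eq)
  have "p * c powr (p - 1) * I = (\<integral>t. p * c powr (p - 1) * (indicator {0..h} t * \<bar>g t\<bar>) \<partial>lborel)"
    by (simp add: I_def)
  also have "\<dots> \<le> (\<integral>t. indicator {0..h} t * \<bar>g t\<bar> powr p + (p - 1) * c powr p * indicator {0..h} t \<partial>lborel)"
  proof (rule integral_mono)
    show "integrable lborel (\<lambda>t. p * c powr (p - 1) * (indicator {0..h} t * \<bar>g t\<bar>))"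
      using int_1 by simp
    show "integrable lborel (\<lambda>t. indicator {0..h} t * \<bar>g t\<bar> powr p + (p - 1) * c powr p * indicator {0..h} t)"
      by (intro Bochner_Integration.integrable_add integrable_mult_right int_p int_ind)
    show "p * c powr (p - 1) * (indicator {0..h} t * \<bar>g t\<bar>) \<le> indicator {0..h} t * \<bar>g t\<bar> powr p + (p - 1) * c powr p * indicator {0..h} t" for t
      using powr_tangent[OF _ c0 p, of "\<bar>g t\<bar>"] by (auto simp: indicator_def)
  qed
  also have "\<dots> = J + (\<integral>t. (p - 1) * c powr p * indicator {0..h} t \<partial>lborel)"
    unfolding J_def by (intro Bochner_Integration.integral_add integrable_mult_right int_p int_ind)
  also have "\<dots> = J + (p - 1) * c powr p * h" using ind by simp
  also have "p * c powr (p - 1) * I = p * c powr p * h"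
  proof (cases "c = 0")
    case False
    have "I = c * h" using h by (simp add: c_def)
    then show ?thesis using c0 False by (simp add: powr_diff)
  qed (use h in \<open>auto simp: c_def\<close>)
  finally have cJ: "c powr p * h \<le> J" by (simp add: algebra_simps)
  have "\<bar>F h - F 0\<bar> powr p \<le> I powr p" using FI p by (intro powr_mono2) auto
  also have "I powr p = h powr (p - 1) * (c powr p * h)"
    using I0 h by (simp add: c_def powr_divide powr_diff)
  also have "\<dots> \<le> h powr (p - 1) * J" using cJ by (intro mult_left_mono) auto
  finally have "ennreal (\<bar>F h - F 0\<bar> powr p) \<le> ennreal (h powr (p - 1)) * ennreal J"
    by (simp add: ennreal_leI flip: ennreal_mult')
  also have "ennreal J = (\<integral>\<^sup>+t. ennreal (indicator {0..h} t * \<bar>g t\<bar> powr p) \<partial>lborel)"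
    unfolding J_def using int_p by (intro nn_integral_eq_integral[symmetric]) auto
  also have "\<dots> = (\<integral>\<^sup>+t. indicator {0..h} t * ennreal (\<bar>g t\<bar> powr p) \<partial>lborel)"
    by (intro nn_integral_cong) (simp add: indicator_def)
  finally show ?thesis .
qed

section \<open>The Maurey-Pisier inequality, the rate, and the exponential moment\<close>

context gaussian
begin

text \<open>The Maurey--Pisier argument: \<open>F\<close> changes along a quarter rotation, which exchanges the two
  independent copies, at a speed whose law is the same at all times.\<close>

theorem Maurey_Pisier:
  fixes F G :: "(nat \<Rightarrow> 'e) \<times> (nat \<Rightarrow> 'e) \<Rightarrow> real"
  assumes p: "1 \<le> p"
    and deriv: "\<And>z t. ((\<lambda>t. F (rot (cos t) (sin t) z)) has_real_derivative G (rot (cos t) (sin t) z)) (at t)"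
    and cont: "\<And>z. continuous_on UNIV (\<lambda>t. G (rot (cos t) (sin t) z))"
    and G[measurable]: "G \<in> borel_measurable (P \<Otimes>\<^sub>M P)"
  shows "(\<integral>\<^sup>+z. ennreal (\<bar>F (rot 0 1 z) - F z\<bar> powr p) \<partial>(P \<Otimes>\<^sub>M P))
    \<le> ennreal ((pi / 2) powr p) * (\<integral>\<^sup>+z. ennreal (\<bar>G z\<bar> powr p) \<partial>(P \<Otimes>\<^sub>M P))"
proof -
  interpret PP: pair_prob_space P P by unfold_locales
  interpret L: pair_sigma_finite lborel "P \<Otimes>\<^sub>M P" by unfold_locales
  define h where "h = pi / 2"
  have h: "0 < h" by (simp add: h_def)
  define K where "K q = indicator {0..h} (fst q) * ennreal (\<bar>G (rot (cos (fst q)) (sin (fst q)) (snd q))\<bar> powr p)" for q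
  have ind: "(\<lambda>q. indicator {0..h} (fst q) :: ennreal) \<in> borel_measurable (lborel \<Otimes>\<^sub>M (P \<Otimes>\<^sub>M P))"
    by (rule measurable_compose[OF measurable_fst]) simp
  have K[measurable]: "K \<in> borel_measurable (lborel \<Otimes>\<^sub>M (P \<Otimes>\<^sub>M P))"
    unfolding K_def by (rule borel_measurable_times_ennreal[OF ind]) measurable
  have inv: "(\<integral>\<^sup>+z. ennreal (\<bar>G (rot (cos t) (sin t) z)\<bar> powr p) \<partial>(P \<Otimes>\<^sub>M P)) = (\<integral>\<^sup>+z. ennreal (\<bar>G z\<bar> powr p) \<partial>(P \<Otimes>\<^sub>M P))" for t
    by (subst (2) distr_rot[of t, symmetric], subst nn_integral_distr) auto
  have "(\<integral>\<^sup>+z. ennreal (\<bar>F (rot 0 1 z) - F z\<bar> powr p) \<partial>(P \<Otimes>\<^sub>M P))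
    \<le> (\<integral>\<^sup>+z. ennreal (h powr (p - 1)) * (\<integral>\<^sup>+t. K (t, z) \<partial>lborel) \<partial>(P \<Otimes>\<^sub>M P))"
  proof (rule nn_integral_mono)
    fix z
    show "ennreal (\<bar>F (rot 0 1 z) - F z\<bar> powr p) \<le> ennreal (h powr (p - 1)) * (\<integral>\<^sup>+t. K (t, z) \<partial>lborel)"
      using FTC_powr_le[OF h p, of "\<lambda>t. F (rot (cos t) (sin t) z)" "\<lambda>t. G (rot (cos t) (sin t) z)"] deriv cont
      by (simp add: K_def h_def rot_zero)
  qed
  also have "\<dots> = ennreal (h powr (p - 1)) * (\<integral>\<^sup>+z. (\<integral>\<^sup>+t. K (t, z) \<partial>lborel) \<partial>(P \<Otimes>\<^sub>M P))"
    by (intro nn_integral_cmult) measurable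
  also have "(\<integral>\<^sup>+z. (\<integral>\<^sup>+t. K (t, z) \<partial>lborel) \<partial>(P \<Otimes>\<^sub>M P)) = (\<integral>\<^sup>+t. (\<integral>\<^sup>+z. K (t, z) \<partial>(P \<Otimes>\<^sub>M P)) \<partial>lborel)"
    by (rule L.Fubini[OF K])
  also have "\<dots> = (\<integral>\<^sup>+t. indicator {0..h} t * (\<integral>\<^sup>+z. ennreal (\<bar>G z\<bar> powr p) \<partial>(P \<Otimes>\<^sub>M P)) \<partial>lborel)"
    unfolding K_def fst_conv snd_conv by (subst nn_integral_cmult) (auto simp: inv)
  also have "\<dots> = ennreal h * (\<integral>\<^sup>+z. ennreal (\<bar>G z\<bar> powr p) \<partial>(P \<Otimes>\<^sub>M P))"
    using h by (subst nn_integral_multc) auto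
  also have "ennreal (h powr (p - 1)) * (ennreal h * (\<integral>\<^sup>+z. ennreal (\<bar>G z\<bar> powr p) \<partial>(P \<Otimes>\<^sub>M P)))
    = ennreal (h powr p) * (\<integral>\<^sup>+z. ennreal (\<bar>G z\<bar> powr p) \<partial>(P \<Otimes>\<^sub>M P))"
  proof -
    have "h powr (p - 1) * h = h powr p" using h by (simp add: powr_diff)
    then have "ennreal (h powr (p - 1)) * ennreal h = ennreal (h powr p)" using h by (simp flip: ennreal_mult')
    then show ?thesis by (simp flip: mult.assoc)
  qed
  finally show ?thesis by (simp add: h_def)
qed

text \<open>With \<open>r = m2 / norm \<Sigma>\<close> this is \<open>norm \<Sigma>\<close> times the maximum of \<open>sqrt (r / n)\<close> and \<open>r / n\<close>.\<close>

definition rate :: "nat \<Rightarrow> real" where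
  "rate n = max (sqrt (norm \<Sigma> * m2 / real n)) (m2 / real n)"

lemma rate_pos:
  assumes "1 \<le> n" "0 < norm \<Sigma>"
  shows "0 < m2" "0 < rate n"
proof -
  show "0 < m2" using assms(2) norm_cov_le_m2 by linarith
  then have "0 < m2 / real n" using assms by simp
  then show "0 < rate n" unfolding rate_def by (rule less_le_trans) simp
qed

lemma rate_bounds:
  assumes n: "1 \<le> n" and S: "0 < norm \<Sigma>"
  shows "m2 \<le> real n * rate n" "sqrt (real n * norm \<Sigma> * m2) \<le> real n * rate n"
proof -
  have "m2 / real n \<le> rate n" "sqrt (norm \<Sigma> * m2 / real n) \<le> rate n" by (auto simp: rate_def)
  then show "m2 \<le> real n * rate n" using n by (simp add: divide_le_eq mult.commute)
  have "sqrt (real n * norm \<Sigma> * m2) = real n * sqrt (norm \<Sigma> * m2 / real n)"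
  proof -
    have "real n * norm \<Sigma> * m2 = (real n)\<^sup>2 * (norm \<Sigma> * m2 / real n)" using n by (simp add: power2_eq_square)
    then have "sqrt (real n * norm \<Sigma> * m2) = sqrt ((real n)\<^sup>2 * (norm \<Sigma> * m2 / real n))"
      by (rule arg_cong)
    also have "\<dots> = sqrt ((real n)\<^sup>2) * sqrt (norm \<Sigma> * m2 / real n)" by (rule real_sqrt_mult)
    finally show ?thesis by simp
  qed
  also have "\<dots> \<le> real n * rate n" using \<open>sqrt (norm \<Sigma> * m2 / real n) \<le> rate n\<close> by (intro mult_left_mono) auto
  finally show "sqrt (real n * norm \<Sigma> * m2) \<le> real n * rate n" .
qed

text \<open>The balancing parameter \<open>\<theta>\<close> equals \<open>min 1 (sqrt (r / n))\<close>.\<close>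

lemma balance_exists:
  assumes n: "1 \<le> n" and S: "0 < norm \<Sigma>"
  obtains \<theta> where "0 < \<theta>" "\<theta> \<le> 1" "\<theta> * norm \<Sigma> \<le> rate n" "m2 \<le> \<theta> * (real n * rate n)"
proof -
  note m = rate_pos(1)[OF n S]
  define \<theta> where "\<theta> = min 1 (sqrt (m2 / (real n * norm \<Sigma>)))"
  have q: "0 < m2 / (real n * norm \<Sigma>)" using n S m by simp
  have "\<theta> * norm \<Sigma> \<le> sqrt (m2 / (real n * norm \<Sigma>)) * norm \<Sigma>" using S by (intro mult_right_mono) (auto simp: \<theta>_def)
  also have "\<dots> = sqrt (m2 / (real n * norm \<Sigma>) * (norm \<Sigma>)\<^sup>2)" by (subst real_sqrt_mult) simp
  also have "m2 / (real n * norm \<Sigma>) * (norm \<Sigma>)\<^sup>2 = norm \<Sigma> * m2 / real n" using S by (simp add: power2_eq_square)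
  also have "sqrt \<dots> \<le> rate n" by (simp add: rate_def)
  finally have 1: "\<theta> * norm \<Sigma> \<le> rate n" .
  have 2: "m2 \<le> \<theta> * (real n * rate n)"
  proof (cases "sqrt (m2 / (real n * norm \<Sigma>)) \<le> 1")
    case True
    have "m2 = sqrt (m2 * m2)" using m by simp
    also have "m2 * m2 = (m2 / (real n * norm \<Sigma>)) * (real n * norm \<Sigma> * m2)" using n S by simp
    also have "sqrt \<dots> = sqrt (m2 / (real n * norm \<Sigma>)) * sqrt (real n * norm \<Sigma> * m2)" by (rule real_sqrt_mult)
    also have "\<dots> \<le> sqrt (m2 / (real n * norm \<Sigma>)) * (real n * rate n)"
      using q rate_bounds(2)[OF n S] by (intro mult_left_mono) auto
    finally show ?thesis using True by (simp add: \<theta>_def)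
  next
    case False
    then show ?thesis using rate_bounds(1)[OF n S] by (simp add: \<theta>_def)
  qed
  have "0 < \<theta>" using q by (simp add: \<theta>_def)
  then show ?thesis by (rule that[OF _ _ 1 2]) (simp add: \<theta>_def)
qed

text \<open>Given y, the sum over x has the law of a single copy z of X, scaled by
  \<open>r y\<close>. The product of \<open>r y\<close> and \<open>norm z\<close> in the exponent is
  split into squares, and convexity of \<open>exp\<close> separates them into two terms with
  integral at most 2 each.\<close>

lemma mixed_exp_le:
  assumes n: "1 \<le> n" and S: "0 < norm \<Sigma>" and v: "norm v \<le> 1" and l: "l = 1 / (12000 * rate n)"
  shows "(\<integral>\<^sup>+x. (\<integral>\<^sup>+y. ennreal (exp (8 * sqrt 2 * norm (\<Sum>k=1..n. blinfun_apply v (y (n + k)) *\<^sub>R ((2 * l / real n) *\<^sub>R x k)))) \<partial>P) \<partial>P) \<le> 2"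
proof -
  interpret PP: pair_prob_space P P by unfold_locales
  note m = rate_pos(1)[OF n S] and R = rate_pos(2)[OF n S]
  define K where "K z = ennreal (exp (8 * sqrt 2 * norm (\<Sum>k=1..n. blinfun_apply v (snd z (n + k)) *\<^sub>R ((2 * l / real n) *\<^sub>R fst z k))))"
    for z :: "(nat \<Rightarrow> 'e) \<times> (nat \<Rightarrow> 'e)"
  have K[measurable]: "K \<in> borel_measurable (P \<Otimes>\<^sub>M P)"
    unfolding K_def
    by (intro measurable_compose[OF _ measurable_ennreal] measurable_PP_continuous continuous_intros continuous_on_coord)
  define r where "r y = sqrt (\<Sum>k=1..n. (blinfun_apply v (y (n + k)))\<^sup>2)" for y :: "nat \<Rightarrow> 'e"
  have r0: "0 \<le> r y" and r2: "(r y)\<^sup>2 = (\<Sum>k=1..n. (blinfun_apply v (y (n + k)))\<^sup>2)" for y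
    by (simp_all add: r_def sum_nonneg)
  have l0: "0 < l" using R by (simp add: l)
  have inner: "(\<integral>\<^sup>+x. K (x, y) \<partial>P) = (\<integral>\<^sup>+z. ennreal (exp (16 * sqrt 2 * (l / real n) * r y * norm z)) \<partial>\<mu>)" for y
  proof -
    \<comment> \<open>\<open>distr_weighted_sum\<close> counts from 0 but the sample from 1, hence
      the zero coefficient.\<close>
    define b where "b k = (if k = 0 then 0 else (2 * l / real n) * blinfun_apply v (y (n + k)))" for k
    have split: "(\<Sum>k<Suc n. g k) = g 0 + (\<Sum>k=1..n. g k)" for g :: "nat \<Rightarrow> 'c::comm_monoid_add"
      by (simp add: lessThan_Suc_atMost flip: atLeast0AtMost) (subst sum.atLeast_Suc_atMost, auto)
    have "(\<Sum>k=1..n. blinfun_apply v (y (n + k)) *\<^sub>R ((2 * l / real n) *\<^sub>R x k)) = (\<Sum>k<Suc n. b k *\<^sub>R x k)" for x :: "nat \<Rightarrow> 'e"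
    proof -
      have "(\<Sum>k=1..n. blinfun_apply v (y (n + k)) *\<^sub>R ((2 * l / real n) *\<^sub>R x k)) = (\<Sum>k=1..n. b k *\<^sub>R x k)"
        by (intro sum.cong refl) (auto simp: b_def mult_ac)
      then show ?thesis unfolding split by (simp add: b_def)
    qed
    then have "(\<integral>\<^sup>+x. K (x, y) \<partial>P) = (\<integral>\<^sup>+x. ennreal (exp (8 * sqrt 2 * norm (\<Sum>k<Suc n. b k *\<^sub>R x k))) \<partial>P)"
      by (simp only: K_def fst_conv snd_conv)
    also have "\<dots> = (\<integral>\<^sup>+z. ennreal (exp (8 * sqrt 2 * norm z)) \<partial>distr P borel (\<lambda>x. \<Sum>k<Suc n. b k *\<^sub>R x k))"
      by (subst nn_integral_distr) (auto intro!: borel_measurable_sum borel_measurable_scaleR measurable_P_coord simp del: sum.lessThan_Suc)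
    also have "\<dots> = (\<integral>\<^sup>+z. ennreal (exp (8 * sqrt 2 * norm (sqrt (\<Sum>k<Suc n. (b k)\<^sup>2) *\<^sub>R z))) \<partial>\<mu>)"
      unfolding distr_weighted_sum by (subst nn_integral_distr) auto
    also have "sqrt (\<Sum>k<Suc n. (b k)\<^sup>2) = (2 * l / real n) * r y"
    proof -
      have "(\<Sum>k<Suc n. (b k)\<^sup>2) = (2 * l / real n)\<^sup>2 * (\<Sum>k=1..n. (blinfun_apply v (y (n + k)))\<^sup>2)"
        unfolding split by (simp add: b_def power_mult_distrib sum_distrib_left power_divide)
      then show ?thesis using l0 by (simp add: real_sqrt_mult r_def)
    qed
    also have "(\<lambda>z. ennreal (exp (8 * sqrt 2 * norm (((2 * l / real n) * r y) *\<^sub>R z)))) = (\<lambda>z. ennreal (exp (16 * sqrt 2 * (l / real n) * r y * norm z)))" for z :: 'e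
      using l0 r0[of y] by (simp add: abs_mult fun_eq_iff mult_ac)
    finally show ?thesis .
  qed
  have am: "16 * sqrt 2 * (l / real n) * s * t \<le> (s\<^sup>2 / (500 * real n * norm \<Sigma>) + t\<^sup>2 / (500 * m2)) / 2"
    if "0 \<le> s" "0 \<le> t" for s t
  proof -
    define A where "A = sqrt (real n * norm \<Sigma>)"
    define B where "B = sqrt m2"
    have A: "0 < A" "A\<^sup>2 = real n * norm \<Sigma>" and B: "0 < B" "B\<^sup>2 = m2" using n S m by (auto simp: A_def B_def)
    have AB: "A * B \<le> real n * rate n"
      using rate_bounds(2)[OF n S] by (simp add: A_def B_def real_sqrt_mult)
    \<comment> \<open>The origin of 12000: \<open>16 * sqrt 2\<close> is at most 24, and 24 / 12000
      is the 1 / 500 allowed by Fernique.\<close>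
    have "16 * sqrt 2 \<le> (24 :: real)"
    proof -
      have "sqrt 2 \<le> 3 / 2" by (rule real_le_lsqrt) (auto simp: power2_eq_square)
      then show ?thesis by simp
    qed
    moreover have "l / real n \<le> 1 / (12000 * (A * B))"
    proof -
      have "l / real n = 1 / (12000 * (real n * rate n))" by (simp add: l)
      also have "\<dots> \<le> 1 / (12000 * (A * B))" using AB A B n R by (intro divide_left_mono) auto
      finally show ?thesis .
    qed
    ultimately have "16 * sqrt 2 * (l / real n) * (s * t) \<le> 24 * (1 / (12000 * (A * B))) * (s * t)"
      using that l0 A B by (intro mult_right_mono mult_mono) auto
    also have "\<dots> = (s / A) * (t / B) / 500" by simp
    also have "\<dots> \<le> ((s / A)\<^sup>2 + (t / B)\<^sup>2) / 2 / 500"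
      using sum_squares_bound[of "s / A" "t / B"] by simp
    also have "\<dots> = (s\<^sup>2 / (500 * real n * norm \<Sigma>) + t\<^sup>2 / (500 * m2)) / 2"
      by (simp add: power_divide A B add_divide_distrib)
    finally show ?thesis by (simp add: mult.assoc)
  qed
  have half: "exp ((a + b) / 2) \<le> (exp a + exp b) / 2" for a b :: real
  proof -
    have "2 * (exp (a / 2) * exp (b / 2)) \<le> (exp (a / 2))\<^sup>2 + (exp (b / 2))\<^sup>2"
      using sum_squares_bound[of "exp (a / 2)" "exp (b / 2)"] by (simp add: mult.assoc)
    then show ?thesis by (simp add: add_divide_distrib exp_add flip: exp_double)
  qed
  \<comment> \<open>The exponent is an average over k, so convexity of \<open>exp\<close> reduces it
    to single coordinates. For a scalar variable of variance at most \<open>norm \<Sigma>\<close>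
    the rate 1/500 is well below 1/4.\<close>
  have ndiv: "(\<integral>\<^sup>+y. ennreal (exp ((r y)\<^sup>2 / (500 * real n * norm \<Sigma>))) \<partial>P) \<le> 2"
  proof -
    define q where "q = 1 / (500 * norm \<Sigma>)"
    have "(\<integral>\<^sup>+y. ennreal (exp ((r y)\<^sup>2 / (500 * real n * norm \<Sigma>))) \<partial>P)
      \<le> (\<integral>\<^sup>+y. ennreal (1 / real n) * (\<Sum>k=1..n. ennreal (exp (q * (blinfun_apply v (y (n + k)))\<^sup>2))) \<partial>P)"
    proof (intro nn_integral_mono)
      fix y
      have "(r y)\<^sup>2 / (500 * real n * norm \<Sigma>) = (1 / real n) * (\<Sum>k=1..n. q * (blinfun_apply v (y (n + k)))\<^sup>2)"
        unfolding r2 sum_distrib_left[symmetric] by (simp add: q_def mult_ac)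
      then have "exp ((r y)\<^sup>2 / (500 * real n * norm \<Sigma>)) \<le> (1 / real n) * (\<Sum>k=1..n. exp (q * (blinfun_apply v (y (n + k)))\<^sup>2))"
        using exp_mean_le[OF n] by simp
      then have "ennreal (exp ((r y)\<^sup>2 / (500 * real n * norm \<Sigma>))) \<le> ennreal ((1 / real n) * (\<Sum>k=1..n. exp (q * (blinfun_apply v (y (n + k)))\<^sup>2)))"
        by (rule ennreal_leI)
      also have "\<dots> = ennreal (1 / real n) * (\<Sum>k=1..n. ennreal (exp (q * (blinfun_apply v (y (n + k)))\<^sup>2)))"
        by (subst ennreal_mult') (simp_all add: sum_ennreal)
      finally show "ennreal (exp ((r y)\<^sup>2 / (500 * real n * norm \<Sigma>))) \<le> ennreal (1 / real n) * (\<Sum>k=1..n. ennreal (exp (q * (blinfun_apply v (y (n + k)))\<^sup>2)))" .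
    qed
    also have "\<dots> = ennreal (1 / real n) * (\<Sum>k=1..n. \<integral>\<^sup>+y. ennreal (exp (q * (blinfun_apply v (y (n + k)))\<^sup>2)) \<partial>P)"
    proof -
      have meas: "(\<lambda>y. ennreal (exp (q * (blinfun_apply v (y (n + k)))\<^sup>2))) \<in> borel_measurable P" for k
        by (intro measurable_compose[OF _ measurable_ennreal] measurable_P_continuous continuous_intros continuous_on_product_coordinates)
      show ?thesis
        by (simp only: nn_integral_cmult[OF borel_measurable_sum[OF meas]] nn_integral_sum[OF meas])
    qed
    also have "\<dots> \<le> ennreal (1 / real n) * (\<Sum>k=1..n. 2)"
    proof (intro mult_left_mono sum_mono)
      fix k
      have "(\<integral>\<^sup>+y. ennreal (exp (q * (blinfun_apply v (y (n + k)))\<^sup>2)) \<partial>P) = (\<integral>\<^sup>+z. ennreal (exp (q * (blinfun_apply v z)\<^sup>2)) \<partial>\<mu>)"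
        by (rule nn_integral_P_coord) measurable
      also have "\<dots> \<le> 2"
        using S by (intro functional_exp_square[OF cov_le_norm[OF v]]) (auto simp: q_def field_simps)
      finally show "(\<integral>\<^sup>+y. ennreal (exp (q * (blinfun_apply v (y (n + k)))\<^sup>2)) \<partial>P) \<le> 2" .
    qed simp
    also have "\<dots> = ennreal (1 / real n) * ennreal (real n * 2)"
      by (simp add: ennreal_of_nat_eq_real_of_nat ennreal_mult')
    also have "\<dots> = 2" using n by (simp flip: ennreal_mult')
    finally show ?thesis .
  qed
  have rmeas[measurable]: "r \<in> borel_measurable P"
    unfolding r_def by (intro measurable_P_continuous continuous_intros continuous_on_product_coordinates)
  have "(\<integral>\<^sup>+x. (\<integral>\<^sup>+y. K (x, y) \<partial>P) \<partial>P) = (\<integral>\<^sup>+y. (\<integral>\<^sup>+x. K (x, y) \<partial>P) \<partial>P)"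
    by (rule PP.Fubini[OF K, symmetric])
  also have "\<dots> \<le> (\<integral>\<^sup>+y. ennreal (1/2) * ennreal (exp ((r y)\<^sup>2 / (500 * real n * norm \<Sigma>))) + 1 \<partial>P)"
  proof (rule nn_integral_mono)
    fix y :: "nat \<Rightarrow> 'e"
    have "(\<integral>\<^sup>+x. K (x, y) \<partial>P) \<le> (\<integral>\<^sup>+z. ennreal (1/2) * ennreal (exp ((r y)\<^sup>2 / (500 * real n * norm \<Sigma>))) + ennreal (1/2) * ennreal (exp ((1 / (500 * m2)) * (norm z)\<^sup>2)) \<partial>\<mu>)"
      unfolding inner
    proof (rule nn_integral_mono)
      fix z :: 'e
      have "exp (16 * sqrt 2 * (l / real n) * r y * norm z) \<le> exp (((r y)\<^sup>2 / (500 * real n * norm \<Sigma>) + (norm z)\<^sup>2 / (500 * m2)) / 2)"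
        using am[OF r0[of y] norm_ge_zero[of z]] by simp
      also have "\<dots> \<le> (1/2) * exp ((r y)\<^sup>2 / (500 * real n * norm \<Sigma>)) + (1/2) * exp ((1 / (500 * m2)) * (norm z)\<^sup>2)"
        using half[of "(r y)\<^sup>2 / (500 * real n * norm \<Sigma>)" "(norm z)\<^sup>2 / (500 * m2)"] by (simp add: add_divide_distrib)
      finally have "ennreal (exp (16 * sqrt 2 * (l / real n) * r y * norm z)) \<le> ennreal ((1/2) * exp ((r y)\<^sup>2 / (500 * real n * norm \<Sigma>)) + (1/2) * exp ((1 / (500 * m2)) * (norm z)\<^sup>2))"
        by (rule ennreal_leI)
      then show "ennreal (exp (16 * sqrt 2 * (l / real n) * r y * norm z)) \<le> ennreal (1/2) * ennreal (exp ((r y)\<^sup>2 / (500 * real n * norm \<Sigma>))) + ennreal (1/2) * ennreal (exp ((1 / (500 * m2)) * (norm z)\<^sup>2))"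
        by (simp only: ennreal_plus[symmetric] ennreal_mult'[symmetric] exp_ge_zero mult_nonneg_nonneg zero_le_divide_1_iff zero_le_numeral)
    qed
    also have "\<dots> = ennreal (1/2) * ennreal (exp ((r y)\<^sup>2 / (500 * real n * norm \<Sigma>))) + ennreal (1/2) * (\<integral>\<^sup>+z. ennreal (exp ((1 / (500 * m2)) * (norm z)\<^sup>2)) \<partial>\<mu>)"
      by (subst nn_integral_add, measurable, subst nn_integral_cmult, measurable) (simp add: emeasure_space_1[unfolded space_eq])
    also have "\<dots> \<le> ennreal (1/2) * ennreal (exp ((r y)\<^sup>2 / (500 * real n * norm \<Sigma>))) + ennreal (1/2) * 2"
      using norm_exp_square[OF m order_refl] by (intro add_left_mono mult_left_mono) auto
    also have "ennreal (1/2) * 2 = 1"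
      using ennreal_mult'[of "1/2" 2] by simp
    finally show "(\<integral>\<^sup>+x. K (x, y) \<partial>P) \<le> ennreal (1/2) * ennreal (exp ((r y)\<^sup>2 / (500 * real n * norm \<Sigma>))) + 1" .
  qed
  also have "\<dots> = ennreal (1/2) * (\<integral>\<^sup>+y. ennreal (exp ((r y)\<^sup>2 / (500 * real n * norm \<Sigma>))) \<partial>P) + 1"
    by (subst nn_integral_add, measurable, subst nn_integral_cmult, measurable) (simp add: P.emeasure_space_1[unfolded space_P])
  also have "\<dots> \<le> ennreal (1/2) * 2 + 1"
    using ndiv by (intro add_right_mono mult_left_mono) auto
  also have "ennreal (1/2) * 2 + 1 = 2"
    using ennreal_mult'[of "1/2" 2] by simp
  finally show ?thesis by (simp add: K_def)
qed

text \<open>A crude bound, exponential in n. Its only purpose is to allow the unknown moment to be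
  subtracted from both sides in the next theorem.\<close>

lemma emp_cov_exp_finite:
  assumes n: "1 \<le> n" and S: "0 < norm \<Sigma>" and l: "l = 1 / (12000 * rate n)"
  shows "(\<integral>\<^sup>+x. ennreal (exp (l * norm (emp_cov n x - \<Sigma>))) \<partial>P) < \<infinity>"
proof -
  note m = rate_pos(1)[OF n S] and R = rate_pos(2)[OF n S]
  have l0: "0 < l" using R by (simp add: l)
  have "(\<integral>\<^sup>+x. ennreal (exp (l * norm (emp_cov n x - \<Sigma>))) \<partial>P)
    \<le> (\<integral>\<^sup>+x. ennreal (exp (l * norm \<Sigma>)) * (\<Prod>k=1..n. ennreal (exp ((l / real n) * (norm (x k))\<^sup>2))) \<partial>P)"
  proof (rule nn_integral_mono)
    fix x :: "nat \<Rightarrow> 'e"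
    have "norm (emp_cov n x - \<Sigma>) \<le> norm \<Sigma> + (1 / real n) * (\<Sum>k=1..n. (norm (x k))\<^sup>2)"
      using norm_triangle_ineq4[of "emp_cov n x" \<Sigma>] norm_emp_cov_le[of n x] by linarith
    then have "l * norm (emp_cov n x - \<Sigma>) \<le> l * (norm \<Sigma> + (1 / real n) * (\<Sum>k=1..n. (norm (x k))\<^sup>2))"
      using l0 by (intro mult_left_mono) auto
    also have "\<dots> = l * norm \<Sigma> + (\<Sum>k=1..n. (l / real n) * (norm (x k))\<^sup>2)"
      by (simp add: algebra_simps sum_distrib_left sum_divide_distrib)
    finally have "exp (l * norm (emp_cov n x - \<Sigma>)) \<le> exp (l * norm \<Sigma>) * (\<Prod>k=1..n. exp ((l / real n) * (norm (x k))\<^sup>2))"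
      by (simp flip: exp_sum exp_add)
    then have "ennreal (exp (l * norm (emp_cov n x - \<Sigma>))) \<le> ennreal (exp (l * norm \<Sigma>) * (\<Prod>k=1..n. exp ((l / real n) * (norm (x k))\<^sup>2)))"
      by (rule ennreal_leI)
    then show "ennreal (exp (l * norm (emp_cov n x - \<Sigma>))) \<le> ennreal (exp (l * norm \<Sigma>)) * (\<Prod>k=1..n. ennreal (exp ((l / real n) * (norm (x k))\<^sup>2)))"
      by (simp add: ennreal_mult' prod_ennreal)
  qed
  also have "\<dots> = ennreal (exp (l * norm \<Sigma>)) * (\<integral>\<^sup>+x. (\<Prod>k=1..n. ennreal (exp ((l / real n) * (norm (x k))\<^sup>2))) \<partial>P)"
    by (rule nn_integral_cmult)
      (intro borel_measurable_prod_ennreal measurable_compose[OF _ measurable_ennreal] measurable_P_continuous continuous_intros continuous_on_product_coordinates)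
  also have "(\<integral>\<^sup>+x. (\<Prod>k=1..n. ennreal (exp ((l / real n) * (norm (x k))\<^sup>2))) \<partial>P) = (\<Prod>k=1..n. \<integral>\<^sup>+z. ennreal (exp ((l / real n) * (norm z)\<^sup>2)) \<partial>\<mu>)"
    by (rule nn_integral_P_prod) auto
  also have "\<dots> \<le> (\<Prod>k=1..n. 2)"
  proof (intro prod_mono_ennreal)
    have "l / real n = 1 / (12000 * (real n * rate n))" by (simp add: l)
    also have "\<dots> \<le> 1 / (500 * m2)"
      using rate_bounds(1)[OF n S] m n R by (intro divide_left_mono mult_mono) auto
    finally show "(\<integral>\<^sup>+z. ennreal (exp ((l / real n) * (norm z)\<^sup>2)) \<partial>\<mu>) \<le> 2"
      by (rule norm_exp_square[OF m])
  qed
  also have "ennreal (exp (l * norm \<Sigma>)) * (\<Prod>k=1..n. 2) < \<infinity>"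
    by (simp add: ennreal_mult_less_top power_less_top_ennreal)
  finally show ?thesis by (simp add: mult_left_mono)
qed

text \<open>Decoupling and Chevet give \<open>\<Phi> \<le> \<Phi> / 2 + 9 / 2\<close>. The norm of
  the empirical covariance is at most the deviation plus \<open>norm \<Sigma>\<close>; a small
  \<theta> makes the share of \<open>norm \<Sigma>\<close> harmless but enlarges the coefficient B
  of the squared norm of \<open>y 0\<close>, and the balanced \<theta> meets both
  constraints.\<close>

theorem emp_cov_exp_moment:
  assumes n: "1 \<le> n" and S: "0 < norm \<Sigma>" and l: "l = 1 / (12000 * rate n)"
  shows "(\<integral>\<^sup>+x. ennreal (exp (l * norm (emp_cov n x - \<Sigma>))) \<partial>P) \<le> 9"
proof -
  note m = rate_pos(1)[OF n S] and R = rate_pos(2)[OF n S]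
  have l0: "0 < l" using R by (simp add: l)
  obtain \<theta> where \<theta>: "0 < \<theta>" "\<theta> \<le> 1" "\<theta> * norm \<Sigma> \<le> rate n" "m2 \<le> \<theta> * (real n * rate n)"
    using balance_exists[OF n S] by blast
  obtain v where v: "norm v \<le> 1" "norm \<Sigma> \<le> 4 * cov v v"
    using almost_extremal_functional_exists by blast
  define \<Phi> where "\<Phi> = (\<integral>\<^sup>+x. ennreal (exp (l * norm (emp_cov n x - \<Sigma>))) \<partial>P)"
  define D where "D x = norm (emp_cov n x - \<Sigma>)" for x
  have Dm[measurable]: "D \<in> borel_measurable P"
    unfolding D_def by (intro measurable_P_continuous continuous_on_norm continuous_on_diff continuous_emp_cov continuous_on_const)
  define a where "a = 2 * l / real n"
  have a0: "0 < a" using l0 n by (simp add: a_def)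
  define T where "T x y = norm (\<Sum>k=1..n. blinfun_apply v (y (n + k)) *\<^sub>R (a *\<^sub>R x k))" for x y :: "nat \<Rightarrow> 'e"
  define B where "B = 4 * l / (\<theta> * real n)"
  define E1 where "E1 y = ennreal (exp (4 * B * (norm (y 0))\<^sup>2))" for y :: "nat \<Rightarrow> 'e"
  define E2 where "E2 x y = ennreal (exp (8 * sqrt 2 * T x y))" for x y :: "nat \<Rightarrow> 'e"
  \<comment> \<open>With 9/8 the remaining terms add up to
    \<open>9/8 * (2 + 2) = 9/2\<close>.\<close>
  have hsmall: "exp (l * \<theta> * norm \<Sigma>) \<le> 9 / 8"
  proof -
    have "l * (\<theta> * norm \<Sigma>) \<le> l * rate n" using \<theta>(3) l0 by (intro mult_left_mono) auto
    also have "\<dots> = 1 / 12000" using R by (simp add: l)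
    finally have "exp (l * \<theta> * norm \<Sigma>) \<le> exp (1 / 12000)" by (simp add: mult.assoc)
    also have "\<dots> \<le> 9 / 8"
    proof -
      have "norm (exp (1 / 12000 :: real)) \<le> 1 + 2 * norm (1 / 12000 :: real)" by (intro exp_bound_lemma) auto
      then show ?thesis by simp
    qed
    finally show ?thesis .
  qed
  have ptw: "ennreal (exp (sqrt 2 * (a * sqrt (real n * norm (emp_cov n x)) * norm (y 0) + 2 * T x y)))
    \<le> ennreal (1/4) * ennreal (exp (l * D x)) + ennreal (9/16) * (E1 y + E2 x y)" for x y
  proof -
    define q where "q = norm (emp_cov n x)"
    have q: "0 \<le> q" "q \<le> D x + norm \<Sigma>"
      using norm_triangle_sub[of "emp_cov n x" \<Sigma>] by (auto simp: q_def D_def)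
    define N where "N = norm (y 0)"
    \<comment> \<open>The constants \<open>c1\<close> and \<open>c2\<close> make twice their product
      equal to the coefficient on the left; \<open>l * \<theta> / 2\<close> leaves room for the
      squaring of exponentials that follows.\<close>
    have am: "sqrt 2 * (a * sqrt (real n * q) * N) \<le> l * \<theta> / 2 * q + B * N\<^sup>2"
    proof -
      define c1 where "c1 = sqrt (l * \<theta> / 2)"
      define c2 where "c2 = sqrt B"
      have B0: "0 < B" using l0 \<theta> n by (simp add: B_def)
      have c: "c1\<^sup>2 = l * \<theta> / 2" "c2\<^sup>2 = B" using l0 \<theta> B0 by (auto simp: c1_def c2_def)
      have prod: "2 * (c1 * c2) = sqrt 2 * (a * sqrt (real n))"
      proof -
        have "c1 * c2 = sqrt (l * \<theta> / 2 * B)" by (simp only: c1_def c2_def real_sqrt_mult)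
        also have "l * \<theta> / 2 * B = 2 * l\<^sup>2 / real n" using \<theta> by (simp add: B_def power2_eq_square)
        also have "\<dots> = (sqrt 2 * (a * sqrt (real n)) / 2)\<^sup>2"
          using n by (simp add: a_def power_mult_distrib power_divide power2_eq_square[of "real n"] power2_eq_square[of l])
        also have "sqrt \<dots> = sqrt 2 * (a * sqrt (real n)) / 2" using a0 by simp
        finally show ?thesis by simp
      qed
      have "sqrt 2 * (a * sqrt (real n * q) * N) = 2 * (c1 * sqrt q) * (c2 * N)"
        using prod by (simp add: real_sqrt_mult)
      also have "\<dots> \<le> (c1 * sqrt q)\<^sup>2 + (c2 * N)\<^sup>2" by (rule sum_squares_bound)
      also have "\<dots> = l * \<theta> / 2 * q + B * N\<^sup>2" using q by (simp add: power_mult_distrib c)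
      finally show ?thesis .
    qed
    have "l * \<theta> / 2 * q \<le> l * \<theta> / 2 * (D x + norm \<Sigma>)" using q l0 \<theta> by (intro mult_left_mono) auto
    also have "\<dots> \<le> l * D x / 2 + l * \<theta> * norm \<Sigma> / 2"
    proof -
      have "l * D x * \<theta> \<le> l * D x * 1" using \<theta> l0 by (intro mult_left_mono) (auto simp: D_def)
      then show ?thesis by (simp add: algebra_simps)
    qed
    finally have "sqrt 2 * (a * sqrt (real n * q) * N + 2 * T x y)
      \<le> l * D x / 2 + (l * \<theta> * norm \<Sigma> / 2 + (B * N\<^sup>2 + 2 * sqrt 2 * T x y))"
      using am by (simp add: algebra_simps)
    then have "exp (sqrt 2 * (a * sqrt (real n * q) * N + 2 * T x y))
      \<le> exp (l * D x / 2) * exp (l * \<theta> * norm \<Sigma> / 2 + (B * N\<^sup>2 + 2 * sqrt 2 * T x y))"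
      by (simp flip: exp_add)
    \<comment> \<open>Halving one factor before squaring produces the coefficient 1/4, which becomes
      1/2 after the factor 2 of Chevet's bound and can then be absorbed.\<close>
    also have "\<dots> \<le> (exp (l * D x / 2) / 2)\<^sup>2 + (exp (l * \<theta> * norm \<Sigma> / 2 + (B * N\<^sup>2 + 2 * sqrt 2 * T x y)))\<^sup>2"
      using sum_squares_bound[of "exp (l * D x / 2) / 2" "exp (l * \<theta> * norm \<Sigma> / 2 + (B * N\<^sup>2 + 2 * sqrt 2 * T x y))"] by simp
    also have "\<dots> = (1/4) * exp (l * D x) + exp (l * \<theta> * norm \<Sigma>) * (exp (2 * (B * N\<^sup>2)) * exp (4 * sqrt 2 * T x y))"
      by (simp add: power_divide flip: exp_double exp_add)
    also have "\<dots> \<le> (1/4) * exp (l * D x) + (9/8) * ((exp (4 * B * N\<^sup>2) + exp (8 * sqrt 2 * T x y)) / 2)"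
    proof -
      have "2 * exp (2 * (B * N\<^sup>2)) * exp (4 * sqrt 2 * T x y) \<le> (exp (2 * (B * N\<^sup>2)))\<^sup>2 + (exp (4 * sqrt 2 * T x y))\<^sup>2"
        by (rule sum_squares_bound)
      then have "exp (2 * (B * N\<^sup>2)) * exp (4 * sqrt 2 * T x y) \<le> (exp (4 * B * N\<^sup>2) + exp (8 * sqrt 2 * T x y)) / 2"
        by (simp flip: exp_double) (simp add: mult_ac)
      then have "exp (l * \<theta> * norm \<Sigma>) * (exp (2 * (B * N\<^sup>2)) * exp (4 * sqrt 2 * T x y)) \<le> (9/8) * ((exp (4 * B * N\<^sup>2) + exp (8 * sqrt 2 * T x y)) / 2)"
        using hsmall by (intro mult_mono) auto
      then show ?thesis by simp
    qed
    also have "\<dots> = (1/4) * exp (l * D x) + (9/16) * (exp (4 * B * N\<^sup>2) + exp (8 * sqrt 2 * T x y))" by simp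
    finally have "ennreal (exp (sqrt 2 * (a * sqrt (real n * q) * N + 2 * T x y))) \<le> ennreal ((1/4) * exp (l * D x) + (9/16) * (exp (4 * B * N\<^sup>2) + exp (8 * sqrt 2 * T x y)))"
      by (rule ennreal_leI)
    also have "\<dots> = ennreal (1/4) * ennreal (exp (l * D x)) + ennreal (9/16) * (E1 y + E2 x y)"
      unfolding E1_def E2_def N_def by (rule ennreal_lincomb) auto
    finally show ?thesis by (simp add: q_def N_def)
  qed
  have E1m[measurable]: "E1 \<in> borel_measurable P"
    unfolding E1_def by (intro measurable_compose[OF _ measurable_ennreal] measurable_P_continuous continuous_intros continuous_on_product_coordinates)
  have E2m: "(\<lambda>z. E2 (fst z) (snd z)) \<in> borel_measurable (P \<Otimes>\<^sub>M P)"
    unfolding E2_def T_def by (intro measurable_compose[OF _ measurable_ennreal] measurable_PP_continuous continuous_intros continuous_on_coord)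
  have E2y[measurable]: "E2 x \<in> borel_measurable P" for x
    unfolding E2_def T_def by (intro measurable_compose[OF _ measurable_ennreal] measurable_P_continuous continuous_intros continuous_on_product_coordinates)
  have E2x[measurable]: "(\<lambda>x. \<integral>\<^sup>+y. E2 x y \<partial>P) \<in> borel_measurable P"
    using P.borel_measurable_nn_integral_fst[OF E2m] by simp
  have I1: "(\<integral>\<^sup>+y. E1 y \<partial>P) \<le> 2"
  proof -
    have "(\<integral>\<^sup>+y. E1 y \<partial>P) = (\<integral>\<^sup>+z. ennreal (exp (4 * B * (norm z)\<^sup>2)) \<partial>\<mu>)"
      unfolding E1_def by (rule nn_integral_P_coord) measurable
    also have "\<dots> \<le> 2"
    proof (rule norm_exp_square[OF m])
      have "4 * B = 16 / (12000 * (\<theta> * (real n * rate n)))" by (simp add: B_def l)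
      also have "\<dots> \<le> 16 / (12000 * m2)"
        using \<theta> m n R by (intro divide_left_mono mult_left_mono) auto
      also have "\<dots> \<le> 1 / (500 * m2)" using m by (simp add: field_simps)
      finally show "4 * B \<le> 1 / (500 * m2)" .
    qed
    finally show ?thesis .
  qed
  have I2: "(\<integral>\<^sup>+x. (\<integral>\<^sup>+y. E2 x y \<partial>P) \<partial>P) \<le> 2"
    using mixed_exp_le[OF n S v(1) l] by (simp add: E2_def T_def a_def)
  have "\<Phi> \<le> (\<integral>\<^sup>+x. (\<integral>\<^sup>+y. ennreal (exp (norm (tens_sum n (\<lambda>k. a *\<^sub>R x k) y))) \<partial>P) \<partial>P)"
    unfolding \<Phi>_def a_def by (rule decoupling[OF n l0])
  also have "\<dots> \<le> (\<integral>\<^sup>+x. ennreal (1/2) * ennreal (exp (l * D x)) + ennreal (9/8) * (2 + (\<integral>\<^sup>+y. E2 x y \<partial>P)) \<partial>P)"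
  proof (rule nn_integral_mono)
    fix x :: "nat \<Rightarrow> 'e"
    have "(\<integral>\<^sup>+y. ennreal (exp (norm (tens_sum n (\<lambda>k. a *\<^sub>R x k) y))) \<partial>P)
      \<le> 2 * (\<integral>\<^sup>+y. ennreal (exp (sqrt 2 * (a * sqrt (real n * norm (emp_cov n x)) * norm (y 0) + 2 * T x y))) \<partial>P)"
      unfolding T_def
    proof (rule Chevet_exp)
      show "0 \<le> a * sqrt (real n * norm (emp_cov n x))" using a0 by simp
      show "norm \<Sigma> \<le> 4 * cov v v" by fact
      fix u :: "'e \<Rightarrow>\<^sub>L real" assume u: "norm u \<le> 1"
      have "(\<Sum>k=1..n. (blinfun_apply u (a *\<^sub>R x k))\<^sup>2) = a\<^sup>2 * (\<Sum>k=1..n. (blinfun_apply u (x k))\<^sup>2)"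
        by (simp add: blinfun.scaleR_right power_mult_distrib sum_distrib_left)
      also have "\<dots> \<le> a\<^sup>2 * (real n * norm (emp_cov n x))"
        using emp_cov_quadratic[OF u n] by (intro mult_left_mono) auto
      also have "\<dots> = (a * sqrt (real n * norm (emp_cov n x)))\<^sup>2" by (simp add: power_mult_distrib)
      finally show "(\<Sum>k=1..n. (blinfun_apply u (a *\<^sub>R x k))\<^sup>2) \<le> (a * sqrt (real n * norm (emp_cov n x)))\<^sup>2" .
    qed
    also have "\<dots> \<le> 2 * (\<integral>\<^sup>+y. ennreal (1/4) * ennreal (exp (l * D x)) + ennreal (9/16) * (E1 y + E2 x y) \<partial>P)"
      by (intro mult_left_mono nn_integral_mono ptw) simp
    also have "(\<integral>\<^sup>+y. ennreal (1/4) * ennreal (exp (l * D x)) + ennreal (9/16) * (E1 y + E2 x y) \<partial>P)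
      = ennreal (1/4) * ennreal (exp (l * D x)) + ennreal (9/16) * ((\<integral>\<^sup>+y. E1 y \<partial>P) + (\<integral>\<^sup>+y. E2 x y \<partial>P))"
      by (subst nn_integral_add, measurable, subst nn_integral_cmult, measurable, subst nn_integral_add, measurable)
        (simp add: P.emeasure_space_1[unfolded space_P])
    also have "2 * \<dots> \<le> 2 * (ennreal (1/4) * ennreal (exp (l * D x)) + ennreal (9/16) * (2 + (\<integral>\<^sup>+y. E2 x y \<partial>P)))"
      using I1 by (intro mult_left_mono add_left_mono add_right_mono) auto
    also have "\<dots> = (2 * ennreal (1/4)) * ennreal (exp (l * D x)) + (2 * ennreal (9/16)) * (2 + (\<integral>\<^sup>+y. E2 x y \<partial>P))"
      by (simp add: distrib_left mult.assoc)
    also have "2 * ennreal (1/4) = ennreal (1/2)" using ennreal_mult'[of 2 "1/4"] by simp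
    also have "2 * ennreal (9/16) = ennreal (9/8)" using ennreal_mult'[of 2 "9/16"] by simp
    finally show "(\<integral>\<^sup>+y. ennreal (exp (norm (tens_sum n (\<lambda>k. a *\<^sub>R x k) y))) \<partial>P)
      \<le> ennreal (1/2) * ennreal (exp (l * D x)) + ennreal (9/8) * (2 + (\<integral>\<^sup>+y. E2 x y \<partial>P))" .
  qed
  also have "\<dots> = ennreal (1/2) * \<Phi> + ennreal (9/8) * (2 + (\<integral>\<^sup>+x. (\<integral>\<^sup>+y. E2 x y \<partial>P) \<partial>P))"
    unfolding \<Phi>_def D_def[symmetric]
    by (subst nn_integral_add, measurable, subst nn_integral_cmult, measurable, subst nn_integral_cmult, measurable, subst nn_integral_add, measurable)
      (simp add: P.emeasure_space_1[unfolded space_P])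
  also have "\<dots> \<le> ennreal (1/2) * \<Phi> + ennreal (9/8) * (2 + 2)"
    using I2 by (intro add_left_mono mult_left_mono) auto
  also have "ennreal (9/8) * (2 + 2) = ennreal (9/2)"
    using ennreal_mult'[of 4 "9/8"] by (simp add: mult.commute)
  finally have le: "\<Phi> \<le> ennreal (1/2) * \<Phi> + ennreal (9/2)" .
  \<comment> \<open>Only finiteness permits solving the inequality for the moment.\<close>
  have fin: "\<Phi> < \<infinity>" unfolding \<Phi>_def by (rule emp_cov_exp_finite[OF n S l])
  then obtain \<phi> where \<phi>: "0 \<le> \<phi>" "\<Phi> = ennreal \<phi>" by (cases \<Phi>) auto
  have "ennreal \<phi> \<le> ennreal (1/2 * \<phi> + 9/2)"
  proof -
    have "ennreal (1/2 * \<phi> + 9/2) = ennreal (1/2) * ennreal \<phi> + ennreal (9/2)"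
      using \<phi>(1) by (intro ennreal_affine) auto
    then show ?thesis using le unfolding \<phi>(2) by (simp only:)
  qed
  then have "\<phi> \<le> 1/2 * \<phi> + 9/2" using \<phi> by (subst (asm) ennreal_le_iff) auto
  then have "\<Phi> \<le> ennreal 9" unfolding \<phi>(2) by (intro ennreal_leI) simp
  then show ?thesis by (simp add: \<Phi>_def)
qed

end

section \<open>Bias and fluctuation of smooth functionals\<close>

lemma norm_derivative_le_Lipschitz:
  fixes f :: "'a::real_normed_vector \<Rightarrow> real"
  assumes deriv: "(f has_derivative blinfun_apply f') (at A)"
    and lip: "\<And>x y. \<bar>f x - f y\<bar> \<le> L * norm (x - y)" and L: "0 \<le> L"
  shows "norm f' \<le> L"
proof (rule norm_blinfun_bound[OF L])
  fix h
  have path: "((\<lambda>t::real. A + t *\<^sub>R h) has_vector_derivative h) (at 0 within UNIV)"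
    by (auto intro!: derivative_eq_intros)
  have "(f has_derivative blinfun_apply f') (at (A + 0 *\<^sub>R h) within range (\<lambda>t::real. A + t *\<^sub>R h))"
    using deriv by (simp add: has_derivative_at_withinI)
  from vector_derivative_diff_chain_within[OF path this]
  have "((\<lambda>t. f (A + t *\<^sub>R h)) has_real_derivative blinfun_apply f' h) (at 0)"
    by (simp add: has_real_derivative_iff_has_vector_derivative comp_def)
  then have "((\<lambda>t. (f (A + t *\<^sub>R h) - f A) / t) \<longlongrightarrow> blinfun_apply f' h) (at 0)"
    by (simp add: DERIV_def)
  then have "((\<lambda>t. norm ((f (A + t *\<^sub>R h) - f A) / t)) \<longlongrightarrow> norm (blinfun_apply f' h)) (at 0)"
    by (rule tendsto_norm)
  moreover have "norm ((f (A + t *\<^sub>R h) - f A) / t) \<le> L * norm h" if "t \<noteq> 0" for t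
    using lip[of "A + t *\<^sub>R h" A] that by (simp add: divide_le_eq mult_ac)
  then have "\<forall>\<^sub>F t in at 0. norm ((f (A + t *\<^sub>R h) - f A) / t) \<le> L * norm h"
    by (simp add: eventually_at_filter)
  ultimately show "norm (blinfun_apply f' h) \<le> L * norm h"
    by (rule tendsto_upperbound) simp
qed

text \<open>The mean value inequality for f minus its linearization at a: on the segment every point
  is within \<open>norm (b - a)\<close> of a, so one Hoelder bound on the derivative holds
  throughout.\<close>

lemma Taylor_Holder:
  fixes f :: "'a::real_normed_vector \<Rightarrow> real"
  assumes deriv: "\<And>A. (f has_derivative blinfun_apply (f' A)) (at A)"
    and holder: "\<And>x y. norm (f' x - f' y) \<le> H * norm (x - y) powr \<rho>" and H: "0 \<le> H" and \<rho>: "0 < \<rho>"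
  shows "\<bar>f b - f a - blinfun_apply (f' a) (b - a)\<bar> \<le> H * norm (b - a) powr (1 + \<rho>)"
proof -
  define S where "S = (\<lambda>t. a + t *\<^sub>R (b - a)) ` {0..1::real}"
  have aS: "a \<in> S" unfolding S_def by (rule image_eqI[of _ _ 0]) auto
  have "norm (f b - f a - blinfun_apply (f' a) (b - a)) \<le> norm (b - a) * (H * norm (b - a) powr \<rho>)"
  proof (rule differentiable_bound_linearization[where S = S])
    show "a + t *\<^sub>R (b - a) \<in> S" if "t \<in> {0..1}" for t using that by (auto simp: S_def)
    show "(f has_derivative blinfun_apply (f' x)) (at x within S)" for x
      using deriv by (rule has_derivative_at_withinI)
    show "onorm (blinfun_apply (f' x) - blinfun_apply (f' a)) \<le> H * norm (b - a) powr \<rho>" if "x \<in> S" for x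
    proof -
      obtain t where t: "0 \<le> t" "t \<le> 1" "x = a + t *\<^sub>R (b - a)" using \<open>x \<in> S\<close> by (auto simp: S_def)
      have "norm (x - a) \<le> norm (b - a)" using t by (simp add: mult_left_le_one_le)
      then have "H * norm (x - a) powr \<rho> \<le> H * norm (b - a) powr \<rho>"
        using H \<rho> by (intro mult_left_mono powr_mono2) auto
      moreover have "onorm (blinfun_apply (f' x) - blinfun_apply (f' a)) = norm (f' x - f' a)"
        by (simp add: norm_blinfun.rep_eq fun_diff_def minus_blinfun.rep_eq)
      ultimately show ?thesis using holder[of x a] by simp
    qed
  qed (rule aS)
  also have "\<dots> = H * (norm (b - a) * norm (b - a) powr \<rho>)" by simp
  also have "norm (b - a) * norm (b - a) powr \<rho> = norm (b - a) powr (1 + \<rho>)"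
    by (simp add: powr_add powr_one_gt_zero_iff)
  finally show ?thesis by simp
qed

lemma emp_cov_cong: "(\<And>k. k \<in> {1..n} \<Longrightarrow> x k = y k) \<Longrightarrow> emp_cov n x = emp_cov n y"
  unfolding emp_cov_def tens_sum_def by (intro arg_cong2[where f = scaleR] refl sum.cong) auto

section \<open>Transfer to the product space, moments of the deviation, bias and velocity\<close>

context gaussian
begin

lemma measurable_emp_cov_continuous:
  fixes h :: "'e dual_op \<Rightarrow> 'b::topological_space"
  assumes "continuous_on UNIV h"
  shows "(\<lambda>x. h (emp_cov n x)) \<in> borel_measurable P"
  by (intro measurable_P_continuous continuous_on_compose2[OF assms continuous_emp_cov]) auto

lemma emp_cov_dist_measurable[measurable]: "(\<lambda>x. norm (emp_cov n x - \<Sigma>)) \<in> borel_measurable P"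
  by (intro measurable_emp_cov_continuous continuous_intros)

text \<open>Independence and equal laws say that the sample has the law of the coordinates 1 to n
  under \<open>P\<close>. Measurability of k is requested only after composition with
  \<open>emp_cov n\<close>, where continuity on the separable sequence space delivers it.\<close>

lemma sample_cov_transfer:
  assumes M: "prob_space M" and n: "1 \<le> n" and iid: "iid_sample M n X \<mu>"
    and k: "(\<lambda>x. k (emp_cov n x)) \<in> borel_measurable P"
  shows "(\<integral>\<^sup>+\<omega>. k (sample_cov n X \<omega>) \<partial>M) = (\<integral>\<^sup>+x. (k (emp_cov n x) :: ennreal) \<partial>P)"
proof -
  interpret M: prob_space M by fact
  define J where "J = {1..n}"
  have J: "finite J" "J \<noteq> {}" using n by (auto simp: J_def)
  have indep: "M.indep_vars (\<lambda>_. borel) X J" and law: "\<And>j. j \<in> J \<Longrightarrow> distr M borel (X j) = \<mu>"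
    using iid by (auto simp: iid_sample_def J_def)
  have rv: "X j \<in> borel_measurable M" if "j \<in> J" for j
    using indep that unfolding M.indep_vars_def by auto
  \<comment> \<open>A finite family becomes a sequence by filling with 0; \<open>emp_cov n\<close>
    ignores the added coordinates.\<close>
  define e where "e x k = (if k \<in> J then x k else 0)" for x :: "nat \<Rightarrow> 'e" and k
  have e_eq: "emp_cov n (e x) = emp_cov n x" "emp_cov n (e (restrict x J)) = emp_cov n x" for x
    by (rule emp_cov_cong; simp add: e_def J_def)+
  have e_meas: "e \<in> measurable (PiM J (\<lambda>_. borel)) P"
  proof -
    have "(\<lambda>x. e x k) \<in> borel_measurable (PiM J (\<lambda>_. borel))" for k
      by (cases "k \<in> J") (simp_all add: e_def)
    then have "(\<lambda>x. e x k) \<in> measurable (PiM J (\<lambda>_. borel)) \<mu>" for k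
      by (simp add: measurable_cong_sets[OF refl sets_eq])
    then show ?thesis unfolding P_def by (intro measurable_PiM_single') auto
  qed
  have g_meas: "(\<lambda>x. k (emp_cov n (e x))) \<in> borel_measurable (PiM J (\<lambda>_. borel))"
    by (rule measurable_compose[OF e_meas k])
  have setsJ: "sets (PiM J (\<lambda>_. \<mu>)) = sets (PiM J (\<lambda>_. borel))"
    by (intro sets_PiM_cong) auto
  have Xmeas: "(\<lambda>\<omega>. \<lambda>i\<in>J. X i \<omega>) \<in> measurable M (PiM J (\<lambda>_. borel))"
    by (intro measurable_restrict rv)
  have "(\<integral>\<^sup>+\<omega>. k (sample_cov n X \<omega>) \<partial>M) = (\<integral>\<^sup>+\<omega>. k (emp_cov n (e (\<lambda>i\<in>J. X i \<omega>))) \<partial>M)"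
  proof -
    have "emp_cov n (e (\<lambda>i\<in>J. X i \<omega>)) = emp_cov n (\<lambda>j. X j \<omega>)" for \<omega>
      by (rule emp_cov_cong) (simp add: e_def J_def)
    then show ?thesis by (simp only: sample_cov_eq_emp_cov)
  qed
  also have "\<dots> = (\<integral>\<^sup>+x. k (emp_cov n (e x)) \<partial>distr M (PiM J (\<lambda>_. borel)) (\<lambda>\<omega>. \<lambda>i\<in>J. X i \<omega>))"
    using g_meas by (subst nn_integral_distr[OF Xmeas]) simp_all
  also have "distr M (PiM J (\<lambda>_. borel)) (\<lambda>\<omega>. \<lambda>i\<in>J. X i \<omega>) = PiM J (\<lambda>i. distr M borel (X i))"
    using M.indep_vars_iff_distr_eq_PiM'[where I = J and X = X and M' = "\<lambda>_. borel"] J(2) rv indep by simp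
  also have "\<dots> = PiM J (\<lambda>_. \<mu>)" by (intro PiM_cong law refl)
  also have "\<dots> = distr P (PiM J (\<lambda>_. \<mu>)) (\<lambda>x. restrict x J)" by (rule distr_P_restrict[OF J(1), symmetric])
  also have "(\<integral>\<^sup>+x. k (emp_cov n (e x)) \<partial>\<dots>) = (\<integral>\<^sup>+x. k (emp_cov n (e (restrict x J))) \<partial>P)"
    using g_meas
    by (subst nn_integral_distr[OF restrict_measurable_P]) (simp_all add: measurable_cong_sets[OF setsJ refl])
  finally show ?thesis by (simp only: e_eq(2))
qed

lemma emp_cov_moment:
  assumes n: "1 \<le> n" and S: "0 < norm \<Sigma>" and q: "0 < q"
  shows "(\<integral>\<^sup>+x. ennreal (norm (emp_cov n x - \<Sigma>) powr q) \<partial>P) \<le> ennreal (9 * (12000 * q * rate n) powr q)"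
proof -
  note R = rate_pos(2)[OF n S]
  define l where "l = 1 / (12000 * rate n)"
  have l: "0 < l" using R by (simp add: l_def)
  have "(\<integral>\<^sup>+x. ennreal (norm (emp_cov n x - \<Sigma>) powr q) \<partial>P)
    \<le> (\<integral>\<^sup>+x. ennreal ((12000 * q * rate n) powr q) * ennreal (exp (l * norm (emp_cov n x - \<Sigma>))) \<partial>P)"
  proof (intro nn_integral_mono)
    fix x
    define D where "D = norm (emp_cov n x - \<Sigma>)"
    have D: "0 \<le> D" by (simp add: D_def)
    have "D powr q = (12000 * rate n) powr q * (l * D) powr q"
      using R D by (simp add: l_def flip: powr_mult)
    also have "\<dots> \<le> (12000 * rate n) powr q * (q powr q * exp (l * D))"
      using l D q by (intro mult_left_mono powr_le_exp) auto
    also have "\<dots> = (12000 * q * rate n) powr q * exp (l * D)"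
      using R q by (simp add: powr_mult mult_ac)
    finally show "ennreal (D powr q) \<le> ennreal ((12000 * q * rate n) powr q) * ennreal (exp (l * D))"
      by (simp add: ennreal_leI flip: ennreal_mult')
  qed
  also have "\<dots> = ennreal ((12000 * q * rate n) powr q) * (\<integral>\<^sup>+x. ennreal (exp (l * norm (emp_cov n x - \<Sigma>))) \<partial>P)"
    by (intro nn_integral_cmult) measurable
  also have "\<dots> \<le> ennreal ((12000 * q * rate n) powr q) * ennreal 9"
    using emp_cov_exp_moment[OF n S l_def] by (intro mult_left_mono) auto
  also have "\<dots> = ennreal (9 * (12000 * q * rate n) powr q)"
    by (subst ennreal_mult'[symmetric]) (auto simp: mult.commute)
  finally show ?thesis .
qed

lemma emp_cov_dist_integrable:
  assumes n: "1 \<le> n" and S: "0 < norm \<Sigma>" and q: "0 < q"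
  shows "integrable P (\<lambda>x. norm (emp_cov n x - \<Sigma>) powr q)"
    "(\<integral>x. norm (emp_cov n x - \<Sigma>) powr q \<partial>P) \<le> 9 * (12000 * q * rate n) powr q"
proof -
  note le = emp_cov_moment[OF n S q]
  show int: "integrable P (\<lambda>x. norm (emp_cov n x - \<Sigma>) powr q)"
    by (rule integrableI_nonneg) (use le_less_trans[OF le] in auto)
  have "ennreal (\<integral>x. norm (emp_cov n x - \<Sigma>) powr q \<partial>P) \<le> ennreal (9 * (12000 * q * rate n) powr q)"
    using le nn_integral_eq_integral[OF int] by simp
  then show "(\<integral>x. norm (emp_cov n x - \<Sigma>) powr q \<partial>P) \<le> 9 * (12000 * q * rate n) powr q"
    by (subst (asm) ennreal_le_iff) auto
qed

lemma rate_tendsto_0: "(\<lambda>n. rate (Suc n)) \<longlonglongrightarrow> 0"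
proof -
  have 1: "(\<lambda>n. m2 * inverse (real (Suc n))) \<longlonglongrightarrow> m2 * 0"
    by (intro tendsto_mult tendsto_const LIMSEQ_inverse_real_of_nat)
  have 2: "(\<lambda>n. sqrt (norm \<Sigma> * m2 * inverse (real (Suc n)))) \<longlonglongrightarrow> sqrt (norm \<Sigma> * m2 * 0)"
    by (intro tendsto_intros LIMSEQ_inverse_real_of_nat)
  show ?thesis
    using tendsto_max[OF 2 1] by (simp add: rate_def divide_inverse)
qed

text \<open>As the operator space need not be separable, the identity is obtained from the law of large
  numbers instead of a Bochner integral: the left-hand side does not depend on \<open>n\<close>.\<close>

lemma emp_cov_unbiased:
  fixes \<phi> :: "'e dual_op \<Rightarrow>\<^sub>L real"
  assumes n: "1 \<le> n" and S: "0 < norm \<Sigma>"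
  shows "has_bochner_integral P (\<lambda>x. blinfun_apply \<phi> (emp_cov n x - \<Sigma>)) 0"
proof -
  define h where "h z = blinfun_apply \<phi> (tens z z)" for z
  have cont: "continuous_on UNIV h"
    unfolding h_def by (intro blinfun.continuous_on continuous_on_const tens.continuous_on continuous_on_id)
  have h_le: "\<bar>h z\<bar> \<le> norm \<phi> * (norm z)\<^sup>2" for z
  proof -
    have "\<bar>h z\<bar> \<le> norm \<phi> * norm (tens z z)" unfolding h_def using norm_blinfun[of \<phi> "tens z z"] by simp
    also have "\<dots> \<le> norm \<phi> * (norm z * norm z)" by (intro mult_left_mono norm_tens_le) simp
    finally show ?thesis by (simp add: power2_eq_square)
  qed
  have int_h: "integrable \<mu> h"
  proof (rule Bochner_Integration.integrable_bound)
    show "integrable \<mu> (\<lambda>z. norm \<phi> * (norm z)\<^sup>2)" using norm_square_integrable by simp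
    show "h \<in> borel_measurable \<mu>"
      using cont by (simp add: borel_measurable_continuous_onI measurable_cong_sets[OF sets_eq refl])
    show "AE z in \<mu>. norm (h z) \<le> norm (norm \<phi> * (norm z)\<^sup>2)" using h_le by simp
  qed
  define e where "e = (\<integral>z. h z \<partial>\<mu>)"
  have he: "has_bochner_integral \<mu> h e" using int_h by (simp add: e_def has_bochner_integral_iff)
  have const: "has_bochner_integral P (\<lambda>x. r) r" for r :: real
    using P.prob_space by (simp add: has_bochner_integral_iff)
  have mean: "has_bochner_integral P (\<lambda>x. blinfun_apply \<phi> (emp_cov m x - \<Sigma>)) (e - blinfun_apply \<phi> \<Sigma>)" if m: "1 \<le> m" for m
  proof -
    have eq: "blinfun_apply \<phi> (emp_cov m x - \<Sigma>) = (1 / real m) * (\<Sum>k=1..m. h (x k)) - blinfun_apply \<phi> \<Sigma>" for x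
      by (simp add: emp_cov_def tens_sum_def h_def blinfun.diff_right blinfun.scaleR_right blinfun.sum_right)
    have "has_bochner_integral P (\<lambda>x. (1 / real m) * (\<Sum>k=1..m. h (x k)) - blinfun_apply \<phi> \<Sigma>) ((1 / real m) * (\<Sum>k=1..m. e) - blinfun_apply \<phi> \<Sigma>)"
      by (intro has_bochner_integral_diff const has_bochner_integral_mult_right has_bochner_integral_sum
          has_bochner_integral_P_coord he)
    then show ?thesis using m by (simp add: eq)
  qed
  \<comment> \<open>The first moment of the deviation for a sample of arbitrary size m, with
    \<open>9 * 12000 = 108000\<close>. The left-hand side is free of m and so must vanish.\<close>
  have bound: "\<bar>e - blinfun_apply \<phi> \<Sigma>\<bar> \<le> norm \<phi> * (108000 * rate m)" if m: "1 \<le> m" for m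
  proof -
    have intD: "integrable P (\<lambda>x. norm (emp_cov m x - \<Sigma>))" "(\<integral>x. norm (emp_cov m x - \<Sigma>) \<partial>P) \<le> 108000 * rate m"
      using emp_cov_dist_integrable[OF m S, of 1] rate_pos(2)[OF m S] by simp_all
    have "\<bar>e - blinfun_apply \<phi> \<Sigma>\<bar> = \<bar>\<integral>x. blinfun_apply \<phi> (emp_cov m x - \<Sigma>) \<partial>P\<bar>"
      using mean[OF m] by (simp add: has_bochner_integral_iff)
    also have "\<dots> \<le> (\<integral>x. \<bar>blinfun_apply \<phi> (emp_cov m x - \<Sigma>)\<bar> \<partial>P)" by (rule integral_abs_bound)
    also have "\<dots> \<le> (\<integral>x. norm \<phi> * norm (emp_cov m x - \<Sigma>) \<partial>P)"
    proof (rule integral_mono)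
      show "integrable P (\<lambda>x. \<bar>blinfun_apply \<phi> (emp_cov m x - \<Sigma>)\<bar>)"
        using mean[OF m] by (simp add: has_bochner_integral_iff)
      show "integrable P (\<lambda>x. norm \<phi> * norm (emp_cov m x - \<Sigma>))" using intD by simp
      show "\<bar>blinfun_apply \<phi> (emp_cov m x - \<Sigma>)\<bar> \<le> norm \<phi> * norm (emp_cov m x - \<Sigma>)" for x
        using norm_blinfun[of \<phi> "emp_cov m x - \<Sigma>"] by simp
    qed
    also have "\<dots> \<le> norm \<phi> * (108000 * rate m)" using intD by (simp add: mult_left_mono)
    finally show ?thesis .
  qed
  have "(\<lambda>m. norm \<phi> * (108000 * rate (Suc m))) \<longlonglongrightarrow> norm \<phi> * (108000 * 0)"
    by (intro tendsto_mult tendsto_const rate_tendsto_0)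
  then have "\<bar>e - blinfun_apply \<phi> \<Sigma>\<bar> \<le> norm \<phi> * (108000 * 0)"
    by (rule LIMSEQ_le_const) (use bound in auto)
  then show ?thesis using mean[OF n] by simp
qed

text \<open>The velocity of \<open>emp_cov n (fst z)\<close> along the rotation. For fixed
  \<open>fst z\<close> it is linear in \<open>snd z\<close>, so scalar functionals of it are
  Gaussian.\<close>

definition dcov :: "nat \<Rightarrow> (nat \<Rightarrow> 'e) \<times> (nat \<Rightarrow> 'e) \<Rightarrow> 'e dual_op" where
  "dcov n z = (1 / real n) *\<^sub>R (tens_sum n (fst z) (snd z) + tens_sum n (snd z) (fst z))"

lemma emp_cov_rot_deriv:
  "((\<lambda>t. emp_cov n (fst (rot (cos t) (sin t) z))) has_vector_derivative dcov n (rot (cos t) (sin t) z)) (at t)"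
proof -
  have coord: "((\<lambda>t. fst (rot (cos t) (sin t) z) k) has_vector_derivative snd (rot (cos t) (sin t) z) k) (at t)" for k
    unfolding rot_def fst_conv snd_conv
    by (auto intro!: derivative_eq_intros)
  have "((\<lambda>t. tens_sum n (fst (rot (cos t) (sin t) z)) (fst (rot (cos t) (sin t) z))) has_vector_derivative
    (\<Sum>k=1..n. tens (fst (rot (cos t) (sin t) z) k) (snd (rot (cos t) (sin t) z) k) + tens (snd (rot (cos t) (sin t) z) k) (fst (rot (cos t) (sin t) z) k))) (at t)"
    unfolding tens_sum_def by (intro has_vector_derivative_sum tens.has_vector_derivative coord)
  then have "((\<lambda>t. (1 / real n) *\<^sub>R tens_sum n (fst (rot (cos t) (sin t) z)) (fst (rot (cos t) (sin t) z))) has_vector_derivative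
    (1 / real n) *\<^sub>R (\<Sum>k=1..n. tens (fst (rot (cos t) (sin t) z) k) (snd (rot (cos t) (sin t) z) k) + tens (snd (rot (cos t) (sin t) z) k) (fst (rot (cos t) (sin t) z) k))) (at t)"
    by (rule bounded_linear.has_vector_derivative[OF bounded_linear_scaleR_right])
  then show ?thesis
    by (simp add: emp_cov_def dcov_def tens_sum_def sum.distrib)
qed

lemma continuous_rot_coord:
  "continuous_on UNIV (\<lambda>t. fst (rot (cos t) (sin t) z) k)" "continuous_on UNIV (\<lambda>t. snd (rot (cos t) (sin t) z) k)"
  unfolding rot_def fst_conv snd_conv by (intro continuous_intros)+

lemma continuous_dcov: "continuous_on UNIV (dcov n)"
  unfolding dcov_def by (intro continuous_intros continuous_on_coord)

text \<open>\<open>powr_le_exp\<close> with exponent \<open>p / 2\<close>, applied to the square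
  divided by \<open>4 * V\<close>; the degenerate case has no such rate. The growth p^(p/2) is half
  of what the psi-1 norm allows, and the random conditional variance will use the other
  half.\<close>

lemma lin_form_moment:
  assumes V: "qf N w w \<le> V" and p: "1 \<le> p"
  shows "(\<integral>\<^sup>+x. ennreal (\<bar>lin_form N w x\<bar> powr p) \<partial>P) \<le> ennreal (2 * (2 * p * V) powr (p / 2))"
proof (cases "V = 0")
  case True
  then have "qf N w w = 0" using V qf_nonneg[of N w] by simp
  then have "(\<integral>x. (lin_form N w x)\<^sup>2 \<partial>P) = 0" "integrable P (\<lambda>x. (lin_form N w x)\<^sup>2)"
    using lin_form_square[of N w] by (simp_all add: has_bochner_integral_iff)
  then have "AE x in P. (lin_form N w x)\<^sup>2 = 0"
    by (subst (asm) integral_nonneg_eq_0_iff_AE) auto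
  then have "(\<integral>\<^sup>+x. ennreal (\<bar>lin_form N w x\<bar> powr p) \<partial>P) = (\<integral>\<^sup>+x. 0 \<partial>P)"
    by (intro nn_integral_cong_AE) (auto elim!: eventually_mono)
  then show ?thesis by simp
next
  case False
  then have V0: "0 < V" using V qf_nonneg[of N w] by simp
  have "(\<integral>\<^sup>+x. ennreal (\<bar>lin_form N w x\<bar> powr p) \<partial>P)
    \<le> (\<integral>\<^sup>+x. ennreal ((2 * p * V) powr (p / 2)) * ennreal (exp ((1 / (4 * V)) * (lin_form N w x)\<^sup>2)) \<partial>P)"
  proof (rule nn_integral_mono)
    fix x
    define t where "t = lin_form N w x"
    have "\<bar>t\<bar> powr p = (t\<^sup>2) powr (p / 2)"
    proof (cases "t = 0")
      case False
      then have "(t\<^sup>2) powr (p / 2) = (\<bar>t\<bar> powr 2) powr (p / 2)" by (simp add: powr_numeral)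
      also have "\<dots> = \<bar>t\<bar> powr p" unfolding powr_powr by simp
      finally show ?thesis by (rule sym)
    qed simp
    also have "\<dots> = (4 * V) powr (p / 2) * ((1 / (4 * V)) * t\<^sup>2) powr (p / 2)"
      using V0 by (simp flip: powr_mult)
    also have "\<dots> \<le> (4 * V) powr (p / 2) * ((p / 2) powr (p / 2) * exp ((1 / (4 * V)) * t\<^sup>2))"
      using V0 p by (intro mult_left_mono powr_le_exp) auto
    also have "\<dots> = (2 * p * V) powr (p / 2) * exp ((1 / (4 * V)) * t\<^sup>2)"
    proof -
      have e: "(4 * V) * (p / 2) = 2 * p * V" by simp
      have "(4 * V) powr (p / 2) * (p / 2) powr (p / 2) = (2 * p * V) powr (p / 2)"
        unfolding e[symmetric] by (rule powr_mult[symmetric])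
      then show ?thesis by (simp only: mult.assoc[symmetric])
    qed
    finally show "ennreal (\<bar>t\<bar> powr p) \<le> ennreal ((2 * p * V) powr (p / 2)) * ennreal (exp ((1 / (4 * V)) * t\<^sup>2))"
      by (simp add: ennreal_leI flip: ennreal_mult')
  qed
  also have "\<dots> = ennreal ((2 * p * V) powr (p / 2)) * (\<integral>\<^sup>+x. ennreal (exp ((1 / (4 * V)) * (lin_form N w x)\<^sup>2)) \<partial>P)"
    by (intro nn_integral_cmult) measurable
  also have "\<dots> \<le> ennreal ((2 * p * V) powr (p / 2)) * ennreal 2"
    using lin_form_exp_square[OF V V0 order_refl] by (intro mult_left_mono) auto
  also have "\<dots> = ennreal (2 * (2 * p * V) powr (p / 2))"
    by (subst ennreal_mult'[symmetric]) (auto simp: mult.commute)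
  finally show ?thesis .
qed

text \<open>The variance \<open>Q\<close> of the Gaussian variable \<open>\<phi> (dcov n (x, y))\<close> is \<open>\<phi>\<close> evaluated at
  \<open>dcov n (x, y*)\<close> for a suitable \<open>y*\<close>, and the norm of the latter is of order \<open>sqrt Q\<close>.\<close>

lemma dcov_conditionally_gaussian:
  fixes \<phi> :: "'e dual_op \<Rightarrow>\<^sub>L real" and x :: "nat \<Rightarrow> 'e"
  assumes n: "1 \<le> n" and L: "norm \<phi> \<le> L"
  obtains w where "\<And>y. blinfun_apply \<phi> (dcov n (x, y)) = lin_form (Suc n) w y"
    "qf (Suc n) w w \<le> 4 * L\<^sup>2 * norm \<Sigma> * norm (emp_cov n x) / real n"
proof -
  define g where "g k z = blinfun_apply \<phi> ((1 / real n) *\<^sub>R (tens (x k) z + tens z (x k)))" for k z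
  have bl: "bounded_linear (g k)" for k
    unfolding g_def
    by (intro bounded_linear_compose[OF blinfun.bounded_linear_right]
        bounded_linear_compose[OF bounded_linear_scaleR_right] bounded_linear_add
        tens.bounded_linear_right tens.bounded_linear_left)
  \<comment> \<open>The coefficient at 0 vanishes because linear forms count from 0 and the sample
    from 1.\<close>
  define w where "w k = (if k = 0 then 0 else Blinfun (g k))" for k
  have w_apply: "blinfun_apply (w k) z = g k z" if "k \<noteq> 0" for k z
    using that bl by (simp add: w_def bounded_linear_Blinfun_apply)
  have split: "(\<Sum>k<Suc n. h k) = h 0 + (\<Sum>k=1..n. h k)" for h :: "nat \<Rightarrow> real"
    by (simp add: lessThan_Suc_atMost flip: atLeast0AtMost) (subst sum.atLeast_Suc_atMost, auto)
  have lin: "blinfun_apply \<phi> (dcov n (x, y)) = lin_form (Suc n) w y" for y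
  proof -
    have "lin_form (Suc n) w y = (\<Sum>k=1..n. g k (y k))"
    proof -
      have "(\<Sum>k=1..n. blinfun_apply (w k) (y k)) = (\<Sum>k=1..n. g k (y k))"
        by (intro sum.cong refl w_apply) auto
      then show ?thesis unfolding lin_form_def split by (simp add: w_def)
    qed
    also have "\<dots> = blinfun_apply \<phi> (dcov n (x, y))"
      by (simp add: g_def dcov_def tens_sum_def sum.distrib scaleR_sum_right scaleR_right_distrib blinfun.sum_right blinfun.add_right)
    finally show ?thesis by simp
  qed
  define Q where "Q = qf (Suc n) w w"
  have Q0: "0 \<le> Q" unfolding Q_def by (rule qf_nonneg)
  have Qsum: "Q = (\<Sum>k=1..n. cov (w k) (w k))"
    unfolding Q_def qf_def split by (simp add: w_def cov_zero)
  \<comment> \<open>The vectors representing the \<open>w k\<close> through the covariance: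
    evaluating the form at \<open>ys\<close> returns its own variance Q.\<close>
  define ys where "ys k = blinfun_apply \<Sigma> (w k)" for k
  define e where "e = norm (emp_cov n x)"
  define B where "B = sqrt (norm \<Sigma> * Q * (real n * e))"
  have B0: "0 \<le> norm \<Sigma> * Q * (real n * e)" using Q0 by (simp add: e_def)
  \<comment> \<open>Cauchy-Schwarz is used twice, over k and in the covariance form; the latter
    splits off \<open>norm \<Sigma>\<close> and leaves the sum of the variances, which is Q.\<close>
  have cross: "(\<Sum>k=1..n. blinfun_apply u (ys k) * blinfun_apply v (x k)) \<le> B" if u: "norm u \<le> 1" and v: "norm v \<le> 1" for u v
  proof -
    have "(\<Sum>k=1..n. blinfun_apply u (ys k) * blinfun_apply v (x k))\<^sup>2
      \<le> (\<Sum>k=1..n. (blinfun_apply u (ys k))\<^sup>2) * (\<Sum>k=1..n. (blinfun_apply v (x k))\<^sup>2)"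
      by (rule Cauchy_Schwarz_ineq_sum)
    also have "\<dots> \<le> (norm \<Sigma> * Q) * (real n * e)"
    proof (intro mult_mono)
      have "(\<Sum>k=1..n. (blinfun_apply u (ys k))\<^sup>2) \<le> (\<Sum>k=1..n. norm \<Sigma> * cov (w k) (w k))"
      proof (rule sum_mono)
        fix k
        have "(blinfun_apply u (ys k))\<^sup>2 \<le> cov u u * cov (w k) (w k)"
          unfolding ys_def cov_def[symmetric] by (rule cov_Cauchy_Schwarz)
        also have "\<dots> \<le> norm \<Sigma> * cov (w k) (w k)" using cov_le_norm[OF u] cov_nonneg by (intro mult_right_mono) auto
        finally show "(blinfun_apply u (ys k))\<^sup>2 \<le> norm \<Sigma> * cov (w k) (w k)" .
      qed
      then show "(\<Sum>k=1..n. (blinfun_apply u (ys k))\<^sup>2) \<le> norm \<Sigma> * Q" by (simp add: Qsum sum_distrib_left)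
      show "(\<Sum>k=1..n. (blinfun_apply v (x k))\<^sup>2) \<le> real n * e" unfolding e_def by (rule emp_cov_quadratic[OF v n])
    qed (use Q0 in \<open>auto intro!: sum_nonneg\<close>)
    finally show ?thesis unfolding B_def by (rule real_le_rsqrt)
  qed
  have "Q = lin_form (Suc n) w ys"
    unfolding Q_def qf_def lin_form_def cov_def ys_def ..
  also have "\<dots> = blinfun_apply \<phi> (dcov n (x, ys))" by (simp add: lin)
  also have "\<dots> \<le> norm \<phi> * norm (dcov n (x, ys))" using norm_blinfun[of \<phi> "dcov n (x, ys)"] by simp
  also have "\<dots> \<le> L * ((1 / real n) * (2 * B))"
  proof (intro mult_mono L)
    show "norm (dcov n (x, ys)) \<le> (1 / real n) * (2 * B)"
    proof (rule norm_dual_op_le)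
      fix u v :: "'e \<Rightarrow>\<^sub>L real" assume uv: "norm u \<le> 1" "norm v \<le> 1"
      have "blinfun_apply u (blinfun_apply (dcov n (x, ys)) v)
        = (1 / real n) * ((\<Sum>k=1..n. blinfun_apply v (ys k) * blinfun_apply u (x k)) + (\<Sum>k=1..n. blinfun_apply u (ys k) * blinfun_apply v (x k)))"
        by (simp add: dcov_def blinfun.scaleR_left blinfun.add_left tens_sum_apply blinfun.scaleR_right blinfun.add_right blinfun.sum_right mult.commute)
      also have "\<dots> \<le> (1 / real n) * (B + B)"
        using cross uv by (intro mult_left_mono add_mono) auto
      finally show "blinfun_apply u (blinfun_apply (dcov n (x, ys)) v) \<le> (1 / real n) * (2 * B)" by simp
    qed (use B0 in \<open>simp add: B_def\<close>)
  qed (use order_trans[OF norm_ge_zero L] in auto)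
  finally have QB: "Q \<le> 2 * L * B / real n" by (simp add: mult_ac)
  \<comment> \<open>B contains \<open>sqrt Q\<close>, so the bound on Q refers to Q; squaring it and
    cancelling one factor Q resolves this.\<close>
  have "Q \<le> 4 * L\<^sup>2 * norm \<Sigma> * e / real n"
  proof (cases "Q = 0")
    case False
    then have Q: "0 < Q" using Q0 by simp
    have "Q * Q \<le> (2 * L * B / real n) * (2 * L * B / real n)" using QB Q by (intro mult_mono) auto
    also have "\<dots> = 4 * L\<^sup>2 * B\<^sup>2 / (real n)\<^sup>2" by (simp add: power2_eq_square)
    also have "B\<^sup>2 = norm \<Sigma> * Q * (real n * e)" using B0 by (simp add: B_def)
    also have "4 * L\<^sup>2 * (norm \<Sigma> * Q * (real n * e)) / (real n)\<^sup>2 = (4 * L\<^sup>2 * norm \<Sigma> * e / real n) * Q"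
      using n by (simp add: power2_eq_square)
    finally have "Q * Q \<le> (4 * L\<^sup>2 * norm \<Sigma> * e / real n) * Q" .
    then show ?thesis using Q by (rule mult_right_le_imp_le)
  qed (simp add: e_def)
  then show ?thesis using that[of w] lin by (simp add: Q_def e_def)
qed

text \<open>Given x, the velocity of f is Gaussian with variance of order
  \<open>norm (emp_cov n x)\<close>. The Gaussian moment and the moment of order
  \<open>p / 2\<close> of this norm contribute p^(p/2) each, which together give the linear growth
  in p of a psi-1 bound.\<close>

theorem smooth_functional_two_sample_moment:
  fixes f :: "'e dual_op \<Rightarrow> real"
  assumes n: "1 \<le> n" and S: "0 < norm \<Sigma>" and p: "1 \<le> p"
    and deriv: "\<And>A. (f has_derivative blinfun_apply (f' A)) (at A)"
    and cont: "continuous_on UNIV f'" and L: "\<And>A. norm (f' A) \<le> L"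
  shows "(\<integral>\<^sup>+x. (\<integral>\<^sup>+y. ennreal (\<bar>f (emp_cov n x) - f (emp_cov n y)\<bar> powr p) \<partial>P) \<partial>P)
    \<le> ennreal (20 * (pi / 2 * (p * L * sqrt (48000 * norm \<Sigma> * (rate n + norm \<Sigma>) / real n))) powr p)"
proof -
  note R = rate_pos(2)[OF n S]
  have L0: "0 \<le> L" using L norm_ge_zero order_trans by blast
  \<comment> \<open>F sees only the first copy. The quarter rotation brings the second copy into
    that place, so the inequality compares f at two independent samples.\<close>
  define F where "F z = f (emp_cov n (fst z))" for z :: "(nat \<Rightarrow> 'e) \<times> (nat \<Rightarrow> 'e)"
  define G where "G z = blinfun_apply (f' (emp_cov n (fst z))) (dcov n z)" for z
  have contf: "continuous_on UNIV f"
    using deriv by (intro continuous_at_imp_continuous_on) (auto intro: has_derivative_continuous)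
  have cfst: "continuous_on UNIV (\<lambda>z :: (nat \<Rightarrow> 'e) \<times> (nat \<Rightarrow> 'e). emp_cov n (fst z))"
    by (rule continuous_on_compose2[OF continuous_emp_cov continuous_on_fst[OF continuous_on_id]]) auto
  have csnd: "continuous_on UNIV (\<lambda>z :: (nat \<Rightarrow> 'e) \<times> (nat \<Rightarrow> 'e). emp_cov n (snd z))"
    by (rule continuous_on_compose2[OF continuous_emp_cov continuous_on_snd[OF continuous_on_id]]) auto
  have contG: "continuous_on UNIV G"
    unfolding G_def
    by (intro blinfun.continuous_on continuous_dcov continuous_on_compose2[OF cont cfst]) auto
  have Gm[measurable]: "G \<in> borel_measurable (P \<Otimes>\<^sub>M P)" by (rule measurable_PP_continuous[OF contG])
  have MP: "(\<integral>\<^sup>+z. ennreal (\<bar>F (rot 0 1 z) - F z\<bar> powr p) \<partial>(P \<Otimes>\<^sub>M P))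
    \<le> ennreal ((pi / 2) powr p) * (\<integral>\<^sup>+z. ennreal (\<bar>G z\<bar> powr p) \<partial>(P \<Otimes>\<^sub>M P))"
  proof (rule Maurey_Pisier[OF p])
    fix z t
    have "(f has_derivative blinfun_apply (f' (emp_cov n (fst (rot (cos t) (sin t) z)))))
       (at (emp_cov n (fst (rot (cos t) (sin t) z))) within range (\<lambda>t. emp_cov n (fst (rot (cos t) (sin t) z))))"
      by (rule has_derivative_at_withinI[OF deriv])
    from vector_derivative_diff_chain_within[OF emp_cov_rot_deriv this]
    show "((\<lambda>t. F (rot (cos t) (sin t) z)) has_real_derivative G (rot (cos t) (sin t) z)) (at t)"
      by (simp add: F_def G_def has_real_derivative_iff_has_vector_derivative comp_def)
  next
    fix z
    have 1: "continuous_on UNIV (\<lambda>t. emp_cov n (fst (rot (cos t) (sin t) z)))"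
      unfolding emp_cov_def by (intro continuous_intros continuous_rot_coord)
    have 2: "continuous_on UNIV (\<lambda>t. dcov n (rot (cos t) (sin t) z))"
      unfolding dcov_def by (intro continuous_intros continuous_rot_coord)
    show "continuous_on UNIV (\<lambda>t. G (rot (cos t) (sin t) z))"
      unfolding G_def by (intro blinfun.continuous_on 2 continuous_on_compose2[OF cont 1]) auto
  qed (rule Gm)
  \<comment> \<open>\<open>a\<close> is \<open>2 * p\<close> times the coefficient of the
    conditional variance, and \<open>b\<close> is \<open>p / 2\<close> times the scale
    \<open>12000 * (rate n + norm \<Sigma>)\<close> at which the exponential moment of the norm is
    controlled.\<close>
  define a where "a = 8 * p * L\<^sup>2 * norm \<Sigma> / real n"
  define b where "b = 6000 * p * (rate n + norm \<Sigma>)"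
  have a0: "0 \<le> a" and b0: "0 < b" using p S R by (auto simp: a_def b_def intro!: mult_pos_pos add_pos_pos)
  have ptw: "(\<integral>\<^sup>+y. ennreal (\<bar>G (x, y)\<bar> powr p) \<partial>P)
    \<le> ennreal (2 * (10/9) * (a * b) powr (p / 2)) * ennreal (exp (1 / (12000 * rate n) * norm (emp_cov n x - \<Sigma>)))" for x
  proof -
    obtain w where w: "\<And>y. blinfun_apply (f' (emp_cov n x)) (dcov n (x, y)) = lin_form (Suc n) w y"
      "qf (Suc n) w w \<le> 4 * L\<^sup>2 * norm \<Sigma> * norm (emp_cov n x) / real n"
      using dcov_conditionally_gaussian[OF n L[of "emp_cov n x"], of x] by metis
    define q where "q = norm (emp_cov n x)"
    define \<tau> where "\<tau> = rate n + norm \<Sigma>"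
    define l where "l = 1 / (12000 * \<tau>)"
    define D where "D = norm (emp_cov n x - \<Sigma>)"
    have \<tau>: "0 < \<tau>" "rate n \<le> \<tau>" "norm \<Sigma> \<le> \<tau>" using R S by (auto simp: \<tau>_def intro: add_pos_pos)
    have l0: "0 < l" using \<tau> by (simp add: l_def)
    have q0: "0 \<le> q" "q \<le> D + norm \<Sigma>" using norm_triangle_sub[of "emp_cov n x" \<Sigma>] by (auto simp: q_def D_def)
    have lq: "l * q \<le> 1 / (12000 * rate n) * D + 1 / 12000"
    proof -
      have "l * q \<le> l * D + l * norm \<Sigma>" using q0 l0 by (simp add: mult_left_mono flip: distrib_left)
      moreover have "l * D \<le> 1 / (12000 * rate n) * D"
        unfolding l_def using R \<tau> by (intro mult_right_mono frac_le) (auto simp: D_def)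
      moreover have "l * norm \<Sigma> \<le> 1 / 12000" using \<tau> by (simp add: l_def divide_le_eq)
      ultimately show ?thesis by linarith
    qed
    \<comment> \<open>The value 10/9 meets the bound 9 on the exponential moment:
      \<open>2 * (10/9) * 9 = 20\<close>.\<close>
    have e1: "exp (1 / 12000 :: real) \<le> 10 / 9"
    proof -
      have "norm (exp (1 / 12000 :: real)) \<le> 1 + 2 * norm (1 / 12000 :: real)" by (intro exp_bound_lemma) auto
      then show ?thesis by simp
    qed
    have "(\<integral>\<^sup>+y. ennreal (\<bar>G (x, y)\<bar> powr p) \<partial>P) = (\<integral>\<^sup>+y. ennreal (\<bar>lin_form (Suc n) w y\<bar> powr p) \<partial>P)"
      by (simp add: G_def w(1))
    also have "\<dots> \<le> ennreal (2 * (2 * p * (4 * L\<^sup>2 * norm \<Sigma> * norm (emp_cov n x) / real n)) powr (p / 2))"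
      by (rule lin_form_moment[OF w(2) p])
    also have "2 * p * (4 * L\<^sup>2 * norm \<Sigma> * norm (emp_cov n x) / real n) = a * q" by (simp add: a_def q_def)
    also have "ennreal (2 * (a * q) powr (p / 2)) \<le> ennreal (2 * (10/9) * (a * b) powr (p / 2) * exp (1 / (12000 * rate n) * D))"
    proof (rule ennreal_leI)
      have bl: "b = (p / 2) * (1 / l)" by (simp add: b_def l_def \<tau>_def)
      have "q powr (p / 2) = (1 / l) powr (p / 2) * (l * q) powr (p / 2)"
        using l0 q0 by (simp flip: powr_mult)
      also have "\<dots> \<le> (1 / l) powr (p / 2) * ((p / 2) powr (p / 2) * exp (l * q))"
        using l0 q0 p by (intro mult_left_mono powr_le_exp) auto
      also have "\<dots> = b powr (p / 2) * exp (l * q)" unfolding bl powr_mult by (simp only: mult_ac)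
      also have "\<dots> \<le> b powr (p / 2) * (exp (1 / (12000 * rate n) * D) * (10 / 9))"
      proof (intro mult_left_mono)
        have "exp (l * q) \<le> exp (1 / (12000 * rate n) * D + 1 / 12000)" using lq by simp
        also have "\<dots> = exp (1 / (12000 * rate n) * D) * exp (1 / 12000)" by (rule exp_add)
        also have "\<dots> \<le> exp (1 / (12000 * rate n) * D) * (10 / 9)" using e1 by (intro mult_left_mono) auto
        finally show "exp (l * q) \<le> exp (1 / (12000 * rate n) * D) * (10 / 9)" .
      qed simp
      finally have qb: "q powr (p / 2) \<le> b powr (p / 2) * (exp (1 / (12000 * rate n) * D) * (10 / 9))" .
      have "2 * (a * q) powr (p / 2) = 2 * a powr (p / 2) * q powr (p / 2)" using a0 q0 by (simp add: powr_mult)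
      also have "\<dots> \<le> 2 * a powr (p / 2) * (b powr (p / 2) * (exp (1 / (12000 * rate n) * D) * (10 / 9)))"
        by (rule mult_left_mono[OF qb]) simp
      also have "\<dots> = 2 * (10/9) * (a * b) powr (p / 2) * exp (1 / (12000 * rate n) * D)"
        using a0 b0 by (simp add: powr_mult)
      finally show "2 * (a * q) powr (p / 2) \<le> 2 * (10/9) * (a * b) powr (p / 2) * exp (1 / (12000 * rate n) * D)" .
    qed
    also have "\<dots> = ennreal (2 * (10/9) * (a * b) powr (p / 2)) * ennreal (exp (1 / (12000 * rate n) * D))"
      by (rule ennreal_mult') simp
    finally show ?thesis by (simp only: D_def)
  qed
  have "(\<integral>\<^sup>+z. ennreal (\<bar>G z\<bar> powr p) \<partial>(P \<Otimes>\<^sub>M P)) = (\<integral>\<^sup>+x. (\<integral>\<^sup>+y. ennreal (\<bar>G (x, y)\<bar> powr p) \<partial>P) \<partial>P)"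
    by (rule P.nn_integral_fst[symmetric]) measurable
  also have "\<dots> \<le> (\<integral>\<^sup>+x. ennreal (2 * (10/9) * (a * b) powr (p / 2)) * ennreal (exp (1 / (12000 * rate n) * norm (emp_cov n x - \<Sigma>))) \<partial>P)"
    by (intro nn_integral_mono ptw)
  also have "\<dots> = ennreal (2 * (10/9) * (a * b) powr (p / 2)) * (\<integral>\<^sup>+x. ennreal (exp (1 / (12000 * rate n) * norm (emp_cov n x - \<Sigma>))) \<partial>P)"
    by (intro nn_integral_cmult) measurable
  also have "\<dots> \<le> ennreal (2 * (10/9) * (a * b) powr (p / 2)) * ennreal 9"
    using emp_cov_exp_moment[OF n S refl] by (intro mult_left_mono) auto
  also have "\<dots> = ennreal (20 * (a * b) powr (p / 2))"
    by (subst ennreal_mult'[symmetric]) auto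
  finally have GE: "(\<integral>\<^sup>+z. ennreal (\<bar>G z\<bar> powr p) \<partial>(P \<Otimes>\<^sub>M P)) \<le> ennreal (20 * (a * b) powr (p / 2))" .
  have ab: "(a * b) powr (p / 2) = (p * L * sqrt (48000 * norm \<Sigma> * (rate n + norm \<Sigma>) / real n)) powr p"
  proof -
    define s where "s = 48000 * norm \<Sigma> * (rate n + norm \<Sigma>) / real n"
    have s0: "0 \<le> s" using S R by (simp add: s_def)
    have "(p * L * sqrt s)\<^sup>2 = p\<^sup>2 * L\<^sup>2 * s" using s0 by (simp add: power_mult_distrib)
    then have "a * b = (p * L * sqrt s)\<^sup>2" by (simp add: a_def b_def s_def power2_eq_square)
    moreover have "(c\<^sup>2) powr (p / 2) = c powr p" if "0 \<le> c" for c :: real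
    proof (cases "c = 0")
      case False
      then have "(c\<^sup>2) powr (p / 2) = (c powr 2) powr (p / 2)" using that by (simp add: powr_numeral)
      also have "\<dots> = c powr p" unfolding powr_powr by simp
      finally show ?thesis .
    qed simp
    moreover have "0 \<le> p * L * sqrt s" using p L0 s0 by simp
    ultimately show ?thesis by (simp add: s_def)
  qed
  have Fm: "(\<lambda>z. ennreal (\<bar>f (emp_cov n (fst z)) - f (emp_cov n (snd z))\<bar> powr p)) \<in> borel_measurable (P \<Otimes>\<^sub>M P)"
  proof -
    have [measurable]: "(\<lambda>z. f (emp_cov n (fst z))) \<in> borel_measurable (P \<Otimes>\<^sub>M P)" "(\<lambda>z. f (emp_cov n (snd z))) \<in> borel_measurable (P \<Otimes>\<^sub>M P)"
      by (intro measurable_PP_continuous continuous_on_compose2[OF contf cfst] continuous_on_compose2[OF contf csnd]; simp)+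
    show ?thesis by measurable
  qed
  have scale: "(pi / 2) powr p * (20 * c powr p) = 20 * (pi / 2 * c) powr p" for c
    by (simp only: powr_mult mult_ac)
  have "(\<integral>\<^sup>+x. (\<integral>\<^sup>+y. ennreal (\<bar>f (emp_cov n x) - f (emp_cov n y)\<bar> powr p) \<partial>P) \<partial>P)
    = (\<integral>\<^sup>+z. ennreal (\<bar>f (emp_cov n (fst z)) - f (emp_cov n (snd z))\<bar> powr p) \<partial>(P \<Otimes>\<^sub>M P))"
    using P.nn_integral_fst[OF Fm] by simp
  also have "\<dots> = (\<integral>\<^sup>+z. ennreal (\<bar>F (rot 0 1 z) - F z\<bar> powr p) \<partial>(P \<Otimes>\<^sub>M P))"
    by (simp add: F_def rot_right_angle abs_minus_commute)
  also have "\<dots> \<le> ennreal ((pi / 2) powr p) * ennreal (20 * (a * b) powr (p / 2))"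
    using MP mult_left_mono[OF GE, of "ennreal ((pi / 2) powr p)"] by (intro order_trans[OF MP]) auto
  also have "\<dots> = ennreal (20 * (pi / 2 * (p * L * sqrt (48000 * norm \<Sigma> * (rate n + norm \<Sigma>) / real n))) powr p)"
    unfolding ab by (subst ennreal_mult'[symmetric], simp, simp only: scale)
  finally show ?thesis .
qed

end

section \<open>The moment bounds\<close>

lemma Holder_bound:
  fixes g :: "'b::real_normed_vector \<Rightarrow> 'c::real_normed_vector"
  assumes fin: "holder_norm \<rho> g < \<top>"
  shows "norm (g x - g y) \<le> enn2real (holder_norm \<rho> g) * norm (x - y) powr \<rho>"
proof (cases "x = y")
  case False
  define H where "H = enn2real (holder_norm \<rho> g)"
  have "ennreal (norm (g x - g y) / norm (x - y) powr \<rho>) \<le> holder_norm \<rho> g"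
    unfolding holder_norm_def using False by (intro SUP_upper2[of "(x, y)"]) auto
  also have "\<dots> = ennreal H" unfolding H_def using fin by simp
  finally have "norm (g x - g y) / norm (x - y) powr \<rho> \<le> H"
    by (subst (asm) ennreal_le_iff) (simp_all add: H_def)
  then show ?thesis using False by (simp add: H_def divide_le_eq)
qed simp

lemma psi_norm_le:
  assumes B: "0 \<le> B"
    and moment: "\<And>p. 1 \<le> p \<Longrightarrow> (\<integral>\<^sup>+\<omega>. ennreal (\<bar>\<eta> \<omega>\<bar> powr p) \<partial>M) \<le> ennreal ((p powr (1 / \<alpha>) * B) powr p)"
  shows "psi_norm \<alpha> M \<eta> \<le> ennreal B"
  unfolding psi_norm_def
proof (rule SUP_least)
  fix p :: real assume "p \<in> {1..}"
  then have p: "1 \<le> p" by simp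
  define I where "I = (\<integral>\<^sup>+\<omega>. ennreal (\<bar>\<eta> \<omega>\<bar> powr p) \<partial>M)"
  define c where "c = p powr (1 / \<alpha>) * B"
  have c0: "0 \<le> c" using B by (simp add: c_def)
  have I: "I \<le> ennreal (c powr p)" using moment[OF p] by (simp add: I_def c_def)
  \<comment> \<open>This excludes the branch of \<open>Lp_norm\<close> with value \<top>, so
    \<open>enn2real\<close> loses nothing.\<close>
  then have top: "I \<noteq> \<top>" by (metis ennreal_neq_top top.extremum_unique)
  have "enn2real I \<le> c powr p" using I by (intro enn2real_leI) auto
  then have "enn2real I powr (1 / p) \<le> (c powr p) powr (1 / p)" using p by (intro powr_mono2) auto
  also have "\<dots> = c" using p c0 by (simp add: powr_powr)
  finally have "Lp_norm M p \<eta> \<le> ennreal c"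
    using top by (simp add: Lp_norm_def I_def[symmetric] ennreal_leI)
  then have "ennreal (p powr (- 1 / \<alpha>)) * Lp_norm M p \<eta> \<le> ennreal (p powr (- 1 / \<alpha>)) * ennreal c"
    by (intro mult_left_mono) auto
  also have "\<dots> = ennreal (p powr (- 1 / \<alpha>) * p powr (1 / \<alpha>) * B)"
    by (simp add: c_def mult.assoc flip: ennreal_mult')
  also have "p powr (- 1 / \<alpha>) * p powr (1 / \<alpha>) = 1"
    using p by (simp flip: powr_add)
  finally show "ennreal (p powr (- 1 / \<alpha>)) * Lp_norm M p \<eta> \<le> ennreal B" by simp
qed

lemma powr_add_le:
  fixes a b p :: real
  assumes "0 \<le> a" "0 \<le> b" "1 \<le> p"
  shows "(a + b) powr p \<le> 2 powr p * (a powr p + b powr p)"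
proof -
  have "(a + b) powr p \<le> (2 * max a b) powr p" using assms by (intro powr_mono2) auto
  also have "\<dots> = 2 powr p * max a b powr p" by (rule powr_mult)
  also have "max a b powr p \<le> a powr p + b powr p" by (simp add: max_def)
  finally show ?thesis by simp
qed

text \<open>For p at least 1 a constant c at least 1 satisfies \<open>c \<le> c powr p\<close> and
  can move inside the power. This keeps the constants in the psi-norm independent of p.\<close>

lemma sum_powr_le:
  fixes a b p :: real
  assumes "0 \<le> a" "0 \<le> b" "1 \<le> p"
  shows "2 powr p * (20 * a powr p + b powr p) \<le> (4 * (20 * a + b)) powr p"
proof -
  have const: "20 \<le> (20::real) powr p" "2 \<le> (2::real) powr p"
    using powr_mono[OF assms(3), of 20] powr_mono[OF assms(3), of 2] by simp_all
  define s where "s = 20 * a + b"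
  have "20 * a powr p \<le> 20 powr p * a powr p" using const by (intro mult_right_mono) auto
  also have "\<dots> = (20 * a) powr p" by (rule powr_mult[symmetric])
  also have "\<dots> \<le> s powr p" using assms by (intro powr_mono2) (auto simp: s_def)
  finally have 1: "20 * a powr p \<le> s powr p" .
  have 2: "b powr p \<le> s powr p" using assms by (intro powr_mono2) (auto simp: s_def)
  have "2 powr p * (20 * a powr p + b powr p) \<le> 2 powr p * (2 * s powr p)"
    using 1 2 by (intro mult_left_mono) auto
  also have "\<dots> \<le> 2 powr p * (2 powr p * s powr p)"
    using const by (intro mult_left_mono mult_right_mono) auto
  also have "\<dots> = (2 * (2 * s)) powr p" by (simp only: powr_mult)
  finally show ?thesis by (simp add: s_def)
qed

text \<open>With t the effective rank over n, this turns \<open>rate n + norm \<Sigma>\<close>, the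
  scale of the norm of the empirical covariance, into the squared maximum whose root appears in the
  linear term of the claim.\<close>

lemma max_sqrt_bound:
  fixes t :: real
  assumes "0 \<le> t"
  shows "max (sqrt t) t + 1 \<le> 2 * (max (sqrt t) 1)\<^sup>2"
proof (cases "t \<le> 1")
  case True
  then have "sqrt t \<le> 1" using assms by (simp add: real_sqrt_le_1_iff)
  then show ?thesis using True by (simp add: max_def)
next
  case False
  then have "1 \<le> sqrt t" by simp
  moreover have "sqrt t \<le> t"
  proof -
    have "sqrt t * 1 \<le> sqrt t * sqrt t" using \<open>1 \<le> sqrt t\<close> by (intro mult_left_mono) auto
    then show ?thesis using assms by simp
  qed
  ultimately show ?thesis using False assms by (simp add: max_def)
qed

section \<open>The degenerate case and the two moment bounds\<close>

context gaussian
begin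

lemma rate_eq_rank:
  assumes S: "0 < norm \<Sigma>"
  shows "rate n = norm \<Sigma> * max (sqrt (m2 / norm \<Sigma> / real n)) (m2 / norm \<Sigma> / real n)"
proof -
  have "norm \<Sigma> * m2 / real n = (norm \<Sigma>)\<^sup>2 * (m2 / norm \<Sigma> / real n)" using S by (simp add: power2_eq_square)
  then have "sqrt (norm \<Sigma> * m2 / real n) = sqrt ((norm \<Sigma>)\<^sup>2 * (m2 / norm \<Sigma> / real n))" by (rule arg_cong)
  also have "\<dots> = norm \<Sigma> * sqrt (m2 / norm \<Sigma> / real n)" by (subst real_sqrt_mult) simp
  finally have 1: "sqrt (norm \<Sigma> * m2 / real n) = norm \<Sigma> * sqrt (m2 / norm \<Sigma> / real n)" .
  have 2: "m2 / real n = norm \<Sigma> * (m2 / norm \<Sigma> / real n)" using S by simp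
  show ?thesis unfolding rate_def 1 by (subst 2) (simp only: max_mult_distrib_left norm_ge_zero if_True)
qed

text \<open>Every functional has variance 0 and vanishes almost everywhere. Countably many
  functionals determine the norm, so their exceptional null sets can be united.\<close>

lemma AE_degenerate:
  assumes S: "norm \<Sigma> = 0"
  shows "AE z in \<mu>. z = 0"
proof -
  obtain \<nu> :: "nat \<Rightarrow> 'e \<Rightarrow>\<^sub>L real" where \<nu>: "\<And>i. norm (\<nu> i) \<le> 1"
    "\<And>x c. (\<And>i. blinfun_apply (\<nu> i) x \<le> c) \<Longrightarrow> norm x \<le> c"
    using norming_sequence_exists by blast
  have "AE z in \<mu>. blinfun_apply (\<nu> i) z = 0" for i
  proof -
    have "cov (\<nu> i) (\<nu> i) = 0" using cov_le_norm[OF \<nu>(1)] cov_nonneg S by (simp add: antisym)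
    then have "integrable \<mu> (\<lambda>x. (blinfun_apply (\<nu> i) x)\<^sup>2)" "(\<integral>x. (blinfun_apply (\<nu> i) x)\<^sup>2 \<partial>\<mu>) = 0"
      using cov_integral[of "\<nu> i" "\<nu> i"] by (simp_all add: has_bochner_integral_iff power2_eq_square)
    then have "AE x in \<mu>. (blinfun_apply (\<nu> i) x)\<^sup>2 = 0"
      by (subst (asm) integral_nonneg_eq_0_iff_AE) auto
    then show ?thesis by (auto elim!: eventually_mono)
  qed
  then have "AE z in \<mu>. \<forall>i. blinfun_apply (\<nu> i) z = 0" by (simp add: AE_all_countable)
  then show ?thesis
  proof (rule eventually_mono)
    fix z assume "\<forall>i. blinfun_apply (\<nu> i) z = 0"
    then have "norm z \<le> 0" by (intro \<nu>(2)) simp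
    then show "z = 0" by simp
  qed
qed

lemma sample_cov_degenerate:
  assumes S: "norm \<Sigma> = 0" and M: "prob_space M" and iid: "iid_sample M n X \<mu>"
  shows "AE \<omega> in M. sample_cov n X \<omega> = \<Sigma>"
proof -
  interpret M: prob_space M by fact
  have "AE \<omega> in M. X j \<omega> = 0" if j: "j \<in> {1..n}" for j
  proof -
    have rv: "X j \<in> borel_measurable M" and law: "distr M borel (X j) = \<mu>"
      using iid j unfolding iid_sample_def M.indep_vars_def by auto
    have "AE z in distr M borel (X j). z = 0" using AE_degenerate[OF S] by (simp only: law)
    then show ?thesis by (rule AE_distrD[OF rv])
  qed
  then have "AE \<omega> in M. \<forall>j\<in>{1..n}. X j \<omega> = 0" by (intro AE_finite_allI) auto
  then show ?thesis
  proof (rule eventually_mono)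
    fix \<omega> assume "\<forall>j\<in>{1..n}. X j \<omega> = 0"
    then have "sample_cov n X \<omega> = emp_cov n (\<lambda>_. 0)"
      unfolding sample_cov_eq_emp_cov by (intro emp_cov_cong) auto
    then show "sample_cov n X \<omega> = \<Sigma>" using S by (simp add: emp_cov_def tens_sum_def tens.zero_left)
  qed
qed

lemma psi_norm_degenerate:
  assumes "norm \<Sigma> = 0" "prob_space M" "iid_sample M n X \<mu>"
  shows "psi_norm \<alpha> M (\<lambda>\<omega>. f (sample_cov n X \<omega>) - f \<Sigma>) = 0"
proof -
  have "(\<integral>\<^sup>+\<omega>. ennreal (\<bar>f (sample_cov n X \<omega>) - f \<Sigma>\<bar> powr p) \<partial>M) = (\<integral>\<^sup>+\<omega>. 0 \<partial>M)" for p
    using sample_cov_degenerate[OF assms] by (intro nn_integral_cong_AE) (auto elim!: eventually_mono)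
  then have "psi_norm \<alpha> M (\<lambda>\<omega>. f (sample_cov n X \<omega>) - f \<Sigma>) \<le> ennreal 0"
    by (intro psi_norm_le) simp_all
  then show ?thesis by simp
qed

text \<open>The Hoelder condition reduces the moment of order p to the moment of order
  \<open>\<rho> * p\<close> of the deviation, an order that may lie below 1. Its growth p^(\<rho> p)
  is exactly that of the psi-norm with exponent \<open>1 / \<rho>\<close>, and
  \<open>108000 = 9 * 12000\<close>.\<close>

theorem Holder_functional_moment:
  fixes f :: "'e dual_op \<Rightarrow> real"
  assumes M: "prob_space M" and n: "1 \<le> n" and iid: "iid_sample M n X \<mu>" and S: "0 < norm \<Sigma>"
    and \<rho>: "0 < \<rho>" "\<rho> \<le> 1" and p: "1 \<le> p" and H: "0 \<le> H"
    and holder: "\<And>A B. \<bar>f A - f B\<bar> \<le> H * norm (A - B) powr \<rho>"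
  shows "(\<integral>\<^sup>+\<omega>. ennreal (\<bar>f (sample_cov n X \<omega>) - f \<Sigma>\<bar> powr p) \<partial>M)
    \<le> ennreal ((p powr \<rho> * (108000 * (H * rate n powr \<rho>))) powr p)"
proof -
  note R = rate_pos(2)[OF n S]
  define q where "q = \<rho> * p"
  have q: "0 < q" using \<rho> p by (simp add: q_def)
  have "(\<integral>\<^sup>+\<omega>. ennreal (\<bar>f (sample_cov n X \<omega>) - f \<Sigma>\<bar> powr p) \<partial>M)
    \<le> (\<integral>\<^sup>+\<omega>. (\<lambda>A. ennreal (H powr p) * ennreal (norm (A - \<Sigma>) powr q)) (sample_cov n X \<omega>) \<partial>M)"
  proof (rule nn_integral_mono)
    fix \<omega>
    have "\<bar>f (sample_cov n X \<omega>) - f \<Sigma>\<bar> powr p \<le> (H * norm (sample_cov n X \<omega> - \<Sigma>) powr \<rho>) powr p"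
      using holder p by (intro powr_mono2) auto
    also have "\<dots> = H powr p * norm (sample_cov n X \<omega> - \<Sigma>) powr q"
      unfolding powr_mult powr_powr q_def ..
    finally show "ennreal (\<bar>f (sample_cov n X \<omega>) - f \<Sigma>\<bar> powr p)
      \<le> (\<lambda>A. ennreal (H powr p) * ennreal (norm (A - \<Sigma>) powr q)) (sample_cov n X \<omega>)"
      by (simp add: ennreal_leI flip: ennreal_mult')
  qed
  also have "\<dots> = (\<integral>\<^sup>+x. ennreal (H powr p) * ennreal (norm (emp_cov n x - \<Sigma>) powr q) \<partial>P)"
    by (rule sample_cov_transfer[OF M n iid]) measurable
  also have "\<dots> = ennreal (H powr p) * (\<integral>\<^sup>+x. ennreal (norm (emp_cov n x - \<Sigma>) powr q) \<partial>P)"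
    by (intro nn_integral_cmult) measurable
  also have "\<dots> \<le> ennreal (H powr p) * ennreal (9 * (12000 * q * rate n) powr q)"
    by (intro mult_left_mono emp_cov_moment[OF n S q]) simp
  also have "\<dots> = ennreal (H powr p * (9 * (12000 * q * rate n) powr q))"
    by (rule ennreal_mult'[symmetric]) simp
  also have "\<dots> \<le> ennreal ((p powr \<rho> * (108000 * (H * rate n powr \<rho>))) powr p)"
  proof (rule ennreal_leI)
    have "(12000 * q * rate n) powr \<rho> = (12000 * \<rho>) powr \<rho> * (p powr \<rho> * rate n powr \<rho>)"
      unfolding q_def by (simp only: powr_mult mult_ac)
    also have "\<dots> \<le> 12000 * (p powr \<rho> * rate n powr \<rho>)"
    proof (intro mult_right_mono)
      have "(12000 * \<rho>) powr \<rho> \<le> 12000 powr \<rho>" using \<rho> by (intro powr_mono2) auto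
      also have "\<dots> \<le> 12000 powr 1" using \<rho> by (intro powr_mono) auto
      finally show "(12000 * \<rho>) powr \<rho> \<le> 12000" by simp
    qed simp
    finally have base: "(12000 * q * rate n) powr \<rho> \<le> 12000 * (p powr \<rho> * rate n powr \<rho>)" .
    have "(12000 * q * rate n) powr q = ((12000 * q * rate n) powr \<rho>) powr p"
      unfolding powr_powr q_def ..
    also have "\<dots> \<le> (12000 * (p powr \<rho> * rate n powr \<rho>)) powr p"
      using base p by (intro powr_mono2) auto
    finally have 1: "(12000 * q * rate n) powr q \<le> (12000 * (p powr \<rho> * rate n powr \<rho>)) powr p" .
    have "(9::real) \<le> 9 powr p" using powr_mono[OF p, of 9] by simp
    then have "9 * (12000 * q * rate n) powr q \<le> 9 powr p * (12000 * (p powr \<rho> * rate n powr \<rho>)) powr p"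
      using 1 by (intro mult_mono) auto
    then have "H powr p * (9 * (12000 * q * rate n) powr q) \<le> H powr p * (9 powr p * (12000 * (p powr \<rho> * rate n powr \<rho>)) powr p)"
      by (intro mult_left_mono) auto
    also have "\<dots> = (H * (9 * (12000 * (p powr \<rho> * rate n powr \<rho>)))) powr p"
      by (simp only: powr_mult)
    also have "H * (9 * (12000 * (p powr \<rho> * rate n powr \<rho>))) = p powr \<rho> * (108000 * (H * rate n powr \<rho>))"
      by simp
    finally show "H powr p * (9 * (12000 * q * rate n) powr q) \<le> (p powr \<rho> * (108000 * (H * rate n powr \<rho>))) powr p" .
  qed
  finally show ?thesis .
qed

theorem smooth_functional_moment:
  fixes f :: "'e dual_op \<Rightarrow> real"
  assumes M: "prob_space M" and n: "1 \<le> n" and iid: "iid_sample M n X \<mu>" and S: "0 < norm \<Sigma>"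
    and \<rho>: "0 < \<rho>" "\<rho> \<le> 1" and p: "1 \<le> p" and L0: "0 \<le> L" and H: "0 \<le> H"
    and lip: "\<And>A B. \<bar>f A - f B\<bar> \<le> L * norm (A - B)"
    and deriv: "\<And>A. (f has_derivative blinfun_apply (f' A)) (at A)"
    and cont: "continuous_on UNIV f'"
    and holder: "\<And>A B. norm (f' A - f' B) \<le> H * norm (A - B) powr \<rho>"
  shows "(\<integral>\<^sup>+\<omega>. ennreal (\<bar>f (sample_cov n X \<omega>) - f \<Sigma>\<bar> powr p) \<partial>M)
    \<le> ennreal ((p * (3 * 10 ^ 10 * (L * (max (sqrt (m2 / norm \<Sigma> / real n)) 1 * (norm \<Sigma> / sqrt (real n)))
        + H * rate n powr (1 + \<rho>)))) powr p)"
proof -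
  note R = rate_pos(2)[OF n S]
  define F where "F x = f (emp_cov n x)" for x
  define D where "D x = norm (emp_cov n x - \<Sigma>)" for x
  have contf: "continuous_on UNIV f"
    using deriv by (intro continuous_at_imp_continuous_on) (auto intro: has_derivative_continuous)
  have Fm[measurable]: "F \<in> borel_measurable P"
    unfolding F_def by (rule measurable_emp_cov_continuous[OF contf])
  have intD: "integrable P D" using emp_cov_dist_integrable(1)[OF n S, of 1] by (simp add: D_def[abs_def])
  have intF: "integrable P F"
  proof -
    have "integrable P (\<lambda>x. F x - f \<Sigma>)"
    proof (rule Bochner_Integration.integrable_bound)
      show "integrable P (\<lambda>x. L * D x)" using intD by simp
      show "AE x in P. norm (F x - f \<Sigma>) \<le> norm (L * D x)"
        using lip L0 by (simp add: F_def D_def)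
    qed measurable
    then have "integrable P (\<lambda>x. (F x - f \<Sigma>) + f \<Sigma>)" by (intro Bochner_Integration.integrable_add) auto
    then show ?thesis by simp
  qed
  define e where "e = (\<integral>x. F x \<partial>P)"
  define K where "K = pi / 2 * (p * L * sqrt (48000 * norm \<Sigma> * (rate n + norm \<Sigma>) / real n))"
  have K0: "0 \<le> K" using p L0 S R by (simp add: K_def)
  have normL: "norm (f' A) \<le> L" for A by (rule norm_derivative_le_Lipschitz[OF deriv lip L0])
  \<comment> \<open>Centering at the mean is averaging over an independent copy, so Jensen's
    inequality in y bounds it by the two-sample moment.\<close>
  have conc: "(\<integral>\<^sup>+x. ennreal (\<bar>F x - e\<bar> powr p) \<partial>P) \<le> ennreal (20 * K powr p)"
  proof -
    have "(\<integral>\<^sup>+x. ennreal (\<bar>F x - e\<bar> powr p) \<partial>P) \<le> (\<integral>\<^sup>+x. (\<integral>\<^sup>+y. ennreal (\<bar>F x - F y\<bar> powr p) \<partial>P) \<partial>P)"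
    proof (rule nn_integral_mono)
      fix x
      have "(\<integral>y. F x - F y \<partial>P) = F x - e" using intF by (simp add: e_def P.prob_space[unfolded space_P])
      then show "ennreal (\<bar>F x - e\<bar> powr p) \<le> (\<integral>\<^sup>+y. ennreal (\<bar>F x - F y\<bar> powr p) \<partial>P)"
        using P.powr_integral_le[OF _ p, of "\<lambda>y. F x - F y"] intF by simp
    qed
    also have "\<dots> \<le> ennreal (20 * K powr p)"
      unfolding F_def K_def by (rule smooth_functional_two_sample_moment[OF n S p deriv cont normL])
    finally show ?thesis .
  qed
  define Y where "Y = H * rate n powr (1 + \<rho>)"
  have Y0: "0 \<le> Y" using H by (simp add: Y_def)
  \<comment> \<open>The square bounds the constant of the moment of order \<open>1 + \<rho>\<close>
    uniformly in \<rho>: the base is at most 24000 and the exponent at most 2. The factor 9 is the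
    exponential moment.\<close>
  have bias: "\<bar>e - f \<Sigma>\<bar> \<le> 9 * 24000\<^sup>2 * Y"
  proof -
    define T where "T x = F x - f \<Sigma> - blinfun_apply (f' \<Sigma>) (emp_cov n x - \<Sigma>)" for x
    have lin: "has_bochner_integral P (\<lambda>x. blinfun_apply (f' \<Sigma>) (emp_cov n x - \<Sigma>)) 0"
      by (rule emp_cov_unbiased[OF n S])
    have const: "has_bochner_integral P (\<lambda>x. f \<Sigma>) (f \<Sigma>)" using P.prob_space by (simp add: has_bochner_integral_iff)
    have "has_bochner_integral P F e" using intF by (simp add: has_bochner_integral_iff e_def)
    then have T: "has_bochner_integral P T (e - f \<Sigma> - 0)"
      unfolding T_def by (intro has_bochner_integral_diff const lin)
    have \<rho>1: "0 < 1 + \<rho>" using \<rho> by simp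
    note mom = emp_cov_dist_integrable[OF n S \<rho>1]
    have "\<bar>e - f \<Sigma>\<bar> = \<bar>\<integral>x. T x \<partial>P\<bar>" using T by (simp add: has_bochner_integral_iff)
    also have "\<dots> \<le> (\<integral>x. \<bar>T x\<bar> \<partial>P)" by (rule integral_abs_bound)
    also have "\<dots> \<le> (\<integral>x. H * norm (emp_cov n x - \<Sigma>) powr (1 + \<rho>) \<partial>P)"
    proof (rule integral_mono)
      show "integrable P (\<lambda>x. \<bar>T x\<bar>)" using T by (simp add: has_bochner_integral_iff)
      show "integrable P (\<lambda>x. H * norm (emp_cov n x - \<Sigma>) powr (1 + \<rho>))" using mom(1) by simp
      show "\<bar>T x\<bar> \<le> H * norm (emp_cov n x - \<Sigma>) powr (1 + \<rho>)" for x
        unfolding T_def F_def by (rule Taylor_Holder[OF deriv holder H \<rho>(1)])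
    qed
    also have "\<dots> = H * (\<integral>x. norm (emp_cov n x - \<Sigma>) powr (1 + \<rho>) \<partial>P)" by simp
    also have "\<dots> \<le> H * (9 * (12000 * (1 + \<rho>) * rate n) powr (1 + \<rho>))" using mom(2) H by (rule mult_left_mono)
    also have "\<dots> \<le> H * (9 * (24000\<^sup>2 * rate n powr (1 + \<rho>)))"
    proof (intro mult_left_mono H)
      have "(12000 * (1 + \<rho>)) powr (1 + \<rho>) \<le> 24000 powr (1 + \<rho>)" using \<rho> by (intro powr_mono2) auto
      also have "\<dots> \<le> 24000 powr 2" using \<rho> by (intro powr_mono) auto
      finally have c: "(12000 * (1 + \<rho>)) powr (1 + \<rho>) \<le> 24000\<^sup>2" by simp
      have "(12000 * (1 + \<rho>) * rate n) powr (1 + \<rho>) = (12000 * (1 + \<rho>)) powr (1 + \<rho>) * rate n powr (1 + \<rho>)"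
        by (rule powr_mult)
      also have "\<dots> \<le> 24000\<^sup>2 * rate n powr (1 + \<rho>)" by (rule mult_right_mono[OF c]) simp
      finally show "(12000 * (1 + \<rho>) * rate n) powr (1 + \<rho>) \<le> 24000\<^sup>2 * rate n powr (1 + \<rho>)" .
    qed simp
    finally show ?thesis by (simp add: Y_def)
  qed
  define t where "t = m2 / norm \<Sigma> / real n"
  have t0: "0 \<le> t" using m2_nonneg by (simp add: t_def)
  define X1 where "X1 = L * (max (sqrt t) 1 * (norm \<Sigma> / sqrt (real n)))"
  have X10: "0 \<le> X1" using L0 by (simp add: X1_def)
  \<comment> \<open>Doubling 48000 gives 96000, which is below \<open>310^2\<close>; the factor
    \<open>pi / 2\<close> is rounded up to 2, whence 620.\<close>
  have K_le: "K \<le> 620 * (p * X1)"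
  proof -
    have "rate n + norm \<Sigma> = norm \<Sigma> * (max (sqrt t) t + 1)"
      unfolding rate_eq_rank[OF S] t_def[symmetric] by (simp add: distrib_left)
    also have "\<dots> \<le> norm \<Sigma> * (2 * (max (sqrt t) 1)\<^sup>2)" by (intro mult_left_mono max_sqrt_bound t0) simp
    finally have "48000 * norm \<Sigma> * (rate n + norm \<Sigma>) / real n \<le> 48000 * norm \<Sigma> * (norm \<Sigma> * (2 * (max (sqrt t) 1)\<^sup>2)) / real n"
      by (intro divide_right_mono mult_left_mono) auto
    also have "\<dots> = 96000 * (max (sqrt t) 1 * (norm \<Sigma> / sqrt (real n)))\<^sup>2"
      by (simp add: power_mult_distrib power_divide power2_eq_square[of "norm \<Sigma>"])
    also have "\<dots> \<le> 310\<^sup>2 * (max (sqrt t) 1 * (norm \<Sigma> / sqrt (real n)))\<^sup>2" by (intro mult_right_mono) auto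
    also have "\<dots> = (310 * (max (sqrt t) 1 * (norm \<Sigma> / sqrt (real n))))\<^sup>2" by (rule power_mult_distrib[symmetric])
    finally have "sqrt (48000 * norm \<Sigma> * (rate n + norm \<Sigma>) / real n) \<le> 310 * (max (sqrt t) 1 * (norm \<Sigma> / sqrt (real n)))"
      by (intro real_le_lsqrt) auto
    then have "K \<le> 2 * (p * L * (310 * (max (sqrt t) 1 * (norm \<Sigma> / sqrt (real n)))))"
      unfolding K_def using p L0 S R pi_less_4 by (intro mult_mono mult_left_mono) auto
    then show ?thesis by (simp add: X1_def mult_ac)
  qed
  define b where "b = 9 * 24000\<^sup>2 * Y"
  have b0: "0 \<le> b" using Y0 by (simp add: b_def)
  have "(\<integral>\<^sup>+\<omega>. ennreal (\<bar>f (sample_cov n X \<omega>) - f \<Sigma>\<bar> powr p) \<partial>M)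
    = (\<integral>\<^sup>+x. ennreal (\<bar>F x - f \<Sigma>\<bar> powr p) \<partial>P)"
    using sample_cov_transfer[OF M n iid, of "\<lambda>A. ennreal (\<bar>f A - f \<Sigma>\<bar> powr p)"] Fm by (simp add: F_def[abs_def])
  also have "\<dots> \<le> (\<integral>\<^sup>+x. ennreal (2 powr p) * (ennreal (\<bar>F x - e\<bar> powr p) + ennreal (b powr p)) \<partial>P)"
  proof (rule nn_integral_mono)
    fix x
    have "\<bar>F x - f \<Sigma>\<bar> \<le> \<bar>F x - e\<bar> + b" using bias unfolding b_def by linarith
    then have "\<bar>F x - f \<Sigma>\<bar> powr p \<le> (\<bar>F x - e\<bar> + b) powr p" using p by (intro powr_mono2) auto
    also have "\<dots> \<le> 2 powr p * (\<bar>F x - e\<bar> powr p + b powr p)" using p b0 by (intro powr_add_le) auto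
    finally have "ennreal (\<bar>F x - f \<Sigma>\<bar> powr p) \<le> ennreal (2 powr p * (\<bar>F x - e\<bar> powr p + b powr p))" by (rule ennreal_leI)
    then show "ennreal (\<bar>F x - f \<Sigma>\<bar> powr p) \<le> ennreal (2 powr p) * (ennreal (\<bar>F x - e\<bar> powr p) + ennreal (b powr p))"
      by (simp add: ennreal_mult')
  qed
  also have "\<dots> = ennreal (2 powr p) * ((\<integral>\<^sup>+x. ennreal (\<bar>F x - e\<bar> powr p) \<partial>P) + ennreal (b powr p))"
    by (subst nn_integral_cmult, measurable, subst nn_integral_add, measurable)
      (simp add: P.emeasure_space_1[unfolded space_P])
  also have "\<dots> \<le> ennreal (2 powr p) * (ennreal (20 * K powr p) + ennreal (b powr p))"
    using conc by (intro mult_left_mono add_right_mono) auto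
  also have "\<dots> = ennreal (2 powr p * (20 * K powr p + b powr p))"
    by (simp add: ennreal_mult')
  also have "\<dots> \<le> ennreal ((4 * (20 * K + b)) powr p)"
    by (intro ennreal_leI sum_powr_le K0 b0 p)
  also have "\<dots> \<le> ennreal ((p * (3 * 10 ^ 10 * (X1 + Y))) powr p)"
  proof (intro ennreal_leI powr_mono2)
    have Yp: "Y \<le> p * Y" "0 \<le> p * Y" using mult_right_mono[OF p Y0] p Y0 by auto
    have pX: "0 \<le> p * X1" using p X10 by simp
    \<comment> \<open>The bias decides the final constant: \<open>4 * 9 * 24000^2\<close> is about
      2.1 times \<open>10^10\<close>, while the linear term only needs
      \<open>4 * 20 * 620 = 49600\<close>. Bounding Y by \<open>p * Y\<close> puts the bias, which
      does not grow with p, into the common form.\<close>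
    have "4 * (20 * K + b) \<le> 4 * (20 * (620 * (p * X1)) + 9 * 24000\<^sup>2 * (p * Y))"
      unfolding b_def using K_le Yp by (intro mult_left_mono add_mono) auto
    also have "\<dots> \<le> 3 * 10 ^ 10 * (p * X1) + 3 * 10 ^ 10 * (p * Y)"
      using pX Yp(2) by (simp add: mult.commute[of p])
    finally show "4 * (20 * K + b) \<le> p * (3 * 10 ^ 10 * (X1 + Y))" by (simp add: algebra_simps)
  qed (use p K0 b0 in auto)
  finally show ?thesis by (simp only: X1_def Y_def t_def)
qed

end

theorem corollary2p1:
  shows "\<exists>C. numerical_constant C \<and>
    (\<forall>(M :: 'a measure) (\<mu> :: ('e :: {banach, second_countable_topology}) measure)
      (\<Sigma> :: 'e dual_op) (n :: nat) (X :: nat \<Rightarrow> 'a \<Rightarrow> 'e) (f :: 'e dual_op \<Rightarrow> real) (\<rho> :: real).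
      prob_space M \<longrightarrow> 1 \<le> n \<longrightarrow> gaussian_law \<Sigma> \<mu> \<longrightarrow> iid_sample M n X \<mu> \<longrightarrow>
      0 < \<rho> \<longrightarrow> \<rho> \<le> 1 \<longrightarrow>
      (let r = effective_rank \<Sigma> \<mu>;
           \<eta> = (\<lambda>\<omega>. f (sample_cov n X \<omega>) - f \<Sigma>)
       in
        (holder_norm \<rho> f < \<top> \<longrightarrow>
          psi_norm (1 / \<rho>) M \<eta>
            \<le> ennreal C * (holder_norm \<rho> f *
                ennreal (norm \<Sigma> powr \<rho> * max (sqrt (r / n)) (r / n) powr \<rho>))) \<and>
        (\<forall>f' :: 'e dual_op \<Rightarrow> 'e dual_op \<Rightarrow>\<^sub>L real.
          holder_norm 1 f < \<top> \<longrightarrow>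
          (\<forall>A. (f has_derivative blinfun_apply (f' A)) (at A)) \<longrightarrow>
          continuous_on UNIV f' \<longrightarrow>
          holder_norm \<rho> f' < \<top> \<longrightarrow>
          psi_norm 1 M \<eta>
            \<le> ennreal C *
               (holder_norm 1 f * ennreal (max (sqrt (r / n)) 1 * (norm \<Sigma> / sqrt n))
                + holder_norm \<rho> f' *
                    ennreal (norm \<Sigma> powr (1 + \<rho>) *
                      max (sqrt (r / n)) (r / n) powr (1 + \<rho>))))))"
\<comment> \<open>This is the constant of the smooth case; the 108000 of the Hoelder case is far
  below it.\<close>
proof (intro exI[of _ "3 * 10 ^ 10"] conjI allI impI)
  show "numerical_constant (3 * 10 ^ 10)" by (simp add: numerical_constant_def)
next
  fix M :: "'a measure" and \<mu> :: "'e measure" and \<Sigma> :: "'e dual_op" and n :: nat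
    and X :: "nat \<Rightarrow> 'a \<Rightarrow> 'e" and f :: "'e dual_op \<Rightarrow> real" and \<rho> :: real
  assume M: "prob_space M" and n: "1 \<le> n" and law: "gaussian_law \<Sigma> \<mu>" and iid: "iid_sample M n X \<mu>"
    and \<rho>: "0 < \<rho>" "\<rho> \<le> 1"
  interpret gaussian \<Sigma> \<mu> by unfold_locales (rule law)
  define \<eta> where "\<eta> \<omega> = f (sample_cov n X \<omega>) - f \<Sigma>" for \<omega>
  have rank: "effective_rank \<Sigma> \<mu> = m2 / norm \<Sigma>" by (simp add: effective_rank_def m2_def)
  have part1: "psi_norm (1 / \<rho>) M \<eta> \<le> ennreal (3 * 10 ^ 10) * (holder_norm \<rho> f *
      ennreal (norm \<Sigma> powr \<rho> * max (sqrt (m2 / norm \<Sigma> / n)) (m2 / norm \<Sigma> / n) powr \<rho>))"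
    if fin: "holder_norm \<rho> f < \<top>"
  proof (cases "norm \<Sigma> = 0")
    case True
    then show ?thesis using psi_norm_degenerate[OF True M iid] by (simp add: \<eta>_def[abs_def])
  next
    case False
    then have S: "0 < norm \<Sigma>" by simp
    define H where "H = enn2real (holder_norm \<rho> f)"
    have H: "0 \<le> H" "holder_norm \<rho> f = ennreal H" using fin by (simp_all add: H_def)
    have holder: "\<bar>f A - f B\<bar> \<le> H * norm (A - B) powr \<rho>" for A B
      using Holder_bound[OF fin, of A B] by (simp add: H_def)
    have "psi_norm (1 / \<rho>) M \<eta> \<le> ennreal (108000 * (H * rate n powr \<rho>))"
      unfolding \<eta>_def
    proof (rule psi_norm_le)
      show "(\<integral>\<^sup>+\<omega>. ennreal (\<bar>f (sample_cov n X \<omega>) - f \<Sigma>\<bar> powr p) \<partial>M)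
        \<le> ennreal ((p powr (1 / (1 / \<rho>)) * (108000 * (H * rate n powr \<rho>))) powr p)" if "1 \<le> p" for p
        using Holder_functional_moment[OF M n iid S \<rho> that H(1) holder] by simp
    qed (use H in simp)
    also have "\<dots> \<le> ennreal (3 * 10 ^ 10 * (H * rate n powr \<rho>))"
      using H by (intro ennreal_leI mult_right_mono) auto
    also have "\<dots> = ennreal (3 * 10 ^ 10) * (holder_norm \<rho> f * ennreal (rate n powr \<rho>))"
      using H by (simp add: ennreal_mult')
    also have "rate n powr \<rho> = norm \<Sigma> powr \<rho> * max (sqrt (m2 / norm \<Sigma> / n)) (m2 / norm \<Sigma> / n) powr \<rho>"
      unfolding rate_eq_rank[OF S] by (rule powr_mult)
    finally show ?thesis .
  qed
  have part2: "psi_norm 1 M \<eta> \<le> ennreal (3 * 10 ^ 10) *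
      (holder_norm 1 f * ennreal (max (sqrt (m2 / norm \<Sigma> / n)) 1 * (norm \<Sigma> / sqrt n))
       + holder_norm \<rho> f' * ennreal (norm \<Sigma> powr (1 + \<rho>) * max (sqrt (m2 / norm \<Sigma> / n)) (m2 / norm \<Sigma> / n) powr (1 + \<rho>)))"
    if fin1: "holder_norm 1 f < \<top>" and deriv: "\<forall>A. (f has_derivative blinfun_apply (f' A)) (at A)"
      and cont: "continuous_on UNIV f'" and fin2: "holder_norm \<rho> f' < \<top>"
    for f' :: "'e dual_op \<Rightarrow> 'e dual_op \<Rightarrow>\<^sub>L real"
  proof (cases "norm \<Sigma> = 0")
    case True
    then show ?thesis using psi_norm_degenerate[OF True M iid] by (simp add: \<eta>_def[abs_def])
  next
    case False
    then have S: "0 < norm \<Sigma>" by simp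
    define L where "L = enn2real (holder_norm 1 f)"
    define H where "H = enn2real (holder_norm \<rho> f')"
    have L: "0 \<le> L" "holder_norm 1 f = ennreal L" using fin1 by (simp_all add: L_def)
    have H: "0 \<le> H" "holder_norm \<rho> f' = ennreal H" using fin2 by (simp_all add: H_def)
    have lip: "\<bar>f A - f B\<bar> \<le> L * norm (A - B)" for A B
      using Holder_bound[OF fin1, of A B] by (simp add: L_def)
    have holder: "norm (f' A - f' B) \<le> H * norm (A - B) powr \<rho>" for A B
      unfolding H_def by (rule Holder_bound[OF fin2])
    have d: "(f has_derivative blinfun_apply (f' A)) (at A)" for A using deriv by blast
    define a where "a = max (sqrt (m2 / norm \<Sigma> / n)) 1 * (norm \<Sigma> / sqrt n)"
    have a0: "0 \<le> a" by (simp add: a_def)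
    have "psi_norm 1 M \<eta> \<le> ennreal (3 * 10 ^ 10 * (L * a + H * rate n powr (1 + \<rho>)))"
      unfolding \<eta>_def
    proof (rule psi_norm_le)
      show "(\<integral>\<^sup>+\<omega>. ennreal (\<bar>f (sample_cov n X \<omega>) - f \<Sigma>\<bar> powr p) \<partial>M)
        \<le> ennreal ((p powr (1 / 1) * (3 * 10 ^ 10 * (L * a + H * rate n powr (1 + \<rho>)))) powr p)" if "1 \<le> p" for p
        using smooth_functional_moment[OF M n iid S \<rho> that L(1) H(1) lip d cont holder] that
        by (simp add: a_def)
    qed (use H L a0 in simp)
    also have "\<dots> = ennreal (3 * 10 ^ 10) * (holder_norm 1 f * ennreal a + holder_norm \<rho> f' * ennreal (rate n powr (1 + \<rho>)))"
      unfolding L(2) H(2) using L(1) H(1) a0 by (simp only: ennreal_mult' ennreal_plus mult_nonneg_nonneg powr_ge_zero zero_le_numeral zero_le_power)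
    also have "rate n powr (1 + \<rho>) = norm \<Sigma> powr (1 + \<rho>) * max (sqrt (m2 / norm \<Sigma> / n)) (m2 / norm \<Sigma> / n) powr (1 + \<rho>)"
      unfolding rate_eq_rank[OF S] by (rule powr_mult)
    finally show ?thesis by (simp only: a_def)
  qed
  show "let r = effective_rank \<Sigma> \<mu>; \<eta> = (\<lambda>\<omega>. f (sample_cov n X \<omega>) - f \<Sigma>) in
        (holder_norm \<rho> f < \<top> \<longrightarrow>
          psi_norm (1 / \<rho>) M \<eta>
            \<le> ennreal (3 * 10 ^ 10) * (holder_norm \<rho> f *
                ennreal (norm \<Sigma> powr \<rho> * max (sqrt (r / n)) (r / n) powr \<rho>))) \<and>
        (\<forall>f' :: 'e dual_op \<Rightarrow> 'e dual_op \<Rightarrow>\<^sub>L real.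
          holder_norm 1 f < \<top> \<longrightarrow>
          (\<forall>A. (f has_derivative blinfun_apply (f' A)) (at A)) \<longrightarrow>
          continuous_on UNIV f' \<longrightarrow>
          holder_norm \<rho> f' < \<top> \<longrightarrow>
          psi_norm 1 M \<eta>
            \<le> ennreal (3 * 10 ^ 10) *
               (holder_norm 1 f * ennreal (max (sqrt (r / n)) 1 * (norm \<Sigma> / sqrt n))
                + holder_norm \<rho> f' *
                    ennreal (norm \<Sigma> powr (1 + \<rho>) *
                      max (sqrt (r / n)) (r / n) powr (1 + \<rho>))))"
    unfolding Let_def rank using part1 part2 by (simp only: \<eta>_def[abs_def]) blast
qed

end
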